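(* Let $G$ be a finite graph with irreducible components $G_1,\dots,G_m$, and let $X$ be its graph C*-correspondence. Then \[h_X^s=\max\{\log\lambda_{G_1},\dots,\log\lambda_{G_m}\}.\] If $G$ has a zero sink component then $h_X=0$; otherwise \[h_X=\min\{\log\lambda_{G_s}:G_s\text{ is a non-zero sink irreducible component of }G\}.\]
   Context: $G$ is a finite directed graph with vertices $G^{(0)}$, edges $G^{(1)}$, source/range maps $s,r$; adjacency matrix $G_{ij}=\#\{e:s(e)=v_i,r(e)=v_j\}$. $A=C(G^{(0)})$ spanned by orthogonal projections $p_v$. Graph C*-correspondence $X$: spanned by $x_e$, $e\in G^{(1)}$, with $\langle x_e,x_f\rangle=\delta_{e,f}p_{s(f)}$, $p_vx_e=\delta_{v,r(e)}x_e$, $x_ep_v=\delta_{s(e),v}x_e$; it has finite rank. For a unit decomposition $x=\{x_1,\dots,x_d\}$ of $X$ (i.e. $\sum_i\theta_{x_i,x_i}=1_X$, $x_i$ in the unit ball) and words $\mu$, $x_\mu=x_{\mu_k}\otimes\cdots\otimes x_{\mu_1}$; $h_X^x=\limsup_k k^{-1}\log\|\sum_{|\mu|=k}\langle x_\mu,x_\mu\rangle\|_A$ (taken to be $0$ if eventually the norms vanish), $h_X^s=\inf_xh_X^x$. $\mathcal{T}_X$ is the Toeplitz–Pimsner algebra of $X$, $\sigma_r=\gamma_{e^{ir}}$ for its gauge action ($\gamma_z=\operatorname{Ad}u_z$ with $u_z=z^n$ on $X^{\otimes n}$ in the Fock space), and $h_X=\inf\{\beta>0:\mathcal{T}_X\text{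 has a }(\sigma,\beta)\text{-KMS state}\}$. Irreducible components: maximal strongly connected vertex classes, giving a block upper triangular form with irreducible diagonal blocks $G_1,\dots,G_m$ (a vertex on no cycle forms a zero component $[0]$); $\lambda_{G_s}$ is the spectral radius of $G_s$. $G_s$ is a sink if there is no edge from a vertex of $G_s$ to a vertex outside $G_s$. Convention: $\log 0:=0$. *)

theory Defs
  imports "HOL-Analysis.Analysis"
begin

text \<open>Finite directed graph: finite vertex type 'v, finite edge set E, source s, range r.
  Edges go from s e to r e.\<close>

definition adjm :: "'e set \<Rightarrow> ('e \<Rightarrow> 'v) \<Rightarrow> ('e \<Rightarrow> 'v) \<Rightarrow> 'v \<Rightarrow> 'v \<Rightarrow> nat" where
  "adjm E s r i j = card {e\<in>E. s e = i \<and> r e = j}"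

definition reach :: "'e set \<Rightarrow> ('e \<Rightarrow> 'v) \<Rightarrow> ('e \<Rightarrow> 'v) \<Rightarrow> ('v \<times> 'v) set" where
  "reach E s r = ((\<lambda>e. (s e, r e)) ` E)\<^sup>*"

definition comp_of :: "'e set \<Rightarrow> ('e \<Rightarrow> 'v) \<Rightarrow> ('e \<Rightarrow> 'v) \<Rightarrow> 'v \<Rightarrow> 'v set" where
  "comp_of E s r v = {w. (v, w) \<in> reach E s r \<and> (w, v) \<in> reach E s r}"

definition components :: "'e set \<Rightarrow> ('e \<Rightarrow> 'v) \<Rightarrow> ('e \<Rightarrow> 'v) \<Rightarrow> 'v set set" where
  "components E s r = range (comp_of E s r)"

definition is_sink :: "'e set \<Rightarrow> ('e \<Rightarrow> 'v) \<Rightarrow> ('e \<Rightarrow> 'v) \<Rightarrow> 'v set \<Rightarrow> bool" where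
  "is_sink E s r C \<longleftrightarrow> (\<forall>e\<in>E. s e \<in> C \<longrightarrow> r e \<in> C)"

definition zero_comp :: "'e set \<Rightarrow> ('e \<Rightarrow> 'v) \<Rightarrow> ('e \<Rightarrow> 'v) \<Rightarrow> 'v set \<Rightarrow> bool" where
  "zero_comp E s r C \<longleftrightarrow> (\<forall>i\<in>C. \<forall>j\<in>C. adjm E s r i j = 0)"

definition block_eigenvalues :: "'e set \<Rightarrow> ('e \<Rightarrow> 'v) \<Rightarrow> ('e \<Rightarrow> 'v) \<Rightarrow> 'v set \<Rightarrow> complex set" where
  "block_eigenvalues E s r C = {z. \<exists>w :: 'v \<Rightarrow> complex. (\<exists>i\<in>C. w i \<noteq> 0) \<and>
      (\<forall>i\<in>C. (\<Sum>j\<in>C. of_nat (adjm E s r i j) * w j) = z * w i)}"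

definition spec_rad :: "'e set \<Rightarrow> ('e \<Rightarrow> 'v) \<Rightarrow> ('e \<Rightarrow> 'v) \<Rightarrow> 'v set \<Rightarrow> real" where
  "spec_rad E s r C = Max (cmod ` block_eigenvalues E s r C)"

definition logc :: "real \<Rightarrow> real" where
  "logc x = (if x = 0 then 0 else ln x)"

text \<open>Elements of A = C(G^0) are functions 'v => complex; elements of X are
  coefficient functions 'e => complex (x = sum_e c_e x_e, only e in E matter).
  <x,y>(v) = sum over edges e with s e = v of conj(c_e) d_e;
  right action (x a)_e = x_e a(s e), left action (a x)_e = a(r e) x_e.\<close>

definition ipX :: "'e set \<Rightarrow> ('e \<Rightarrow> 'v) \<Rightarrow> ('e \<Rightarrow> complex) \<Rightarrow> ('e \<Rightarrow> complex) \<Rightarrow> 'v \<Rightarrow> complex" where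
  "ipX E s x y v = (\<Sum>e\<in>{e\<in>E. s e = v}. cnj (x e) * y e)"

definition normA :: "('v::finite \<Rightarrow> complex) \<Rightarrow> real" where
  "normA a = Max (range (\<lambda>v. cmod (a v)))"

text \<open>Unit decomposition x_0,...,x_(d-1): each x_i in the unit ball and
  sum_i theta_(x_i,x_i) = 1_X, i.e. sum_i x_i <x_i, z> = z for all z.\<close>
definition unit_decomp :: "'e set \<Rightarrow> ('e \<Rightarrow> 'v::finite) \<Rightarrow> nat \<Rightarrow> (nat \<Rightarrow> 'e \<Rightarrow> complex) \<Rightarrow> bool" where
  "unit_decomp E s d x \<longleftrightarrow>
     (\<forall>i<d. normA (ipX E s (x i) (x i)) \<le> 1) \<and>
     (\<forall>z. \<forall>e\<in>E. (\<Sum>i<d. x i e * ipX E s (x i) z (s e)) = z e)"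

text \<open>For a word mu = [mu_1,...,mu_k], <x_mu, x_mu> with
  x_mu = x_(mu_k) (x) ... (x) x_(mu_1), computed via the interior tensor product
  formula <xi (x) eta, xi (x) eta> = <eta, <xi,xi> eta>.\<close>
fun ipw :: "'e set \<Rightarrow> ('e \<Rightarrow> 'v) \<Rightarrow> ('e \<Rightarrow> 'v) \<Rightarrow> (nat \<Rightarrow> 'e \<Rightarrow> complex) \<Rightarrow> nat list \<Rightarrow> 'v \<Rightarrow> complex" where
  "ipw E s r x [] = (\<lambda>v. 1)"
| "ipw E s r x (m # \<mu>) = ipX E s (x m) (\<lambda>e. ipw E s r x \<mu> (r e) * x m e)"

definition words :: "nat \<Rightarrow> nat \<Rightarrow> nat list set" where
  "words d k = {\<mu>. length \<mu> = k \<and> set \<mu> \<subseteq> {..<d}}"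

definition hXx :: "'e set \<Rightarrow> ('e \<Rightarrow> 'v::finite) \<Rightarrow> ('e \<Rightarrow> 'v) \<Rightarrow> nat \<Rightarrow> (nat \<Rightarrow> 'e \<Rightarrow> complex) \<Rightarrow> ereal" where
  "hXx E s r d x = limsup (\<lambda>k. ereal (logc (normA (\<lambda>v. \<Sum>\<mu>\<in>words d k. ipw E s r x \<mu> v)) / real k))"

definition hXs :: "'e set \<Rightarrow> ('e \<Rightarrow> 'v::finite) \<Rightarrow> ('e \<Rightarrow> 'v) \<Rightarrow> ereal" where
  "hXs E s r = (INF dx\<in>{(d, x). unit_decomp E s d x}. hXx E s r (fst dx) (snd dx))"

text \<open>The Fock module F(X) = direct sum of X^(tensor n) has basis x_mu for paths mu
  (n = 0: the projections p_v). A path is (v, es): v its source vertex, es = [mu_1,...,mu_n]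
  a composable edge list with s(mu_1) = v and s(mu_(i+1)) = r(mu_i).
  Since A = C(G^0) is finite dimensional, adjointable operators on F(X) are the bounded
  operators on the Hilbert space l^2(paths) commuting with the right A-action; T_X is the
  C*-algebra generated by the creation operators T_(x_e) and the left action of A,
  realised here in B(l^2(paths)).\<close>

definition is_path :: "'e set \<Rightarrow> ('e \<Rightarrow> 'v) \<Rightarrow> ('e \<Rightarrow> 'v) \<Rightarrow> 'v \<times> 'e list \<Rightarrow> bool" where
  "is_path E s r p \<longleftrightarrow> (case p of (v, es) \<Rightarrow> set es \<subseteq> E \<and> (es \<noteq> [] \<longrightarrow> s (hd es) = v) \<and>
      (\<forall>i. Suc i < length es \<longrightarrow> r (es ! i) = s (es ! Suc i)))"

definition prange :: "('e \<Rightarrow> 'v) \<Rightarrow> 'v \<times> 'e list \<Rightarrow> 'v" where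
  "prange r p = (case p of (v, es) \<Rightarrow> if es = [] then v else r (last es))"

type_synonym ('v, 'e) vec = "'v \<times> 'e list \<Rightarrow> complex"
type_synonym ('v, 'e) op = "('v, 'e) vec \<Rightarrow> ('v, 'e) vec"

definition l2 :: "'e set \<Rightarrow> ('e \<Rightarrow> 'v) \<Rightarrow> ('e \<Rightarrow> 'v) \<Rightarrow> ('v, 'e) vec set" where
  "l2 E s r = {f. (\<forall>p. \<not> is_path E s r p \<longrightarrow> f p = 0) \<and> (\<lambda>p. (cmod (f p))\<^sup>2) summable_on UNIV}"

definition hnorm :: "('v, 'e) vec \<Rightarrow> real" where
  "hnorm f = sqrt (infsum (\<lambda>p. (cmod (f p))\<^sup>2) UNIV)"

definition hinner :: "('v, 'e) vec \<Rightarrow> ('v, 'e) vec \<Rightarrow> complex" where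
  "hinner f g = infsum (\<lambda>p. cnj (f p) * g p) UNIV"

definition bounded_op :: "'e set \<Rightarrow> ('e \<Rightarrow> 'v) \<Rightarrow> ('e \<Rightarrow> 'v) \<Rightarrow> ('v, 'e) op \<Rightarrow> bool" where
  "bounded_op E s r T \<longleftrightarrow>
     (\<forall>f\<in>l2 E s r. T f \<in> l2 E s r) \<and>
     (\<forall>f\<in>l2 E s r. \<forall>g\<in>l2 E s r. \<forall>c. T (\<lambda>p. c * f p + g p) = (\<lambda>p. c * T f p + T g p)) \<and>
     (\<exists>K. \<forall>f\<in>l2 E s r. hnorm (T f) \<le> K * hnorm f) \<and>
     (\<forall>f. f \<notin> l2 E s r \<longrightarrow> T f = (\<lambda>_. 0))"

definition opnorm :: "'e set \<Rightarrow> ('e \<Rightarrow> 'v) \<Rightarrow> ('e \<Rightarrow> 'v) \<Rightarrow> ('v, 'e) op \<Rightarrow> real" where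
  "opnorm E s r T = Sup {hnorm (T f) | f. f \<in> l2 E s r \<and> hnorm f \<le> 1}"

definition adjop :: "'e set \<Rightarrow> ('e \<Rightarrow> 'v) \<Rightarrow> ('e \<Rightarrow> 'v) \<Rightarrow> ('v, 'e) op \<Rightarrow> ('v, 'e) op" where
  "adjop E s r T = (THE S. bounded_op E s r S \<and>
      (\<forall>f\<in>l2 E s r. \<forall>g\<in>l2 E s r. hinner (T f) g = hinner f (S g)))"

definition op_add :: "('v, 'e) op \<Rightarrow> ('v, 'e) op \<Rightarrow> ('v, 'e) op" where
  "op_add S T = (\<lambda>f p. S f p + T f p)"

definition op_scale :: "complex \<Rightarrow> ('v, 'e) op \<Rightarrow> ('v, 'e) op" where
  "op_scale c T = (\<lambda>f p. c * T f p)"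

definition op_diff :: "('v, 'e) op \<Rightarrow> ('v, 'e) op \<Rightarrow> ('v, 'e) op" where
  "op_diff S T = (\<lambda>f p. S f p - T f p)"

definition idop :: "'e set \<Rightarrow> ('e \<Rightarrow> 'v) \<Rightarrow> ('e \<Rightarrow> 'v) \<Rightarrow> ('v, 'e) op" where
  "idop E s r f = (if f \<in> l2 E s r then f else (\<lambda>_. 0))"

text \<open>Creation operator T_(x_e): x_mu |-> x_e (x) x_mu (append e at the end of the path).\<close>
definition creation :: "'e set \<Rightarrow> ('e \<Rightarrow> 'v) \<Rightarrow> ('e \<Rightarrow> 'v) \<Rightarrow> 'e \<Rightarrow> ('v, 'e) op" where
  "creation E s r e f = (if f \<in> l2 E s r then
      (\<lambda>(v, es). if is_path E s r (v, es) \<and> es \<noteq> [] \<and> last es = e then f (v, butlast es) else 0)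
    else (\<lambda>_. 0))"

definition leftproj :: "'e set \<Rightarrow> ('e \<Rightarrow> 'v) \<Rightarrow> ('e \<Rightarrow> 'v) \<Rightarrow> 'v \<Rightarrow> ('v, 'e) op" where
  "leftproj E s r w f = (if f \<in> l2 E s r then (\<lambda>p. if prange r p = w then f p else 0) else (\<lambda>_. 0))"

inductive_set polyalg :: "'e set \<Rightarrow> ('e \<Rightarrow> 'v) \<Rightarrow> ('e \<Rightarrow> 'v) \<Rightarrow> ('v, 'e) op set"
  for E s r where
  gen_edge: "e \<in> E \<Longrightarrow> creation E s r e \<in> polyalg E s r"
| gen_vertex: "leftproj E s r w \<in> polyalg E s r"
| adj: "T \<in> polyalg E s r \<Longrightarrow> adjop E s r T \<in> polyalg E s r"
| add: "S \<in> polyalg E s r \<Longrightarrow> T \<in> polyalg E s r \<Longrightarrow> op_add S T \<in> polyalg E s r"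
| scale: "T \<in> polyalg E s r \<Longrightarrow> op_scale c T \<in> polyalg E s r"
| comp: "S \<in> polyalg E s r \<Longrightarrow> T \<in> polyalg E s r \<Longrightarrow> S \<circ> T \<in> polyalg E s r"

definition toeplitz :: "'e set \<Rightarrow> ('e \<Rightarrow> 'v) \<Rightarrow> ('e \<Rightarrow> 'v) \<Rightarrow> ('v, 'e) op set" where
  "toeplitz E s r = {T. bounded_op E s r T \<and>
      (\<forall>\<epsilon>>0. \<exists>S\<in>polyalg E s r. opnorm E s r (op_diff T S) < \<epsilon>)}"

definition gauge_unitary :: "'e set \<Rightarrow> ('e \<Rightarrow> 'v) \<Rightarrow> ('e \<Rightarrow> 'v) \<Rightarrow> real \<Rightarrow> ('v, 'e) op" where
  "gauge_unitary E s r t f = (if f \<in> l2 E s r then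
      (\<lambda>(v, es). exp (\<i> * of_real t) ^ length es * f (v, es)) else (\<lambda>_. 0))"

definition sigma :: "'e set \<Rightarrow> ('e \<Rightarrow> 'v) \<Rightarrow> ('e \<Rightarrow> 'v) \<Rightarrow> real \<Rightarrow> ('v, 'e) op \<Rightarrow> ('v, 'e) op" where
  "sigma E s r t T = gauge_unitary E s r t \<circ> T \<circ> gauge_unitary E s r (- t)"

definition is_state :: "'e set \<Rightarrow> ('e \<Rightarrow> 'v) \<Rightarrow> ('e \<Rightarrow> 'v) \<Rightarrow> (('v, 'e) op \<Rightarrow> complex) \<Rightarrow> bool" where
  "is_state E s r \<phi> \<longleftrightarrow>
     (\<forall>S\<in>toeplitz E s r. \<forall>T\<in>toeplitz E s r. \<forall>c. \<phi> (op_add (op_scale c S) T) = c * \<phi> S + \<phi> T) \<and>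
     (\<forall>T\<in>toeplitz E s r. \<phi> (adjop E s r T \<circ> T) \<in> \<real> \<and> Re (\<phi> (adjop E s r T \<circ> T)) \<ge> 0) \<and>
     \<phi> (idop E s r) = 1"

text \<open>(sigma, beta)-KMS state (Bratteli--Robinson 5.3.1 strip formulation).\<close>
definition is_KMS :: "'e set \<Rightarrow> ('e \<Rightarrow> 'v) \<Rightarrow> ('e \<Rightarrow> 'v) \<Rightarrow> real \<Rightarrow> (('v, 'e) op \<Rightarrow> complex) \<Rightarrow> bool" where
  "is_KMS E s r \<beta> \<phi> \<longleftrightarrow> is_state E s r \<phi> \<and>
     (\<forall>a\<in>toeplitz E s r. \<forall>b\<in>toeplitz E s r. \<exists>F :: complex \<Rightarrow> complex.
        continuous_on {z. 0 \<le> Im z \<and> Im z \<le> \<beta>} F \<and>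
        F holomorphic_on {z. 0 < Im z \<and> Im z < \<beta>} \<and>
        bounded (F ` {z. 0 \<le> Im z \<and> Im z \<le> \<beta>}) \<and>
        (\<forall>t::real. F (of_real t) = \<phi> (a \<circ> sigma E s r t b) \<and>
                   F (of_real t + \<i> * of_real \<beta>) = \<phi> (sigma E s r t b \<circ> a)))"

definition hX :: "'e set \<Rightarrow> ('e \<Rightarrow> 'v) \<Rightarrow> ('e \<Rightarrow> 'v) \<Rightarrow> real" where
  "hX E s r = Inf {\<beta>. \<beta> > 0 \<and> (\<exists>\<phi>. is_KMS E s r \<beta> \<phi>)}"

end

(* For every unit decomposition the sum of <x_mu, x_mu> over the words mu of length k is the
   function counting the walks of length k from each vertex, so h_X^s is the exponential growth
   rate of these counts. A Perron vector of a component bounds the growth from below; scaling the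
   Perron vectors of all components by powers of a small number that decrease along the edges
   between components gives a positive vector u with G u <= (lambda + eps) u, which bounds it
   from above.

   Let phi be a (sigma, beta)-KMS state and m_w = phi(p_w). The KMS condition gives
   phi(T_e T_e^* ) = exp(-beta) m_{s(e)}, and the sum of T_e T_e^* over the edges e into w is at
   most p_w, so m G <= exp(beta) m. The support of m is closed under following edges, hence contains a
   sink component C, and pairing m with the Perron vector of C gives lambda_C <= exp(beta).
   Conversely, if lambda_C < exp(beta) for a sink component C and v is a vertex of C, the weights
   exp(-beta |p|) of the paths p starting at v are summable, and the corresponding Gibbs state on
   the Fock space is KMS. The infimum defining h_X is insensitive to the borderline case. *)
theory Submission
  imports Defs "HOL-Complex_Analysis.Cauchy_Integral_Formula"
begin

section \<open>Perron vectors of the irreducible components\<close>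

text \<open>\<open>spec_rad\<close> is a maximum over a set of complex eigenvalues, so that set must
  be known to be nonempty and finite. A positive eigenvector supplies an eigenvalue that dominates
  all others in modulus, the characteristic polynomial supplies finiteness. As the entries of
  \<open>G\<close> are natural numbers, a component has spectral radius 0 or at least 1, so no
  logarithm is negative under the convention log 0 = 0. On the operator side \<open>adjop\<close> is
  a definite description, so adjoints are first built from matrix coefficients on the path basis.
  Necessity tests the KMS condition on one pair of generators only, but the strip formulation does
  not hand over the factor exp(-beta): the constants on the two edges of the strip have to be
  compared. Sufficiency asks for a strip function for all pairs in the norm closure. No density
  argument is made: the function is a double series over matrix coefficients that converges
  absolutely for any two bounded operators. Its value on the upper edge is right because the
  elements of the algebra preserve source vertices, so cutting down to the paths from one vertex
  commutes with them.\<close>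

locale finite_graph =
  fixes E :: "'e set" and s r :: "'e \<Rightarrow> 'v::finite"
  assumes finite_E: "finite E"
begin

abbreviation G :: "'v \<Rightarrow> 'v \<Rightarrow> nat" where
  "G \<equiv> adjm E s r"

lemma sum_out_edges:
  fixes f :: "'v \<Rightarrow> 'a::comm_semiring_1"
  shows "(\<Sum>e\<in>{e\<in>E. s e = v}. f (r e)) = (\<Sum>w\<in>UNIV. of_nat (G v w) * f w)"
proof -
  have "(\<Sum>e\<in>{e\<in>E. s e = v}. f (r e)) = (\<Sum>w\<in>UNIV. \<Sum>e\<in>{e\<in>{e\<in>E. s e = v}. r e = w}. f (r e))"
    using finite_E by (intro sum.group[symmetric]) auto
  also have "\<dots> = (\<Sum>w\<in>UNIV. of_nat (G v w) * f w)"
  proof (intro sum.cong refl)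
    fix w
    have "(\<Sum>e\<in>{e\<in>{e\<in>E. s e = v}. r e = w}. f (r e)) = (\<Sum>e\<in>{e\<in>E. s e = v \<and> r e = w}. f w)"
      by (intro sum.cong) auto
    then show "(\<Sum>e\<in>{e\<in>{e\<in>E. s e = v}. r e = w}. f (r e)) = of_nat (G v w) * f w"
      by (simp add: adjm_def)
  qed
  finally show ?thesis .
qed

section \<open>Reachability and strongly connected components\<close>

lemma reach_refl [simp]: "(v, v) \<in> reach E s r"
  by (simp add: reach_def)

lemma reach_trans: "(u, v) \<in> reach E s r \<Longrightarrow> (v, w) \<in> reach E s r \<Longrightarrow> (u, w) \<in> reach E s r"
  by (auto simp: reach_def)

lemma adj_imp_reach: "G v w > 0 \<Longrightarrow> (v, w) \<in> reach E s r"
  unfolding adjm_def reach_def by (auto simp: card_gt_0_iff)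

text \<open>Keeping \<open>(y, w) \<in> reach E s r\<close> in the step lets
  \<open>component_convex\<close> show that a path between two vertices of a component never leaves
  it.\<close>

lemma reach_induct_adj [consumes 1, case_names refl step]:
  assumes "(v, w) \<in> reach E s r"
    and "P w" and "\<And>x y. G x y > 0 \<Longrightarrow> (y, w) \<in> reach E s r \<Longrightarrow> P y \<Longrightarrow> P x"
  shows "P v"
  using assms(1) unfolding reach_def
proof (induction rule: converse_rtrancl_induct)
  case (step x y)
  then obtain e where "e \<in> E" "s e = x" "r e = y" by auto
  then have "G x y > 0" using finite_E by (auto simp: adjm_def card_gt_0_iff)
  with step show ?case using assms(3) by (auto simp: reach_def)
qed (fact assms(2))

lemma comp_of_self [simp]: "v \<in> comp_of E s r v"
  by (simp add: comp_of_def)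

lemma comp_of_eq: "w \<in> comp_of E s r v \<Longrightarrow> comp_of E s r w = comp_of E s r v"
  unfolding comp_of_def using reach_trans by blast

lemma components_eq_comp_of:
  "C \<in> components E s r \<Longrightarrow> v \<in> C \<Longrightarrow> C = comp_of E s r v"
  unfolding components_def using comp_of_eq by blast

lemma comp_of_in_components [simp]: "comp_of E s r v \<in> components E s r"
  by (simp add: components_def)

lemma finite_components [simp]: "finite (components E s r)"
  by (simp add: components_def)

lemma component_nonempty: "C \<in> components E s r \<Longrightarrow> C \<noteq> {}"
  unfolding components_def using comp_of_self by blast

lemma component_reach:
  "C \<in> components E s r \<Longrightarrow> x \<in> C \<Longrightarrow> w \<in> C \<Longrightarrow> (x, w) \<in> reach E s r"
  using components_eq_comp_of[of C x] by (auto simp: comp_of_def)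

lemma component_convex:
  assumes C: "C \<in> components E s r" and "x \<in> C" "w \<in> C" "(x, y) \<in> reach E s r" "(y, w) \<in> reach E s r"
  shows "y \<in> C"
proof -
  have "(y, x) \<in> reach E s r"
    using assms(5) component_reach[OF C assms(3,2)] by (rule reach_trans)
  then have "y \<in> comp_of E s r x" using assms by (simp add: comp_of_def)
  then show ?thesis using components_eq_comp_of[OF C assms(2)] by simp
qed

lemma exists_perron_vector:
  assumes C: "C \<in> components E s r"
  obtains lam :: real and h where "lam \<ge> 0" "\<And>i. i \<in> C \<Longrightarrow> h i > 0"
    "\<And>i. i \<in> C \<Longrightarrow> (\<Sum>j\<in>C. real (G i j) * h j) = lam * h i"
proof -
  \<comment> \<open>Brouwer's theorem for \<open>x \<mapsto> (x + Gx) / \<parallel>x + Gx\<parallel>\<^sub>1\<close> on the simplex over \<open>C\<close>; adding \<open>x\<close> avoids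
    division by zero\<close>
  obtain v0 where v0: "v0 \<in> C" using component_nonempty[OF C] by blast
  define S where "S = {x :: real^'v. (\<forall>i. 0 \<le> x $ i) \<and> (\<forall>i\<in>-C. x $ i = 0) \<and> (\<Sum>i\<in>UNIV. x $ i) = 1}"
  define N where "N x i = x $ i + (if i \<in> C then \<Sum>j\<in>C. real (G i j) * x $ j else 0)" for x :: "real^'v" and i
  define f where "f x = (\<chi> i. N x i / (\<Sum>i\<in>UNIV. N x i))" for x
  have N_ge: "N x i \<ge> x $ i" if "x \<in> S" for x i
    using that by (auto simp: N_def S_def intro!: sum_nonneg)
  have sumN: "(\<Sum>i\<in>UNIV. N x i) \<ge> 1" if "x \<in> S" for x
  proof -
    have "1 = (\<Sum>i\<in>UNIV. x $ i)" using that by (simp add: S_def)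
    also have "\<dots> \<le> (\<Sum>i\<in>UNIV. N x i)" using N_ge[OF that] by (intro sum_mono)
    finally show ?thesis .
  qed
  have "compact S"
  proof -
    have "closed S"
      unfolding S_def Ball_def by (intro closed_Collect_conj closed_Collect_all closed_Collect_imp closed_Collect_le closed_Collect_eq
          continuous_intros) auto
    moreover have "bounded S"
    proof (rule bounded_subset[OF bounded_cbox])
      show "S \<subseteq> cbox 0 1"
      proof
        fix x assume x: "x \<in> S"
        have "x $ i \<le> 1" for i
          using x member_le_sum[of i UNIV "\<lambda>i. x $ i"] by (auto simp: S_def)
        then show "x \<in> cbox 0 1" using x by (auto simp: S_def mem_box_cart)
      qed
    qed
    ultimately show ?thesis by (simp add: compact_eq_bounded_closed)
  qed
  moreover have "convex S"
    by (auto simp: convex_def S_def sum.distrib simp flip: sum_distrib_left)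
  moreover have "S \<noteq> {}"
  proof -
    have "axis v0 1 \<in> S" using v0 by (auto simp: S_def axis_def)
    then show ?thesis by blast
  qed
  moreover have "continuous_on S f"
  proof -
    have "continuous_on S (\<lambda>x. N x i)" for i
      unfolding N_def by (cases "i \<in> C") (auto intro!: continuous_intros)
    then show ?thesis
      unfolding f_def by (intro continuous_on_vec_lambda continuous_intros) (use sumN in fastforce)+
  qed
  moreover have "f \<in> S \<rightarrow> S"
  proof
    fix x assume x: "x \<in> S"
    have "N x i \<ge> 0" for i using N_ge[OF x, of i] x by (auto simp: S_def intro: order_trans)
    then show "f x \<in> S"
      using sumN[OF x] x
      by (auto simp: S_def f_def N_def simp flip: sum_divide_distrib)
  qed
  ultimately obtain x where x: "x \<in> S" "f x = x"
    using brouwer by blast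
  \<comment> \<open>At the fixed point the vector \<open>N x\<close> is \<open>x\<close> times its
    own sum, so this sum is an eigenvalue of identity plus block; the subtracted 1 belongs to the
    identity.\<close>
  define lam where "lam = (\<Sum>i\<in>UNIV. N x i) - 1"
  have eig: "(\<Sum>j\<in>C. real (G i j) * x $ j) = lam * x $ i" if "i \<in> C" for i
  proof -
    have "f x $ i = x $ i" using x by simp
    then have "N x i = x $ i * (\<Sum>i\<in>UNIV. N x i)"
      using sumN[OF x(1)] by (simp add: f_def field_simps)
    with that show ?thesis by (simp add: N_def lam_def algebra_simps)
  qed
  have x0: "x $ i \<ge> 0" for i using x by (simp add: S_def)
  \<comment> \<open>A vanishing sum of nonnegative terms has only zero terms, so a zero entry passes
    to the out-neighbours inside \<open>C\<close>. Strong connectivity then spreads it over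
    \<open>C\<close>, against total mass 1.\<close>
  have zero_step: "x $ j = 0" if "i \<in> C" "j \<in> C" "G i j > 0" "x $ i = 0" for i j
  proof -
    have "(\<Sum>j\<in>C. real (G i j) * x $ j) = 0" using eig[OF that(1)] that by simp
    then have "real (G i j) * x $ j = 0"
      using that x0 by (subst (asm) sum_nonneg_eq_0_iff) auto
    then show ?thesis using that by simp
  qed
  have pos: "x $ i > 0" if i: "i \<in> C" for i
  proof (rule ccontr)
    assume "\<not> x $ i > 0"
    then have xi: "x $ i = 0" using x0[of i] by simp
    have "x $ k = 0" if k: "k \<in> C" for k
    proof -
      have "(i, k) \<in> reach E s r" using component_reach[OF C i k] .
      then have "i \<in> C \<longrightarrow> x $ i = 0 \<longrightarrow> x $ k = 0"
      proof (induction rule: reach_induct_adj)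
        case (step a b)
        then show ?case using component_convex[OF C _ k, of a b] zero_step adj_imp_reach by blast
      qed auto
      then show ?thesis using i xi by blast
    qed
    then have "x $ k = 0" for k using x by (cases "k \<in> C") (auto simp: S_def)
    then show False using x by (simp add: S_def)
  qed
  show ?thesis
  proof (rule that[of lam "\<lambda>i. x $ i"])
    show "lam \<ge> 0" using sumN[OF x(1)] by (simp add: lam_def)
  qed (use pos eig in auto)
qed

text \<open>The boundedness hypothesis serves only to rule out that the characteristic
  polynomial is the zero polynomial.\<close>

lemma finite_block_eigenvalues:
  assumes "\<And>z. z \<in> block_eigenvalues E s r C \<Longrightarrow> cmod z \<le> B"
  shows "finite (block_eigenvalues E s r C)"
proof -
  \<comment> \<open>The characteristic polynomial of the block by the Leibniz formula. The block is
    padded with an identity outside \<open>C\<close>, so that the matrix is indexed by the whole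
    type \<open>'v\<close>.\<close>
  define q :: "complex poly" where "q = (\<Sum>p | p permutes (UNIV :: 'v set). of_int (sign p) * (\<Prod>i\<in>UNIV.
    if i \<in> C \<and> p i \<in> C then [:of_nat (G i (p i)), if i = p i then -1 else 0:]
    else if i = p i then 1 else 0))"
  define M :: "complex \<Rightarrow> complex^'v^'v" where
    "M z = (\<chi> i j. if i \<in> C \<and> j \<in> C then of_nat (G i j) - (if i = j then z else 0) else if i = j then 1 else 0)" for z
  have q: "poly q z = det (M z)" for z
    unfolding q_def det_def poly_sum
    by (intro sum.cong refl) (auto simp: poly_prod M_def intro!: prod.cong)
  have ker: "det (M z) = 0 \<longleftrightarrow> z \<in> block_eigenvalues E s r C" for z
  proof -
    have mult: "(M z *v x) $ i = (if i \<in> C then (\<Sum>j\<in>C. of_nat (G i j) * x $ j) - z * x $ i else x $ i)" for x i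
    proof (cases "i \<in> C")
      case True
      have "(M z *v x) $ i = (\<Sum>j\<in>UNIV. if j \<in> C then of_nat (G i j) * x $ j - (if i = j then z * x $ j else 0) else 0)"
        using True by (auto simp: matrix_vector_mult_def M_def algebra_simps intro!: sum.cong)
      also have "\<dots> = (\<Sum>j\<in>C. of_nat (G i j) * x $ j - (if i = j then z * x $ j else 0))"
        by (simp add: sum.If_cases)
      finally show ?thesis using True by (simp add: sum_subtractf)
    next
      case False
      have "(M z *v x) $ i = (\<Sum>j\<in>UNIV. if i = j then x $ j else 0)"
        unfolding matrix_vector_mult_def M_def vec_lambda_beta using False by (intro sum.cong) auto
      then show ?thesis using False by simp
    qed
    have "det (M z) = 0 \<longleftrightarrow> (\<exists>x. x \<noteq> 0 \<and> M z *v x = 0)"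
      using invertible_det_nz[of "M z"] matrix_left_invertible_ker[of "M z"] invertible_left_inverse[of "M z"] by blast
    also have "\<dots> \<longleftrightarrow> z \<in> block_eigenvalues E s r C"
    proof
      assume "\<exists>x. x \<noteq> 0 \<and> M z *v x = 0"
      then obtain x where x: "x \<noteq> 0" "M z *v x = 0" by blast
      then have "(M z *v x) $ i = 0" for i by simp
      then have "(if i \<in> C then (\<Sum>j\<in>C. of_nat (G i j) * x $ j) - z * x $ i else x $ i) = 0" for i
        using mult by simp
      then have *: "(i \<in> C \<longrightarrow> (\<Sum>j\<in>C. of_nat (G i j) * x $ j) = z * x $ i) \<and> (i \<notin> C \<longrightarrow> x $ i = 0)" for i
        by (metis eq_iff_diff_eq_0)
      moreover obtain i where "x $ i \<noteq> 0" using x by (auto simp: vec_eq_iff)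
      ultimately show "z \<in> block_eigenvalues E s r C"
        unfolding block_eigenvalues_def by (auto intro!: exI[of _ "\<lambda>i. x $ i"] bexI[of _ i])
    next
      assume "z \<in> block_eigenvalues E s r C"
      then obtain w i where w: "i \<in> C" "w i \<noteq> 0" "\<forall>i\<in>C. (\<Sum>j\<in>C. of_nat (G i j) * w j) = z * w i"
        by (auto simp: block_eigenvalues_def)
      define x where "x = (\<chi> i. if i \<in> C then w i else 0)"
      have "M z *v x = 0"
        using w by (simp add: vec_eq_iff mult x_def)
      moreover have "x \<noteq> 0" using w by (auto simp: x_def vec_eq_iff)
      ultimately show "\<exists>x. x \<noteq> 0 \<and> M z *v x = 0" by blast
    qed
    finally show ?thesis .
  qed
  have "q \<noteq> 0"
  proof
    assume "q = 0"
    define z where "z = complex_of_real (\<bar>B\<bar> + 1)"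
    have "poly q z = 0" using \<open>q = 0\<close> by simp
    then have "cmod z \<le> B" using q ker assms by auto
    moreover have "cmod z = \<bar>B\<bar> + 1" unfolding z_def norm_of_real by simp
    ultimately show False by simp
  qed
  then have "finite {z. poly q z = 0}" by (rule poly_roots_finite)
  then show ?thesis by (simp add: q ker)
qed

text \<open>For an eigenvector \<open>w\<close> let \<open>c\<close> be the largest ratio of
  \<open>cmod (w i)\<close> to \<open>h i\<close>. At a vertex where it is attained, the triangle
  inequality and the equation for \<open>h\<close> give
  \<open>cmod z * c * h i \<le> lam * c * h i\<close>. Hence \<open>lam\<close>, itself an
  eigenvalue, has the largest modulus.\<close>

lemma spec_rad_eq:
  fixes lam :: real
  assumes C: "C \<noteq> {}" and lam: "lam \<ge> 0" and h: "\<And>i. i \<in> C \<Longrightarrow> h i > 0"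
    and eig: "\<And>i. i \<in> C \<Longrightarrow> (\<Sum>j\<in>C. real (G i j) * h j) = lam * h i"
  shows "spec_rad E s r C = lam"
proof -
  have bound: "cmod z \<le> lam" if z: "z \<in> block_eigenvalues E s r C" for z
  proof -
    obtain w i0 where w: "i0 \<in> C" "w i0 \<noteq> 0" "\<And>i. i\<in>C \<Longrightarrow> (\<Sum>j\<in>C. of_nat (G i j) * w j) = z * w i"
      using z by (auto simp: block_eigenvalues_def)
    define c where "c = Max ((\<lambda>i. cmod (w i) / h i) ` C)"
    have "c \<in> (\<lambda>i. cmod (w i) / h i) ` C" unfolding c_def using C by (intro Max_in) auto
    then obtain i where i: "i \<in> C" "c = cmod (w i) / h i" by blast
    have c: "cmod (w j) / h j \<le> c" if "j \<in> C" for j unfolding c_def using that by (intro Max_ge) auto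
    have "c > 0" using c[OF w(1)] h[OF w(1)] w(2) by (smt (verit) divide_pos_pos zero_less_norm_iff)
    have "cmod z * (c * h i) = cmod (z * w i)" using i h[OF i(1)] by (simp add: norm_mult)
    also have "\<dots> = cmod (\<Sum>j\<in>C. of_nat (G i j) * w j)" using w(3)[OF i(1)] by simp
    also have "\<dots> \<le> (\<Sum>j\<in>C. real (G i j) * (c * h j))"
    proof (rule sum_norm_le)
      fix j assume "j \<in> C"
      then have "cmod (w j) \<le> c * h j" using c h by (simp add: divide_le_eq)
      then show "cmod (of_nat (G i j) * w j) \<le> real (G i j) * (c * h j)"
        by (simp add: norm_mult mult_left_mono)
    qed
    also have "\<dots> = c * (\<Sum>j\<in>C. real (G i j) * h j)" by (simp add: sum_distrib_left mult_ac)
    also have "\<dots> = lam * (c * h i)" using eig[OF i(1)] by simp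
    finally show ?thesis using \<open>c > 0\<close> h[OF i(1)] by simp
  qed
  have "complex_of_real lam \<in> block_eigenvalues E s r C"
  proof -
    have "(\<Sum>j\<in>C. of_nat (G i j) * complex_of_real (h j)) = of_real lam * of_real (h i)" if "i \<in> C" for i
      using arg_cong[OF eig[OF that], of complex_of_real] by simp
    moreover have "\<exists>i\<in>C. complex_of_real (h i) \<noteq> 0" using C h by fastforce
    ultimately show ?thesis by (auto simp: block_eigenvalues_def intro!: exI[of _ "\<lambda>i. complex_of_real (h i)"])
  qed
  moreover have "cmod (complex_of_real lam) = lam" using lam by simp
  ultimately have "lam \<in> cmod ` block_eigenvalues E s r C" by (metis imageI)
  then show ?thesis unfolding spec_rad_def
    using finite_block_eigenvalues[OF bound] bound by (intro Max_eqI) auto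
qed

lemma perron_vector:
  assumes C: "C \<in> components E s r"
  obtains h where "\<And>i. i \<in> C \<Longrightarrow> h i > 0"
    "\<And>i. i \<in> C \<Longrightarrow> (\<Sum>j\<in>C. real (G i j) * h j) = spec_rad E s r C * h i"
  using exists_perron_vector[OF C] spec_rad_eq[OF component_nonempty[OF C]] by metis

lemma spec_rad_nonneg: "C \<in> components E s r \<Longrightarrow> spec_rad E s r C \<ge> 0"
  using exists_perron_vector[of C] spec_rad_eq[OF component_nonempty[of C]] by metis

text \<open>Some vertex \<open>a\<close> of \<open>C\<close> has an edge inside \<open>C\<close>.
  Any other vertex of \<open>C\<close> has a path to \<open>a\<close>, whose first edge stays in
  \<open>C\<close> by convexity.\<close>

lemma nonzero_comp_out_edge:
  assumes C: "C \<in> components E s r" and nz: "\<not> zero_comp E s r C" and i: "i \<in> C"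
  shows "\<exists>j\<in>C. G i j > 0"
proof -
  obtain a b where ab: "a \<in> C" "b \<in> C" "G a b > 0" using nz by (auto simp: zero_comp_def)
  show ?thesis
  proof (cases "i = a")
    case False
    have "(i, a) \<in> reach E s r" using component_reach C i ab by blast
    then have "i \<noteq> a \<longrightarrow> i \<in> C \<longrightarrow> (\<exists>j\<in>C. G i j > 0)"
    proof (induction rule: reach_induct_adj)
      case (step x y)
      then show ?case using component_convex[OF C _ ab(1), of x y] adj_imp_reach by blast
    qed auto
    then show ?thesis using False i by blast
  qed (use ab in blast)
qed

lemma spec_rad_zero_comp:
  assumes C: "C \<in> components E s r" and z: "zero_comp E s r C"
  shows "spec_rad E s r C = 0"
  using z by (intro spec_rad_eq[where h = "\<lambda>_. 1"] component_nonempty[OF C]) (auto simp: zero_comp_def)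

text \<open>At a vertex where the Perron vector is minimal, a single edge inside \<open>C\<close>
  already contributes at least that minimum to the sum, because its multiplicity is at least
  1.\<close>

lemma spec_rad_nonzero_comp:
  assumes C: "C \<in> components E s r" and nz: "\<not> zero_comp E s r C"
  shows "spec_rad E s r C \<ge> 1"
proof -
  obtain h where h: "\<And>i. i \<in> C \<Longrightarrow> h i > 0"
    "\<And>i. i \<in> C \<Longrightarrow> (\<Sum>j\<in>C. real (G i j) * h j) = spec_rad E s r C * h i"
    using perron_vector[OF C] by blast
  have "Min (h ` C) \<in> h ` C" using component_nonempty[OF C] by (intro Min_in) auto
  then obtain i where i: "i \<in> C" "h i = Min (h ` C)" by auto
  obtain j where j: "j \<in> C" "G i j > 0" using nonzero_comp_out_edge[OF C nz i(1)] by blast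
  have "h i \<le> h j" using i j by simp
  also have "\<dots> \<le> real (G i j) * h j" using j h(1)[OF j(1)] by simp
  also have "\<dots> \<le> (\<Sum>j\<in>C. real (G i j) * h j)"
    using j less_imp_le[OF h(1)] by (intro member_le_sum mult_nonneg_nonneg) auto
  also have "\<dots> = spec_rad E s r C * h i" using h i by blast
  finally show ?thesis using h(1)[OF i(1)] by simp
qed

lemma logc_spec_rad_nonneg:
  assumes "C \<in> components E s r"
  shows "logc (spec_rad E s r C) \<ge> 0"
  using spec_rad_zero_comp[OF assms] spec_rad_nonzero_comp[OF assms]
  by (cases "zero_comp E s r C") (auto simp: logc_def)


section \<open>Growth of the number of walks\<close>

primrec walks :: "nat \<Rightarrow> 'v \<Rightarrow> nat" where
  "walks 0 v = 1"
| "walks (Suc k) v = (\<Sum>w\<in>UNIV. G v w * walks k w)"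

text \<open>Parseval's identity at one edge, obtained by applying the reconstruction formula to the
  basis vector of \<open>e\<close>.\<close>

lemma unit_decomp_sum_sq:
  assumes x: "unit_decomp E s d x" and e: "e \<in> E"
  shows "(\<Sum>i<d. cnj (x i e) * x i e) = 1"
proof -
  have "(\<Sum>i<d. x i e * ipX E s (x i) (\<lambda>f. if f = e then 1 else 0) (s e)) = 1"
    using x e unfolding unit_decomp_def by simp
  moreover have "ipX E s (x i) (\<lambda>f. if f = e then 1 else 0) (s e) = cnj (x i e)" for i
    using e finite_E by (simp add: ipX_def if_distrib cong: if_cong)
  ultimately show ?thesis by (simp add: mult.commute)
qed

lemma words_Suc: "words d (Suc k) = (\<lambda>(m, \<mu>). m # \<mu>) ` ({..<d} \<times> words d k)"
  unfolding words_def by (auto simp: length_Suc_conv image_iff)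

lemma sum_ipw:
  assumes x: "unit_decomp E s d x"
  shows "(\<Sum>\<mu>\<in>words d k. ipw E s r x \<mu> v) = of_nat (walks k v)"
proof (induction k arbitrary: v)
  case 0
  have "words d 0 = {[]}" by (auto simp: words_def)
  then show ?case by simp
next
  case (Suc k)
  have "(\<Sum>\<mu>\<in>words d (Suc k). ipw E s r x \<mu> v) = (\<Sum>(m, \<mu>)\<in>{..<d} \<times> words d k. ipw E s r x (m # \<mu>) v)"
    unfolding words_Suc by (subst sum.reindex) (auto simp: inj_on_def case_prod_unfold)
  also have "\<dots> = (\<Sum>m<d. \<Sum>\<mu>\<in>words d k. \<Sum>e\<in>{e\<in>E. s e = v}. cnj (x m e) * x m e * ipw E s r x \<mu> (r e))"
    by (simp add: sum.cartesian_product[symmetric] ipX_def mult_ac)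
  also have "\<dots> = (\<Sum>m<d. \<Sum>e\<in>{e\<in>E. s e = v}. cnj (x m e) * x m e * of_nat (walks k (r e)))"
    by (subst sum.swap) (simp add: Suc flip: sum_distrib_left)
  \<comment> \<open>With the edges outermost, the sum over the first letter is 1 for every edge, and
    all dependence on \<open>x\<close> disappears.\<close>
  also have "\<dots> = (\<Sum>e\<in>{e\<in>E. s e = v}. (\<Sum>m<d. cnj (x m e) * x m e) * of_nat (walks k (r e)))"
    by (subst sum.swap) (simp add: sum_distrib_right)
  also have "\<dots> = (\<Sum>e\<in>{e\<in>E. s e = v}. of_nat (walks k (r e)))"
    using unit_decomp_sum_sq[OF x] by (intro sum.cong) auto
  also have "\<dots> = of_nat (walks (Suc k) v)"
    by (subst sum_out_edges) simp
  finally show ?case .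
qed

text \<open>The basis vectors of the edges, enumerated by \<open>f\<close>, form a decomposition.
  Existence matters because an infimum over the empty set would be infinite.\<close>

lemma unit_decomp_exists: "\<exists>d x. unit_decomp E s d x"
proof -
  obtain f n where f: "bij_betw f {..<n::nat} E"
    using ex_bij_betw_nat_finite[OF finite_E] by (auto simp: lessThan_atLeast0)
  define x where "x i e = (if e = f i then 1 else 0 :: complex)" for i e
  have ip: "ipX E s (x i) z v = (if s (f i) = v then z (f i) else 0)" if "i < n" for i z v
  proof -
    have "f i \<in> E" using f that by (auto simp: bij_betw_def)
    have "ipX E s (x i) z v = (\<Sum>e\<in>{e\<in>E. s e = v}. if e = f i then z (f i) else 0)"
      unfolding ipX_def x_def by (intro sum.cong) auto
    then show ?thesis using finite_E \<open>f i \<in> E\<close> by simp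
  qed
  have "unit_decomp E s n x"
    unfolding unit_decomp_def
  proof (intro conjI allI impI ballI)
    fix i assume i: "i < n"
    show "normA (ipX E s (x i) (x i)) \<le> 1"
      unfolding normA_def using i by (subst Max_le_iff) (auto simp: ip x_def)
  next
    fix z e assume e: "e \<in> E"
    then obtain i where i: "i < n" "f i = e" using f by (auto simp: bij_betw_def)
    have inj: "f j = f i \<longleftrightarrow> j = i" if "j < n" for j
      using f i that by (auto simp: bij_betw_def inj_on_def)
    have "(\<Sum>j<n. x j e * ipX E s (x j) z (s e)) = (\<Sum>j<n. if j = i then z e else 0)"
    proof (intro sum.cong refl)
      fix j assume j: "j \<in> {..<n}"
      have "e = f j \<longleftrightarrow> j = i" using inj j i by auto
      then show "x j e * ipX E s (x j) z (s e) = (if j = i then z e else 0)"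
        using j by (simp add: ip) (auto simp: x_def)
    qed
    then show "(\<Sum>j<n. x j e * ipX E s (x j) z (s e)) = z e" using i by simp
  qed
  then show ?thesis by blast
qed

text \<open>The constant 1 lies below \<open>u / m\<close> with \<open>m\<close> the minimum of
  \<open>u\<close>, and each further edge costs at most a factor \<open>c\<close>; closedness of
  \<open>S\<close> keeps the walks where the inequality holds. It serves for a sink component with
  its Perron vector and for the whole graph with a perturbed vector.\<close>

lemma walks_le_of_superharmonic:
  assumes "\<And>v. u v > 0" and "c \<ge> 0" and "\<And>v. v \<in> S \<Longrightarrow> (\<Sum>w\<in>S. real (G v w) * u w) \<le> c * u v"
    and "\<And>v w. v \<in> S \<Longrightarrow> G v w > 0 \<Longrightarrow> w \<in> S"
  shows "\<exists>K>0. \<forall>k. \<forall>v\<in>S. real (walks k v) \<le> K * c ^ k"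
proof -
  define m where "m = Min (range u)"
  have "m \<in> range u" unfolding m_def by (intro Min_in) auto
  then have m: "m > 0" using assms(1) by auto
  have mle: "m \<le> u v" for v unfolding m_def by simp
  have le: "real (walks k v) \<le> c ^ k * u v / m" if "v \<in> S" for k v
    using that
  proof (induction k arbitrary: v)
    case 0
    then show ?case using m mle by simp
  next
    case (Suc k)
    have "real (walks (Suc k) v) = (\<Sum>w\<in>UNIV. real (G v w) * real (walks k w))" by simp
    also have "\<dots> = (\<Sum>w\<in>S. real (G v w) * real (walks k w))"
      using assms(4)[OF Suc.prems] by (intro sum.mono_neutral_right) auto
    also have "\<dots> \<le> (\<Sum>w\<in>S. real (G v w) * (c ^ k * u w / m))"
      using Suc.IH by (intro sum_mono mult_left_mono) auto
    also have "\<dots> = c ^ k / m * (\<Sum>w\<in>S. real (G v w) * u w)"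
      by (simp add: sum_distrib_left mult_ac)
    also have "\<dots> \<le> c ^ k / m * (c * u v)"
      using assms(2) assms(3)[OF Suc.prems] m by (intro mult_left_mono) auto
    finally show ?case by (simp add: mult_ac)
  qed
  define K where "K = Max (range u) / m"
  have uM: "u v \<le> Max (range u)" for v by simp
  have "K > 0" unfolding K_def using m assms(1) uM by (meson divide_pos_pos less_le_trans)
  moreover have "real (walks k v) \<le> K * c ^ k" if v: "v \<in> S" for k v
  proof -
    have "c ^ k * u v / m \<le> c ^ k * Max (range u) / m"
      using m assms(2) uM by (intro divide_right_mono mult_left_mono) auto
    then show ?thesis using le[OF v, of k] by (simp add: K_def mult_ac)
  qed
  ultimately show ?thesis by blast
qed

lemma sink_walks_le:
  assumes C: "C \<in> components E s r" and sink: "is_sink E s r C"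
  shows "\<exists>K>0. \<forall>k. \<forall>v\<in>C. real (walks k v) \<le> K * spec_rad E s r C ^ k"
proof -
  obtain h where h: "\<And>i. i \<in> C \<Longrightarrow> h i > 0"
    "\<And>i. i \<in> C \<Longrightarrow> (\<Sum>j\<in>C. real (G i j) * h j) = spec_rad E s r C * h i"
    using perron_vector[OF C] by blast
  show ?thesis
  \<comment> \<open>The value 1 outside \<open>C\<close> is a filler that makes the function
    positive everywhere.\<close>
  proof (rule walks_le_of_superharmonic[where u = "\<lambda>v. if v \<in> C then h v else 1"])
    fix v w assume "v \<in> C" "G v w > 0"
    then show "w \<in> C" using sink by (auto simp: adjm_def card_gt_0_iff is_sink_def)
  qed (use h spec_rad_nonneg[OF C] in auto)
qed

text \<open>Walks that stay in \<open>C\<close> are enough: their number dominates the powers of the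
  block applied to \<open>h / M\<close>, which is at most 1 on \<open>C\<close>.\<close>

lemma walks_ge:
  assumes C: "C \<in> components E s r"
  shows "\<exists>c>0. \<forall>k. \<forall>v\<in>C. c * spec_rad E s r C ^ k \<le> real (walks k v)"
proof -
  obtain h where h: "\<And>i. i \<in> C \<Longrightarrow> h i > 0"
    "\<And>i. i \<in> C \<Longrightarrow> (\<Sum>j\<in>C. real (G i j) * h j) = spec_rad E s r C * h i"
    using perron_vector[OF C] by blast
  let ?l = "spec_rad E s r C"
  define M where "M = Max (h ` C)"
  define m where "m = Min (h ` C)"
  have "m \<in> h ` C" unfolding m_def using component_nonempty[OF C] by (intro Min_in) auto
  then have m: "m > 0" using h by auto
  have hm: "m \<le> h i" "h i \<le> M" if "i \<in> C" for i
    using that unfolding m_def M_def by auto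
  have M: "M > 0" using hm m component_nonempty[OF C] by fastforce
  have le: "?l ^ k * h v / M \<le> real (walks k v)" if "v \<in> C" for k v
    using that
  proof (induction k arbitrary: v)
    case 0
    then show ?case using M hm by simp
  next
    case (Suc k)
    have "?l ^ Suc k * h v / M = ?l ^ k / M * (\<Sum>j\<in>C. real (G v j) * h j)"
      using h(2)[OF Suc.prems] by simp
    also have "\<dots> = (\<Sum>j\<in>C. real (G v j) * (?l ^ k * h j / M))"
      by (simp add: sum_distrib_left mult_ac)
    also have "\<dots> \<le> (\<Sum>j\<in>C. real (G v j) * real (walks k j))"
      using Suc.IH by (intro sum_mono mult_left_mono) auto
    also have "\<dots> \<le> (\<Sum>j\<in>UNIV. real (G v j) * real (walks k j))"
      by (intro sum_mono2) auto
    finally show ?case by simp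
  qed
  have "m / M * ?l ^ k \<le> real (walks k v)" if "v \<in> C" for k v
  proof -
    have "m / M * ?l ^ k \<le> ?l ^ k * h v / M"
      using M hm[OF that] spec_rad_nonneg[OF C] mult_right_mono[of m "h v" "?l ^ k"]
      by (simp add: divide_right_mono mult.commute)
    then show ?thesis using le[OF that, of k] by simp
  qed
  then show ?thesis using m M by (intro exI[of _ "m / M"]) auto
qed

text \<open>The weights decay by a factor \<delta> each time an edge leaves a strongly connected
  component, which makes the off-diagonal blocks of the adjacency matrix negligible.\<close>

lemma exists_superharmonic:
  assumes lam: "\<And>C. C \<in> components E s r \<Longrightarrow> spec_rad E s r C \<le> lam" and eps: "eps > 0"
  shows "\<exists>u. (\<forall>v. u v > 0) \<and> (\<forall>v. (\<Sum>w\<in>UNIV. real (G v w) * u w) \<le> (lam + eps) * u v)"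
proof -
  have "\<forall>C\<in>components E s r. \<exists>h. (\<forall>i\<in>C. h i > 0) \<and> (\<forall>i\<in>C. (\<Sum>j\<in>C. real (G i j) * h j) = spec_rad E s r C * h i)"
    using perron_vector by metis
  then obtain H where H: "\<And>C i. C \<in> components E s r \<Longrightarrow> i \<in> C \<Longrightarrow> H C i > (0::real)"
    "\<And>C i. C \<in> components E s r \<Longrightarrow> i \<in> C \<Longrightarrow> (\<Sum>j\<in>C. real (G i j) * H C j) = spec_rad E s r C * H C i"
    by metis
  let ?c = "comp_of E s r"
  define h where "h v = H (?c v) v" for v
  \<comment> \<open>The number of unreachable vertices is constant on components and strictly
    increases along every edge that leaves one, so it can serve as the exponent of
    \<open>\<delta>\<close>.\<close>
  define N where "N v = card {x. (v, x) \<notin> reach E s r}" for v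
  define a where "a = Min (range h)"
  define b where "b = Max (range h)"
  define D where "D = (\<Sum>v\<in>UNIV. \<Sum>w\<in>UNIV. real (G v w))"
  have hpos: "h v > 0" for v unfolding h_def using H by simp
  have ab: "a \<le> h v" "h v \<le> b" for v unfolding a_def b_def by auto
  have "a \<in> range h" unfolding a_def by (intro Min_in) auto
  then have a: "a > 0" using hpos by auto
  have b: "b > 0" using ab(2) hpos by (meson less_le_trans)
  have D: "D \<ge> 0" "(\<Sum>w\<in>UNIV. real (G v w)) \<le> D" for v
  proof -
    show "D \<ge> 0" unfolding D_def by (intro sum_nonneg) auto
    show "(\<Sum>w\<in>UNIV. real (G v w)) \<le> D"
      unfolding D_def by (rule member_le_sum[where f = "\<lambda>v. \<Sum>w\<in>UNIV. real (G v w)"]) (auto intro: sum_nonneg)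
  qed
  \<comment> \<open>Relative to \<open>\<delta> ^ N v\<close>, the leaving edges contribute at most
    \<open>\<delta> * b * D\<close>, which should not exceed \<open>eps * a\<close>. The summand in
    \<open>D + 1\<close> avoids division by 0 for a graph without edges; the minimum with 1 makes
    the powers decrease.\<close>
  define \<delta> where "\<delta> = min 1 (eps * a / (b * (D + 1)))"
  have \<delta>: "\<delta> > 0" "\<delta> \<le> 1" using eps a b D(1) by (auto simp: \<delta>_def)
  have \<delta>D: "\<delta> * b * D \<le> eps * a"
  proof -
    have "\<delta> * (b * (D + 1)) \<le> eps * a"
    proof -
      have "b * (D + 1) > 0" using b D(1) by simp
      moreover have "\<delta> \<le> eps * a / (b * (D + 1))" by (simp add: \<delta>_def)
      ultimately show ?thesis by (simp only: pos_le_divide_eq)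
    qed
    moreover have "\<delta> * b * D \<le> \<delta> * (b * (D + 1))" using \<delta> b D(1) by (simp add: algebra_simps)
    ultimately show ?thesis by simp
  qed
  have N_comp: "N w = N v" if "w \<in> ?c v" for v w
  proof -
    have "{x. (w, x) \<notin> reach E s r} = {x. (v, x) \<notin> reach E s r}"
      using that reach_trans unfolding comp_of_def by blast
    then show ?thesis by (simp add: N_def)
  qed
  have N_less: "N v < N w" if "G v w > 0" "w \<notin> ?c v" for v w
  proof -
    have vw: "(v, w) \<in> reach E s r" using adj_imp_reach that by blast
    then have "(w, v) \<notin> reach E s r" using that by (auto simp: comp_of_def)
    then have "{x. (v, x) \<notin> reach E s r} \<subset> {x. (w, x) \<notin> reach E s r}"
      using vw reach_trans reach_refl by blast
    then show ?thesis unfolding N_def by (intro psubset_card_mono) auto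
  qed
  define u where "u v = \<delta> ^ N v * h v" for v
  have "(\<Sum>w\<in>UNIV. real (G v w) * u w) \<le> (lam + eps) * u v" for v
  proof -
    have "(\<Sum>w\<in>?c v. real (G v w) * u w) = \<delta> ^ N v * (\<Sum>w\<in>?c v. real (G v w) * H (?c v) w)"
      unfolding sum_distrib_left
      by (intro sum.cong) (auto simp: u_def h_def N_comp comp_of_eq)
    also have "\<dots> = spec_rad E s r (?c v) * u v"
      using H(2)[of "?c v" v] by (simp add: u_def h_def)
    also have "\<dots> \<le> lam * u v"
      using lam hpos \<delta>(1) by (intro mult_right_mono) (auto simp: u_def less_imp_le)
    finally have 1: "(\<Sum>w\<in>?c v. real (G v w) * u w) \<le> lam * u v" .
    have "(\<Sum>w\<in>-?c v. real (G v w) * u w) \<le> (\<Sum>w\<in>-?c v. real (G v w) * (\<delta> ^ Suc (N v) * b))"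
    proof (rule sum_mono)
      fix w assume w: "w \<in> -?c v"
      show "real (G v w) * u w \<le> real (G v w) * (\<delta> ^ Suc (N v) * b)"
      proof (cases "G v w > 0")
        case True
        then have "Suc (N v) \<le> N w" using N_less w by (simp add: Suc_le_eq)
        then have "\<delta> ^ N w \<le> \<delta> ^ Suc (N v)" using \<delta> by (intro power_decreasing) auto
        then have "u w \<le> \<delta> ^ Suc (N v) * b"
          unfolding u_def using ab hpos \<delta> by (intro mult_mono) (auto simp: less_imp_le)
        then show ?thesis by (intro mult_left_mono) auto
      qed auto
    qed
    also have "\<dots> = (\<Sum>w\<in>-?c v. real (G v w)) * (\<delta> ^ Suc (N v) * b)"
      by (simp add: sum_distrib_right)
    also have "\<dots> \<le> D * (\<delta> ^ Suc (N v) * b)"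
    proof (rule mult_right_mono)
      have "(\<Sum>w\<in>-?c v. real (G v w)) \<le> (\<Sum>w\<in>UNIV. real (G v w))" by (intro sum_mono2) auto
      then show "(\<Sum>w\<in>-?c v. real (G v w)) \<le> D" using D(2)[of v] by linarith
    qed (use \<delta> b in auto)
    also have "\<dots> = \<delta> ^ N v * (\<delta> * b * D)" by simp
    also have "\<dots> \<le> \<delta> ^ N v * (eps * a)" using \<delta>D \<delta> by (intro mult_left_mono) auto
    also have "\<dots> \<le> eps * u v" using \<delta> eps ab(1)[of v] by (simp add: u_def mult_left_mono)
    finally have 2: "(\<Sum>w\<in>-?c v. real (G v w) * u w) \<le> eps * u v" .
    have "(\<Sum>w\<in>UNIV. real (G v w) * u w) = (\<Sum>w\<in>?c v. real (G v w) * u w) + (\<Sum>w\<in>-?c v. real (G v w) * u w)"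
      by (subst sum.union_disjoint[symmetric]) auto
    then show ?thesis using 1 2 by (simp add: algebra_simps)
  qed
  moreover have "u v > 0" for v using hpos \<delta> by (simp add: u_def)
  ultimately show ?thesis by blast
qed

lemma walks_le:
  assumes lam: "\<And>C. C \<in> components E s r \<Longrightarrow> spec_rad E s r C \<le> lam" and eps: "eps > 0"
  shows "\<exists>K>0. \<forall>k v. real (walks k v) \<le> K * (lam + eps) ^ k"
proof -
  obtain u where u: "\<And>v. u v > 0" "\<And>v. (\<Sum>w\<in>UNIV. real (G v w) * u w) \<le> (lam + eps) * u v"
    using exists_superharmonic[OF lam eps] by blast
  have "0 \<le> lam" using lam[of "comp_of E s r undefined"] spec_rad_nonneg[of "comp_of E s r undefined"] by simp
  then show ?thesis
    using walks_le_of_superharmonic[of u "lam + eps" UNIV] u eps by auto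
qed

section \<open>Logarithmic growth rate and the value of h_X^s\<close>

definition max_walks :: "nat \<Rightarrow> nat" where
  "max_walks k = Max (range (walks k))"

lemma normA_sum_ipw:
  assumes "unit_decomp E s d x"
  shows "normA (\<lambda>v. \<Sum>\<mu>\<in>words d k. ipw E s r x \<mu> v) = real (max_walks k)"
proof -
  have "normA (\<lambda>v. \<Sum>\<mu>\<in>words d k. ipw E s r x \<mu> v) = Max (real ` range (walks k))"
    by (simp add: normA_def sum_ipw[OF assms] image_image)
  also have "\<dots> = real (max_walks k)"
    unfolding max_walks_def by (intro mono_Max_commute[symmetric]) (auto simp: mono_def)
  finally show ?thesis .
qed

lemma walks_le_max_walks: "walks k v \<le> max_walks k"
  unfolding max_walks_def by simp

lemma max_walks_attained: "\<exists>v. max_walks k = walks k v"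
proof -
  have "max_walks k \<in> range (walks k)" unfolding max_walks_def by (intro Max_in) auto
  then show ?thesis by auto
qed

lemma max_logc_spec_rad_le:
  "C \<in> components E s r \<Longrightarrow> logc (spec_rad E s r C) \<le> Max ((\<lambda>C. logc (spec_rad E s r C)) ` components E s r)"
  by simp

text \<open>In an acyclic graph the counts vanish from some length on, and \<open>logc\<close> turns
  this into 0. Otherwise a nonzero component attains the maximum, and the counts lie between
  \<open>c * lam ^ k\<close> and \<open>K * (lam + eps) ^ k\<close>, whose constants disappear after
  division of the logarithm by \<open>k\<close>.\<close>

lemma max_walks_growth:
  "(\<lambda>k. logc (real (max_walks k)) / real k) \<longlonglongrightarrow> Max ((\<lambda>C. logc (spec_rad E s r C)) ` components E s r)"
  (is "?f \<longlonglongrightarrow> ?M")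
proof (cases "\<forall>C\<in>components E s r. zero_comp E s r C")
  case True
  have sr: "spec_rad E s r C = 0" if "C \<in> components E s r" for C
    using True that spec_rad_zero_comp by blast
  have "(\<lambda>C. logc (spec_rad E s r C)) ` components E s r = {0}"
    using sr by (simp add: logc_def image_constant[OF comp_of_in_components])
  then have M: "?M = 0" by simp
  \<comment> \<open>the integers \<open>walks k v\<close> vanish as soon as they are bounded by a number below 1\<close>
  obtain K where K: "K > 0" "\<And>k v. real (walks k v) \<le> K * (0 + 1/2) ^ k"
    using walks_le[of 0 "1/2"] sr by (metis order_refl zero_less_divide_1_iff zero_less_numeral)
  have "(\<lambda>k. K * (1/2) ^ k) \<longlonglongrightarrow> K * 0" by (intro tendsto_intros LIMSEQ_realpow_zero) auto
  then have "eventually (\<lambda>k. K * (1/2) ^ k < 1) sequentially" by (intro order_tendstoD(2)[where y = 0]) auto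
  then have "eventually (\<lambda>k. ?f k = 0) sequentially"
  proof eventually_elim
    case (elim k)
    obtain v where v: "max_walks k = walks k v" using max_walks_attained by blast
    then have "max_walks k = 0" using K(2)[of k v] elim by simp
    then show ?case by (simp add: logc_def)
  qed
  then show ?thesis using M by (simp add: tendsto_eventually)
next
  case False
  have "?M \<in> (\<lambda>C. logc (spec_rad E s r C)) ` components E s r"
    by (intro Max_in) (auto simp: components_def)
  then obtain C0 where C0: "C0 \<in> components E s r" "?M = logc (spec_rad E s r C0)" by auto
  obtain C1 where C1: "C1 \<in> components E s r" "\<not> zero_comp E s r C1" using False by blast
  \<comment> \<open>If a zero component attains the maximum, the maximum is 0, and then a nonzero
    component attains it too because its logarithm is nonnegative.\<close>
  obtain C where C: "C \<in> components E s r" "\<not> zero_comp E s r C" "?M = logc (spec_rad E s r C)"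
  proof (cases "zero_comp E s r C0")
    case True
    then have "?M = 0" using C0 spec_rad_zero_comp by (simp add: logc_def)
    then have "logc (spec_rad E s r C1) = ?M"
      using max_logc_spec_rad_le[OF C1(1)] logc_spec_rad_nonneg[OF C1(1)] by linarith
    then show ?thesis using that C1 by metis
  qed (use that C0 in blast)
  define lam where "lam = spec_rad E s r C"
  have lam1: "lam \<ge> 1" using spec_rad_nonzero_comp C by (simp add: lam_def)
  then have M: "?M = ln lam" using C(3) by (simp add: lam_def logc_def)
  have le_lam: "spec_rad E s r C' \<le> lam" if C': "C' \<in> components E s r" for C'
  proof (cases "zero_comp E s r C'")
    case True
    then show ?thesis using spec_rad_zero_comp[OF C'] lam1 by simp
  next
    case False
    then have 1: "spec_rad E s r C' \<ge> 1" using spec_rad_nonzero_comp[OF C'] by simp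
    then have "ln (spec_rad E s r C') \<le> ln lam"
      using max_logc_spec_rad_le[OF C'] M by (simp add: logc_def split: if_splits)
    then show ?thesis using 1 lam1 by simp
  qed
  obtain c where c: "c > 0" "\<And>k v. v \<in> C \<Longrightarrow> c * lam ^ k \<le> real (walks k v)"
    using walks_ge[OF C(1)] by (auto simp: lam_def)
  obtain v0 where v0: "v0 \<in> C" using component_nonempty[OF C(1)] by blast
  have lower: "c * lam ^ k \<le> real (max_walks k)" for k
    using c(2)[OF v0, of k] walks_le_max_walks[of k v0] by linarith
  have pos: "real (max_walks k) > 0" for k
    using lower[of k] c(1) lam1 by (smt (verit) mult_pos_pos zero_less_power)
  have fk: "?f k = ln (real (max_walks k)) / real k" for k
    using pos[of k] by (simp add: logc_def)
  have log_lim: "(\<lambda>k. (ln a + real k * b) / real k) \<longlonglongrightarrow> b" for a b :: real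
  proof -
    have "(\<lambda>k. ln a / real k + b) \<longlonglongrightarrow> 0 + b" by (intro tendsto_intros lim_const_over_n)
    moreover have "eventually (\<lambda>k. ln a / real k + b = (ln a + real k * b) / real k) sequentially"
      using eventually_gt_at_top[of 0] by eventually_elim (simp add: field_simps)
    ultimately show ?thesis by (simp add: tendsto_cong)
  qed
  show ?thesis
    unfolding M
  proof (rule order_tendstoI)
    fix y assume "y < ln lam"
    then have "eventually (\<lambda>k. y < (ln c + real k * ln lam) / real k) sequentially"
      using log_lim by (rule order_tendstoD(1)[rotated])
    then show "eventually (\<lambda>k. y < ?f k) sequentially"
      using eventually_gt_at_top[of 0]
    proof eventually_elim
      case (elim k)
      have "ln (c * lam ^ k) \<le> ln (real (max_walks k))"
        using lower[of k] c(1) lam1 by (intro ln_mono) auto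
      then have "ln c + real k * ln lam \<le> ln (real (max_walks k))"
        using c(1) lam1 by (simp add: ln_mult ln_realpow)
      then have "(ln c + real k * ln lam) / real k \<le> ?f k"
        unfolding fk by (intro divide_right_mono) auto
      with elim show ?case by linarith
    qed
  next
    fix y assume y: "ln lam < y"
    \<comment> \<open>Chosen so that \<open>ln (lam + eps)\<close> is the midpoint between
      \<open>ln lam\<close> and \<open>y\<close>.\<close>
    define eps where "eps = exp ((ln lam + y) / 2) - lam"
    have "exp (ln lam) < exp ((ln lam + y) / 2)" using y by simp
    then have eps: "eps > 0" using lam1 by (simp add: eps_def)
    have lneps: "ln (lam + eps) = (ln lam + y) / 2" by (simp add: eps_def)
    obtain K where K: "K > 0" "\<And>k v. real (walks k v) \<le> K * (lam + eps) ^ k"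
      using walks_le[OF le_lam eps] by blast
    have "ln (lam + eps) < y" using y lneps by simp
    then have "eventually (\<lambda>k. (ln K + real k * ln (lam + eps)) / real k < y) sequentially"
      using log_lim by (rule order_tendstoD(2)[rotated])
    then show "eventually (\<lambda>k. ?f k < y) sequentially"
      using eventually_gt_at_top[of 0]
    proof eventually_elim
      case (elim k)
      obtain v where "max_walks k = walks k v" using max_walks_attained by blast
      then have "ln (real (max_walks k)) \<le> ln (K * (lam + eps) ^ k)"
        using K(2)[of k v] pos[of k] by (intro ln_mono) auto
      then have "ln (real (max_walks k)) \<le> ln K + real k * ln (lam + eps)"
        using K(1) lam1 eps by (simp add: ln_mult ln_realpow)
      then have "?f k \<le> (ln K + real k * ln (lam + eps)) / real k"
        unfolding fk by (intro divide_right_mono) auto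
      with elim show ?case by linarith
    qed
  qed
qed

lemma hXs_eq: "hXs E s r = ereal (Max ((\<lambda>C. logc (spec_rad E s r C)) ` components E s r))"
proof -
  have "hXx E s r d x = ereal (Max ((\<lambda>C. logc (spec_rad E s r C)) ` components E s r))"
    if "unit_decomp E s d x" for d x
  proof -
    have "(\<lambda>k. ereal (logc (normA (\<lambda>v. \<Sum>\<mu>\<in>words d k. ipw E s r x \<mu> v)) / real k))
      \<longlonglongrightarrow> ereal (Max ((\<lambda>C. logc (spec_rad E s r C)) ` components E s r))"
      unfolding normA_sum_ipw[OF that] using max_walks_growth by simp
    then show ?thesis unfolding hXx_def by (intro lim_imp_Limsup) auto
  qed
  then have "(\<lambda>dx. hXx E s r (fst dx) (snd dx)) ` {(d, x). unit_decomp E s d x} =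
      {ereal (Max ((\<lambda>C. logc (spec_rad E s r C)) ` components E s r))}"
    using unit_decomp_exists by (fastforce simp: image_iff)
  then show ?thesis by (simp add: hXs_def)
qed

end

section \<open>Bounded operators on the Fock space and their adjoints\<close>

declare split_paired_All [simp del] split_paired_Ex [simp del]

text \<open>Split off from \<open>l2\<close> so that the estimates also cover vectors not supported
  on paths, such as \<open>single p\<close> for arbitrary \<open>p\<close>.\<close>

definition sq_summable :: "('v, 'e) vec \<Rightarrow> bool" where
  "sq_summable f \<longleftrightarrow> (\<lambda>p. (cmod (f p))\<^sup>2) summable_on UNIV"

lemma hnorm_nonneg [simp]: "hnorm f \<ge> 0"
  by (simp add: hnorm_def infsum_nonneg)

lemma hnorm_power2: "(hnorm f)\<^sup>2 = (\<Sum>\<^sub>\<infinity>p. (cmod (f p))\<^sup>2)"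
  by (simp add: hnorm_def infsum_nonneg)

lemma L2_set_le_hnorm:
  assumes "sq_summable f"
  shows "L2_set (\<lambda>p. cmod (f p)) F \<le> hnorm f"
proof (cases "finite F")
  case True
  then have "(\<Sum>p\<in>F. (cmod (f p))\<^sup>2) \<le> (\<Sum>\<^sub>\<infinity>p. (cmod (f p))\<^sup>2)"
    using assms by (intro finite_sum_le_infsum) (auto simp: sq_summable_def)
  then show ?thesis by (simp add: L2_set_def hnorm_def)
qed simp

lemma cmod_le_hnorm: "sq_summable f \<Longrightarrow> cmod (f p) \<le> hnorm f"
  using L2_set_le_hnorm[of f "{p}"] by simp

text \<open>Norm bounds are checked on finite sets, where the \<open>L2_set\<close> inequalities
  apply; square summability comes with them.\<close>

lemma sq_summable_hnorm_leI:
  assumes "\<And>F. finite F \<Longrightarrow> L2_set (\<lambda>p. cmod (f p)) F \<le> M"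
  shows "sq_summable f" "hnorm f \<le> M"
proof -
  have M: "M \<ge> 0" using assms[of "{}"] by simp
  have le: "(\<Sum>p\<in>F. (cmod (f p))\<^sup>2) \<le> M\<^sup>2" if "finite F" for F
    using assms[OF that] by (simp add: L2_set_def sqrt_le_D)
  show sq: "sq_summable f"
    unfolding sq_summable_def
    by (rule nonneg_bdd_above_summable_on) (auto intro!: bdd_aboveI[of _ "M\<^sup>2"] le)
  have "(\<Sum>\<^sub>\<infinity>p. (cmod (f p))\<^sup>2) \<le> M\<^sup>2"
    using sq le unfolding sq_summable_def by (intro infsum_le_finite_sums) auto
  then show "hnorm f \<le> M" unfolding hnorm_def using M by (simp add: real_le_lsqrt infsum_nonneg)
qed

lemma sq_summable_add_scaled:
  assumes "sq_summable f" "sq_summable g"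
  shows "sq_summable (\<lambda>p. c * f p + g p)" "hnorm (\<lambda>p. c * f p + g p) \<le> cmod c * hnorm f + hnorm g"
proof -
  have "L2_set (\<lambda>p. cmod (c * f p + g p)) F \<le> cmod c * hnorm f + hnorm g" for F
  proof -
    have "L2_set (\<lambda>p. cmod (c * f p + g p)) F \<le> L2_set (\<lambda>p. cmod c * cmod (f p) + cmod (g p)) F"
      by (intro L2_set_mono) (auto simp: norm_mult intro: order_trans[OF norm_triangle_ineq])
    also have "\<dots> \<le> L2_set (\<lambda>p. cmod c * cmod (f p)) F + L2_set (\<lambda>p. cmod (g p)) F"
      by (rule L2_set_triangle_ineq)
    also have "L2_set (\<lambda>p. cmod c * cmod (f p)) F = cmod c * L2_set (\<lambda>p. cmod (f p)) F"
      by (simp add: L2_set_right_distrib)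
    also have "\<dots> + L2_set (\<lambda>p. cmod (g p)) F \<le> cmod c * hnorm f + hnorm g"
      using assms by (intro add_mono mult_left_mono L2_set_le_hnorm) auto
    finally show ?thesis .
  qed
  then show "sq_summable (\<lambda>p. c * f p + g p)" "hnorm (\<lambda>p. c * f p + g p) \<le> cmod c * hnorm f + hnorm g"
    using sq_summable_hnorm_leI[of "\<lambda>p. c * f p + g p"] by auto
qed

lemma hnorm_0 [simp]: "hnorm (\<lambda>_. 0) = 0"
  by (simp add: hnorm_def)

lemma sq_summable_0 [simp]: "sq_summable (\<lambda>_. 0)"
  by (simp add: sq_summable_def)

lemma sum_mult_le_hnorm:
  assumes "sq_summable f" "sq_summable g"
  shows "(\<Sum>p\<in>F. cmod (f p) * cmod (g p)) \<le> hnorm f * hnorm g"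
proof -
  have "(\<Sum>p\<in>F. \<bar>cmod (f p)\<bar> * \<bar>cmod (g p)\<bar>) \<le> L2_set (\<lambda>p. cmod (f p)) F * L2_set (\<lambda>p. cmod (g p)) F"
    by (rule L2_set_mult_ineq)
  also have "\<dots> \<le> hnorm f * hnorm g"
    using assms by (intro mult_mono L2_set_le_hnorm) auto
  finally show ?thesis by simp
qed

lemma summable_on_mult_sq_summable:
  assumes "sq_summable f" "sq_summable g"
  shows "(\<lambda>p. cmod (f p) * cmod (g p)) summable_on UNIV"
    "(\<Sum>\<^sub>\<infinity>p. cmod (f p) * cmod (g p)) \<le> hnorm f * hnorm g"
proof -
  show *: "(\<lambda>p. cmod (f p) * cmod (g p)) summable_on UNIV"
    using sum_mult_le_hnorm[OF assms]
    by (intro nonneg_bdd_above_summable_on) (auto intro!: bdd_aboveI[of _ "hnorm f * hnorm g"])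
  show "(\<Sum>\<^sub>\<infinity>p. cmod (f p) * cmod (g p)) \<le> hnorm f * hnorm g"
    using * sum_mult_le_hnorm[OF assms] by (intro infsum_le_finite_sums) auto
qed

lemma abs_summable_on_hinner:
  assumes "sq_summable f" "sq_summable g"
  shows "(\<lambda>p. cmod (cnj (f p) * g p)) summable_on UNIV"
  using summable_on_mult_sq_summable[OF assms] by (simp add: norm_mult)

lemma hinner_Cauchy_Schwarz:
  assumes "sq_summable f" "sq_summable g"
  shows "cmod (hinner f g) \<le> hnorm f * hnorm g"
proof -
  have "cmod (hinner f g) \<le> (\<Sum>\<^sub>\<infinity>p. cmod (cnj (f p) * g p))"
    unfolding hinner_def by (rule norm_infsum_bound[OF abs_summable_on_hinner[OF assms]])
  then show ?thesis using summable_on_mult_sq_summable[OF assms] by (simp add: norm_mult)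
qed

lemma hinner_add_scaled_right:
  assumes "sq_summable f" "sq_summable g" "sq_summable h"
  shows "hinner f (\<lambda>p. c * g p + h p) = c * hinner f g + hinner f h"
proof -
  note sm = abs_summable_summable[OF abs_summable_on_hinner[OF assms(1,2)]] abs_summable_summable[OF abs_summable_on_hinner[OF assms(1,3)]]
  have "(\<Sum>\<^sub>\<infinity>p. c * (cnj (f p) * g p) + cnj (f p) * h p) = c * (\<Sum>\<^sub>\<infinity>p. cnj (f p) * g p) + (\<Sum>\<^sub>\<infinity>p. cnj (f p) * h p)"
    using sm by (subst infsum_add) (auto intro: summable_on_cmult_right infsum_cmult_right)
  then show ?thesis by (simp add: hinner_def algebra_simps)
qed

lemma cnj_hinner: "cnj (hinner f g) = hinner g f"
  unfolding hinner_def infsum_cnj[symmetric] by (simp add: mult.commute)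

lemma hinner_add_scaled_left:
  assumes "sq_summable f" "sq_summable g" "sq_summable h"
  shows "hinner (\<lambda>p. c * f p + g p) h = cnj c * hinner f h + hinner g h"
  using arg_cong[OF hinner_add_scaled_right[of h f g c], of cnj] assms by (simp add: cnj_hinner)

lemma hinner_self: "hinner f f = of_real ((hnorm f)\<^sup>2)"
proof -
  have "hinner f f = (\<Sum>\<^sub>\<infinity>p. of_real ((cmod (f p))\<^sup>2))"
    unfolding hinner_def by (intro infsum_cong) (simp add: complex_norm_square mult.commute del: of_real_power)
  also have "\<dots> = of_real (\<Sum>\<^sub>\<infinity>p. (cmod (f p))\<^sup>2)"
  proof (cases "sq_summable f")
    case True
    then show ?thesis
      using has_sum_of_real[where 'a = complex] unfolding sq_summable_def
      by (metis has_sum_infsum infsumI)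
  next
    \<comment> \<open>Here both infinite sums diverge and take the default value 0.\<close>
    case False
    then have "\<not> (\<lambda>p. complex_of_real ((cmod (f p))\<^sup>2)) summable_on UNIV"
      unfolding sq_summable_def by (metis (mono_tags, lifting) summable_on_cong summable_on_Re Re_complex_of_real)
    then show ?thesis using False unfolding sq_summable_def by (simp add: infsum_not_exists)
  qed
  finally show ?thesis by (simp add: hnorm_power2)
qed

definition single :: "'v \<times> 'e list \<Rightarrow> ('v, 'e) vec" where
  "single p = (\<lambda>q. if q = p then 1 else 0)"

lemma hinner_single_left: "hinner (single p) f = f p"
proof -
  have "hinner (single p) f = (\<Sum>\<^sub>\<infinity>q\<in>{p}. f q)"
    unfolding hinner_def by (intro infsum_cong_neutral) (auto simp: single_def)
  then show ?thesis by simp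
qed

lemma hinner_single_right: "hinner f (single p) = cnj (f p)"
  using arg_cong[OF hinner_single_left[of p f], of cnj] by (simp add: cnj_hinner)

lemma hnorm_single [simp]: "hnorm (single p) = 1"
proof -
  have "(\<Sum>\<^sub>\<infinity>q. (cmod (single p q))\<^sup>2) = (\<Sum>\<^sub>\<infinity>q\<in>{p}. 1)"
    by (intro infsum_cong_neutral) (auto simp: single_def)
  then show ?thesis by (simp add: hnorm_def)
qed

lemma sq_summable_restrict:
  assumes "sq_summable f"
  shows "sq_summable (\<lambda>p. if p \<in> A then f p else 0)"
    "(hnorm (\<lambda>p. if p \<in> A then f p else 0))\<^sup>2 = (\<Sum>\<^sub>\<infinity>p\<in>A. (cmod (f p))\<^sup>2)"
proof -
  show "sq_summable (\<lambda>p. if p \<in> A then f p else 0)"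
    using assms unfolding sq_summable_def by (rule summable_on_comparison_test) auto
  show "(hnorm (\<lambda>p. if p \<in> A then f p else 0))\<^sup>2 = (\<Sum>\<^sub>\<infinity>p\<in>A. (cmod (f p))\<^sup>2)"
    unfolding hnorm_power2 by (intro infsum_cong_neutral) auto
qed

text \<open>The squared norm of the tail is the full sum minus a partial sum. Through this,
  identities for finitely supported vectors extend to all of \<open>l2\<close> by
  boundedness.\<close>

lemma hnorm_tail_tendsto_0:
  assumes "sq_summable f"
  shows "((\<lambda>F. hnorm (\<lambda>p. if p \<in> F then 0 else f p)) \<longlongrightarrow> 0) (finite_subsets_at_top UNIV)"
proof -
  let ?f = "\<lambda>p. (cmod (f p))\<^sup>2"
  have sm: "?f summable_on A" for A
    using assms summable_on_subset[of ?f UNIV A] by (auto simp: sq_summable_def)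
  have "((\<lambda>F. sum ?f F) \<longlongrightarrow> infsum ?f UNIV) (finite_subsets_at_top UNIV)"
    using sm by (rule infsum_tendsto)
  then have "((\<lambda>F. sqrt (infsum ?f UNIV - sum ?f F)) \<longlongrightarrow> sqrt (infsum ?f UNIV - infsum ?f UNIV)) (finite_subsets_at_top UNIV)"
    by (intro tendsto_intros)
  moreover have "hnorm (\<lambda>p. if p \<in> F then 0 else f p) = sqrt (infsum ?f UNIV - sum ?f F)" if "finite F" for F
  proof -
    have "infsum ?f (F \<union> -F) = infsum ?f F + infsum ?f (-F)" by (intro infsum_Un_disjoint sm) auto
    then have "infsum ?f (-F) = infsum ?f UNIV - sum ?f F" using that by simp
    moreover have "(\<lambda>p. if p \<in> F then 0 else f p) = (\<lambda>p. if p \<in> -F then f p else 0)" by auto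
    ultimately have "(hnorm (\<lambda>p. if p \<in> F then 0 else f p))\<^sup>2 = infsum ?f UNIV - sum ?f F"
      using sq_summable_restrict(2)[OF assms, of "-F"] by simp
    then show ?thesis by (rule real_sqrt_unique[symmetric]) (rule hnorm_nonneg)
  qed
  then have "\<forall>\<^sub>F F in finite_subsets_at_top UNIV. sqrt (infsum ?f UNIV - sum ?f F) = hnorm (\<lambda>p. if p \<in> F then 0 else f p)"
    by (intro eventually_finite_subsets_at_top_weakI) simp
  ultimately show ?thesis by (simp add: Lim_transform_eventually)
qed

section \<open>Adjoints from matrix coefficients\<close>

context finite_graph
begin

abbreviation H :: "('v, 'e) vec set" where "H \<equiv> l2 E s r"
abbreviation path :: "'v \<times> 'e list \<Rightarrow> bool" where "path \<equiv> is_path E s r"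
abbreviation bop :: "('v, 'e) op \<Rightarrow> bool" where "bop \<equiv> bounded_op E s r"
abbreviation adj :: "('v, 'e) op \<Rightarrow> ('v, 'e) op" where "adj \<equiv> adjop E s r"

lemma l2_iff: "f \<in> H \<longleftrightarrow> (\<forall>p. \<not> path p \<longrightarrow> f p = 0) \<and> sq_summable f"
  by (simp add: l2_def sq_summable_def)

lemma l2_sq_summable: "f \<in> H \<Longrightarrow> sq_summable f"
  by (simp add: l2_iff)

lemma l2_not_path: "f \<in> H \<Longrightarrow> \<not> path p \<Longrightarrow> f p = 0"
  by (simp add: l2_iff)

lemma l2_0 [simp]: "(\<lambda>_. 0) \<in> H"
  by (simp add: l2_iff)

lemma l2_add_scaled: "f \<in> H \<Longrightarrow> g \<in> H \<Longrightarrow> (\<lambda>p. c * f p + g p) \<in> H"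
  by (simp add: l2_iff sq_summable_add_scaled)

lemma l2_scaled: "f \<in> H \<Longrightarrow> (\<lambda>p. c * f p) \<in> H"
  using l2_add_scaled[of f "\<lambda>_. 0" c] by simp

lemma hnorm_scaled: 
  assumes "sq_summable f"
  shows "hnorm (\<lambda>p. c * f p) = cmod c * hnorm f"
proof -
  have "(hnorm (\<lambda>p. c * f p))\<^sup>2 = (cmod c * hnorm f)\<^sup>2"
    using assms unfolding power_mult_distrib hnorm_power2 sq_summable_def
    by (simp add: norm_mult power_mult_distrib infsum_cmult_right)
  then show ?thesis by (simp add: power2_eq_iff_nonneg)
qed

lemma l2_restrict: "f \<in> H \<Longrightarrow> (\<lambda>p. if p \<in> A then f p else 0) \<in> H"
  by (simp add: l2_iff sq_summable_restrict)

lemma l2_restrict_compl: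
  assumes "f \<in> H"
  shows "(\<lambda>p. if p \<in> A then 0 else f p) \<in> H"
proof -
  have "(\<lambda>p. if p \<in> A then 0 else f p) = (\<lambda>p. if p \<in> -A then f p else 0)" by auto
  then show ?thesis using l2_restrict[OF assms, of "-A"] by simp
qed

lemma sq_summable_single [simp]: "sq_summable (single p)"
  unfolding sq_summable_def single_def
  by (rule finite_nonzero_values_imp_summable_on, rule finite_subset[of _ "{p}"]) (auto split: if_splits)

lemma single_l2_iff [simp]: "single p \<in> H \<longleftrightarrow> path p"
proof
  assume "single p \<in> H"
  then show "path p" using l2_not_path[of "single p" p] by (auto simp: single_def)
qed (simp add: l2_iff, simp add: single_def)

lemma bop_l2: "bop T \<Longrightarrow> f \<in> H \<Longrightarrow> T f \<in> H"
  unfolding bounded_op_def by blast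

lemma bop_add_scaled: "bop T \<Longrightarrow> f \<in> H \<Longrightarrow> g \<in> H \<Longrightarrow> T (\<lambda>p. c * f p + g p) = (\<lambda>p. c * T f p + T g p)"
  unfolding bounded_op_def by blast

lemma bop_not_l2: "bop T \<Longrightarrow> f \<notin> H \<Longrightarrow> T f = (\<lambda>_. 0)"
  unfolding bounded_op_def by blast

lemma bop_bound:
  assumes "bop T"
  obtains K where "K \<ge> 0" "\<And>f. f \<in> H \<Longrightarrow> hnorm (T f) \<le> K * hnorm f"
proof -
  obtain K where K: "\<And>f. f \<in> H \<Longrightarrow> hnorm (T f) \<le> K * hnorm f"
    using assms unfolding bounded_op_def by blast
  have "hnorm (T f) \<le> \<bar>K\<bar> * hnorm f" if "f \<in> H" for f
    using K[OF that] mult_right_mono[OF abs_ge_self hnorm_nonneg] by (rule order_trans)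
  then show ?thesis using that[of "\<bar>K\<bar>"] by simp
qed

lemma bop_0: "bop T \<Longrightarrow> T (\<lambda>_. 0) = (\<lambda>_. 0)"
  using bop_add_scaled[of T "\<lambda>_. 0" "\<lambda>_. 0" 1] by (auto simp: fun_eq_iff)

lemma bop_scaled: "bop T \<Longrightarrow> f \<in> H \<Longrightarrow> T (\<lambda>p. c * f p) = (\<lambda>p. c * T f p)"
  using bop_add_scaled[of T f "\<lambda>_. 0" c] by (simp add: bop_0)

lemma bop_restrict_finite:
  assumes T: "bop T" and F: "finite F" and path: "\<And>p. p \<in> F \<Longrightarrow> path p"
  shows "T (\<lambda>p. if p \<in> F then f p else 0) = (\<lambda>q. \<Sum>p\<in>F. f p * T (single p) q)"
    "(\<lambda>p. if p \<in> F then f p else 0) \<in> H"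
proof -
  have "T (\<lambda>p. if p \<in> F then f p else 0) = (\<lambda>q. \<Sum>p\<in>F. f p * T (single p) q) \<and> (\<lambda>p. if p \<in> F then f p else 0) \<in> H"
    using F path
  proof induction
    case empty
    then show ?case using T by (simp add: bop_0)
  next
    case (insert a F)
    have *: "(\<lambda>p. if p \<in> insert a F then f p else 0) = (\<lambda>p. f a * single a p + (if p \<in> F then f p else 0))"
      using insert by (auto simp: single_def)
    have "path a" using insert by simp
    then show ?case unfolding * using insert T
      by (subst bop_add_scaled) (auto intro!: l2_add_scaled simp: \<open>path a\<close>)
  qed
  then show "T (\<lambda>p. if p \<in> F then f p else 0) = (\<lambda>q. \<Sum>p\<in>F. f p * T (single p) q)"
    "(\<lambda>p. if p \<in> F then f p else 0) \<in> H" by auto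
qed

lemma hinner_sum_left:
  assumes "finite F" "\<And>p. p \<in> F \<Longrightarrow> sq_summable (u p)" "sq_summable g"
  shows "hinner (\<lambda>q. \<Sum>p\<in>F. f p * u p q) g = (\<Sum>p\<in>F. cnj (f p) * hinner (u p) g)"
proof -
  have "hinner (\<lambda>q. \<Sum>p\<in>F. f p * u p q) g = (\<Sum>p\<in>F. cnj (f p) * hinner (u p) g) \<and> sq_summable (\<lambda>q. \<Sum>p\<in>F. f p * u p q)"
    using assms
  proof induction
    case empty
    then show ?case by (simp add: hinner_def)
  next
    case (insert a F)
    then show ?case
      using hinner_add_scaled_left[of "u a" "\<lambda>q. \<Sum>p\<in>F. f p * u p q" g "f a"]
        sq_summable_add_scaled(1)[of "u a" "\<lambda>q. \<Sum>p\<in>F. f p * u p q" "f a"] by auto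
  qed
  then show ?thesis by blast
qed

text \<open>The conjugate transpose of the matrix of \<open>T\<close>, the candidate for the
  operator described by \<open>adjop\<close>; it is 0 off \<open>l2\<close>, as
  \<open>bounded_op\<close> demands.\<close>

definition formal_adj :: "('v, 'e) op \<Rightarrow> ('v, 'e) op" where
  "formal_adj T g = (if g \<in> H then (\<lambda>p. hinner (T (single p)) g) else (\<lambda>_. 0))"

lemma formal_adj_l2:
  assumes T: "bop T" and g: "g \<in> H" and K: "\<And>f. f \<in> H \<Longrightarrow> hnorm (T f) \<le> K * hnorm f" "K \<ge> 0"
  shows "formal_adj T g \<in> H" "hnorm (formal_adj T g) \<le> K * hnorm g"
proof -
  define S where "S = formal_adj T g"
  have S: "S p = hinner (T (single p)) g" for p using g by (simp add: S_def formal_adj_def)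
  have np: "S p = 0" if "\<not> path p" for p
    using that bop_not_l2[OF T, of "single p"] by (simp add: S hinner_def)
  have "L2_set (\<lambda>p. cmod (S p)) F \<le> K * hnorm g" if "finite F" for F
  proof -
    define F' where "F' = {p\<in>F. path p}"
    define f where "f = (\<lambda>p. if p \<in> F' then S p else 0)"
    define N where "N = L2_set (\<lambda>p. cmod (S p)) F"
    have F': "finite F'" "\<And>p. p \<in> F' \<Longrightarrow> path p" using that by (auto simp: F'_def)
    have f: "f \<in> H" "T f = (\<lambda>q. \<Sum>p\<in>F'. S p * T (single p) q)"
      unfolding f_def using bop_restrict_finite[OF T F'] by auto
    have N2: "N\<^sup>2 = (\<Sum>p\<in>F'. (cmod (S p))\<^sup>2)"
    proof -
      have "N\<^sup>2 = (\<Sum>p\<in>F. (cmod (S p))\<^sup>2)" by (simp add: N_def L2_set_def sum_nonneg)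
      also have "\<dots> = (\<Sum>p\<in>F'. (cmod (S p))\<^sup>2)"
        unfolding F'_def using that np by (intro sum.mono_neutral_right) auto
      finally show ?thesis .
    qed
    have "(hnorm f)\<^sup>2 = (\<Sum>\<^sub>\<infinity>p\<in>F'. (cmod (S p))\<^sup>2)"
      unfolding hnorm_power2 f_def by (intro infsum_cong_neutral) auto
    then have "(hnorm f)\<^sup>2 = N\<^sup>2" using F' N2 by simp
    then have fN: "hnorm f = N" by (simp add: power2_eq_iff_nonneg N_def)
    \<comment> \<open>\<open>N\<^sup>2 = \<langle>T f, g\<rangle> \<le> K N \<parallel>g\<parallel>\<close>, and a factor \<open>N\<close> cancels\<close>
    have "hinner (T f) g = (\<Sum>p\<in>F'. cnj (S p) * S p)"
      unfolding f(2) S using F' bop_l2[OF T] g by (subst hinner_sum_left) (auto intro!: l2_sq_summable)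
    also have "\<dots> = of_real (N\<^sup>2)"
      unfolding N2 of_real_sum by (intro sum.cong) (simp_all add: complex_norm_square mult.commute del: of_real_power)
    finally have "N\<^sup>2 = cmod (hinner (T f) g)" by (simp add: norm_power)
    also have "\<dots> \<le> hnorm (T f) * hnorm g"
      using bop_l2[OF T f(1)] g by (intro hinner_Cauchy_Schwarz l2_sq_summable) auto
    also have "\<dots> \<le> K * N * hnorm g"
      using K(1)[OF f(1)] fN by (intro mult_right_mono) auto
    finally have "N * N \<le> N * (K * hnorm g)" by (simp add: power2_eq_square mult_ac)
    moreover have "N \<ge> 0" by (simp add: N_def)
    moreover have "K * hnorm g \<ge> 0" using K(2) by simp
    ultimately have "N \<le> K * hnorm g" by (metis mult_le_cancel_left_pos order_le_less)
    then show ?thesis by (simp add: N_def)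
  qed
  from sq_summable_hnorm_leI[of S, OF this]
  show "formal_adj T g \<in> H" "hnorm (formal_adj T g) \<le> K * hnorm g"
    using np by (auto simp: l2_iff S_def)
qed

text \<open>For finite sections of \<open>f\<close> this is linearity. The partial sums converge to
  the right side by absolute convergence, and to the left side because the tail of \<open>f\<close>
  contributes at most \<open>K * hnorm tail * hnorm g\<close>.\<close>

lemma hinner_formal_adj:
  assumes T: "bop T" and f: "f \<in> H" and g: "g \<in> H"
  shows "hinner (T f) g = hinner f (formal_adj T g)"
proof -
  obtain K where K: "K \<ge> 0" "\<And>f. f \<in> H \<Longrightarrow> hnorm (T f) \<le> K * hnorm f" using bop_bound[OF T] by blast
  let ?S = "formal_adj T g"
  have S: "?S \<in> H" using formal_adj_l2(1)[OF T g K(2,1)] .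
  let ?fF = "\<lambda>F p. if p \<in> F then f p else 0"
  have fin: "hinner (T (?fF F)) g = (\<Sum>p\<in>F. cnj (f p) * ?S p)" if F: "finite F" for F
  proof -
    define F' where "F' = {p\<in>F. path p}"
    have F': "finite F'" "\<And>p. p \<in> F' \<Longrightarrow> path p" using F by (auto simp: F'_def)
    have "?fF F = ?fF F'" using l2_not_path[OF f] by (auto simp: F'_def)
    then have "hinner (T (?fF F)) g = hinner (\<lambda>q. \<Sum>p\<in>F'. f p * T (single p) q) g"
      using bop_restrict_finite(1)[OF T F'] by simp
    also have "\<dots> = (\<Sum>p\<in>F'. cnj (f p) * ?S p)"
      using F' bop_l2[OF T] g by (subst hinner_sum_left) (auto intro!: l2_sq_summable simp: formal_adj_def)
    also have "\<dots> = (\<Sum>p\<in>F. cnj (f p) * ?S p)"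
      unfolding F'_def using F l2_not_path[OF f] by (intro sum.mono_neutral_left) auto
    finally show ?thesis .
  qed
  have "((\<lambda>F. (\<Sum>p\<in>F. cnj (f p) * ?S p)) \<longlongrightarrow> hinner (T f) g) (finite_subsets_at_top UNIV)"
  proof (rule LIM_zero_cancel, rule Lim_null_comparison)
    show "((\<lambda>F. K * hnorm (\<lambda>p. if p \<in> F then 0 else f p) * hnorm g) \<longlongrightarrow> 0) (finite_subsets_at_top UNIV)"
      using hnorm_tail_tendsto_0[OF l2_sq_summable[OF f]] by (auto intro!: tendsto_eq_intros)
    show "\<forall>\<^sub>F F in finite_subsets_at_top UNIV. norm ((\<Sum>p\<in>F. cnj (f p) * ?S p) - hinner (T f) g) \<le> K * hnorm (\<lambda>p. if p \<in> F then 0 else f p) * hnorm g"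
    proof (rule eventually_finite_subsets_at_top_weakI)
      fix F :: "('v \<times> 'e list) set" assume F: "finite F"
      let ?t = "\<lambda>p. if p \<in> F then 0 else f p"
      have t: "?t \<in> H" and fF: "?fF F \<in> H" using f l2_restrict_compl l2_restrict by auto
      have "f = (\<lambda>p. 1 * ?t p + ?fF F p)" by auto
      then have "T f = (\<lambda>p. 1 * T ?t p + T (?fF F) p)" using bop_add_scaled[OF T t fF, of 1] by simp
      then have "hinner (T f) g = hinner (T ?t) g + hinner (T (?fF F)) g"
        using hinner_add_scaled_left[of "T ?t" "T (?fF F)" g 1] bop_l2[OF T t] bop_l2[OF T fF] g
        by (simp add: l2_sq_summable)
      then have "norm ((\<Sum>p\<in>F. cnj (f p) * ?S p) - hinner (T f) g) = norm (hinner (T ?t) g)"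
        using fin[OF F] by simp
      also have "\<dots> \<le> hnorm (T ?t) * hnorm g"
        using bop_l2[OF T t] g by (intro hinner_Cauchy_Schwarz l2_sq_summable)
      also have "\<dots> \<le> K * hnorm ?t * hnorm g"
        using K(2)[OF t] by (intro mult_right_mono) auto
      finally show "norm ((\<Sum>p\<in>F. cnj (f p) * ?S p) - hinner (T f) g) \<le> K * hnorm ?t * hnorm g" .
    qed
  qed
  moreover have "((\<lambda>F. (\<Sum>p\<in>F. cnj (f p) * ?S p)) \<longlongrightarrow> hinner f ?S) (finite_subsets_at_top UNIV)"
    unfolding hinner_def
    by (rule infsum_tendsto, rule abs_summable_summable, rule abs_summable_on_hinner)
      (simp_all add: l2_sq_summable f S)
  ultimately show ?thesis by (intro tendsto_unique[of "finite_subsets_at_top UNIV"]) auto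
qed

lemma bop_formal_adj:
  assumes T: "bop T"
  shows "bop (formal_adj T)"
proof -
  obtain K where K: "K \<ge> 0" "\<And>f. f \<in> H \<Longrightarrow> hnorm (T f) \<le> K * hnorm f" using bop_bound[OF T] by blast
  have Ts: "sq_summable (T (single p))" for p
  proof (cases "path p")
    case True
    then show ?thesis by (intro l2_sq_summable bop_l2[OF T]) simp
  next
    case False
    then show ?thesis using bop_not_l2[OF T, of "single p"] by simp
  qed
  show ?thesis
    unfolding bounded_op_def
  proof (intro conjI ballI allI impI)
    show "\<exists>K. \<forall>f\<in>H. hnorm (formal_adj T f) \<le> K * hnorm f"
      using formal_adj_l2(2)[OF T _ K(2,1)] by blast
    fix f g c assume fg: "f \<in> H" "g \<in> H"
    show "formal_adj T (\<lambda>p. c * f p + g p) = (\<lambda>p. c * formal_adj T f p + formal_adj T g p)"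
      using fg l2_add_scaled[OF fg] hinner_add_scaled_right[OF Ts] by (simp add: formal_adj_def l2_sq_summable)
  qed (use formal_adj_l2(1)[OF T _ K(2,1)] in \<open>auto simp: formal_adj_def\<close>)
qed

text \<open>Resolves the definite description. Uniqueness holds as an equality of functions because
  values are tested on \<open>single p\<close> for paths, vanish off paths, and bounded operators
  vanish off \<open>l2\<close>.\<close>

lemma adj_eqI:
  assumes S: "bop S" "\<And>f g. f \<in> H \<Longrightarrow> g \<in> H \<Longrightarrow> hinner (T f) g = hinner f (S g)"
  shows "adj T = S"
  unfolding adjop_def
proof (rule the_equality)
  fix S' assume S': "bop S' \<and> (\<forall>f\<in>H. \<forall>g\<in>H. hinner (T f) g = hinner f (S' g))"
  show "S' = S"
  proof
    fix g show "S' g = S g"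
    proof (cases "g \<in> H")
      case True
      have "S' g p = S g p" for p
      proof (cases "path p")
        case True
        then have "hinner (single p) (S' g) = hinner (single p) (S g)"
          using S S' \<open>g \<in> H\<close> by (metis single_l2_iff)
        then show ?thesis by (simp add: hinner_single_left)
      next
        case False
        then show ?thesis using S S' \<open>g \<in> H\<close> by (metis bop_l2 l2_not_path)
      qed
      then show ?thesis by auto
    next
      case False
      then have "S' g = (\<lambda>_. 0)" "S g = (\<lambda>_. 0)" using S S' by (simp_all add: bop_not_l2)
      then show ?thesis by simp
    qed
  qed
qed (use S in auto)

lemma adj_eq_formal_adj: "bop T \<Longrightarrow> adj T = formal_adj T"
  using bop_formal_adj hinner_formal_adj by (intro adj_eqI) auto

lemma bop_adj: "bop T \<Longrightarrow> bop (adj T)"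
  by (simp add: adj_eq_formal_adj bop_formal_adj)

lemma hinner_adj: "bop T \<Longrightarrow> f \<in> H \<Longrightarrow> g \<in> H \<Longrightarrow> hinner (T f) g = hinner f (adj T g)"
  by (simp add: adj_eq_formal_adj hinner_formal_adj)

lemma adj_apply: "bop T \<Longrightarrow> g \<in> H \<Longrightarrow> adj T g p = hinner (T (single p)) g"
  by (simp add: adj_eq_formal_adj formal_adj_def)

lemma adj_single: "bop T \<Longrightarrow> path q \<Longrightarrow> adj T (single q) p = cnj (T (single p) q)"
  by (simp add: adj_apply hinner_single_right)

text \<open>Row \<open>p\<close> of the matrix of \<open>T\<close> is the conjugate of
  \<open>adj T (single p)\<close>, hence square summable, and the series is an inner product with
  \<open>f\<close>.\<close>

lemma bop_apply_expand:
  assumes T: "bop T" and f: "f \<in> H" and p: "path p"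
  shows "(\<lambda>q. cmod (T (single q) p * f q)) summable_on UNIV" "T f p = (\<Sum>\<^sub>\<infinity>q. T (single q) p * f q)"
proof -
  have sq: "sq_summable (adj T (single p))"
    using p by (intro l2_sq_summable bop_l2[OF bop_adj[OF T]]) simp
  have eq: "cnj (adj T (single p) q) = T (single q) p" for q
    using adj_single[OF T p] by simp
  show "(\<lambda>q. cmod (T (single q) p * f q)) summable_on UNIV"
    using abs_summable_on_hinner[OF sq l2_sq_summable[OF f]] unfolding eq .
  have "T f p = cnj (hinner (T f) (single p))" by (simp add: hinner_single_right)
  also have "\<dots> = cnj (hinner f (adj T (single p)))" using T f p by (simp add: hinner_adj)
  also have "\<dots> = (\<Sum>\<^sub>\<infinity>q. cnj (adj T (single p) q) * f q)" unfolding cnj_hinner by (simp add: hinner_def)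
  finally show "T f p = (\<Sum>\<^sub>\<infinity>q. T (single q) p * f q)" unfolding eq .
qed

end

section \<open>KMS states give subinvariant vectors\<close>

text \<open>A primitive of \<open>F\<close> grows like \<open>a R\<close> along one edge of the strip and like \<open>b R\<close> along the other,
  while its increments across the strip stay bounded.\<close>

lemma strip_boundary_constants_eq:
  fixes F :: "complex \<Rightarrow> complex"
  assumes cont: "continuous_on {z. 0 \<le> Im z \<and> Im z \<le> \<beta>} F"
    and holo: "F holomorphic_on {z. 0 < Im z \<and> Im z < \<beta>}"
    and bdd: "bounded (F ` {z. 0 \<le> Im z \<and> Im z \<le> \<beta>})"
    and beta: "\<beta> > 0"
    and a: "\<And>t::real. F (of_real t) = a"
    and b: "\<And>t::real. F (of_real t + \<i> * of_real \<beta>) = b"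
  shows "a = b"
proof -
  let ?S = "{z. 0 \<le> Im z \<and> Im z \<le> \<beta>}"
  have conv: "convex ?S"
    using convex_Int[OF convex_halfspace_Im_ge[of 0] convex_halfspace_Im_le[of \<beta>]] by (simp add: Int_def)
  have int: "interior ?S \<subseteq> {z. 0 < Im z \<and> Im z < \<beta>}"
  proof -
    have "interior ?S = interior {z. 0 \<le> Im z} \<inter> interior {z. Im z \<le> \<beta>}"
      unfolding interior_Int[symmetric] by (simp add: Int_def)
    also have "\<dots> = {z. 0 < Im z} \<inter> {z. Im z < \<beta>}"
      using interior_halfspace_ge[of \<i> 0] interior_halfspace_le[of \<i> \<beta>] by (simp add: inner_complex_def)
    finally show ?thesis by auto
  qed
  have openS: "open {z. 0 < Im z \<and> Im z < \<beta>}"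
    by (intro open_Collect_conj open_halfspace_Im_gt open_halfspace_Im_lt)
  \<comment> \<open>The primitive exists on the closed strip, since continuity there and
    differentiability in the interior suffice. It can thus be followed along both edges.\<close>
  obtain g where g: "\<And>z. z \<in> ?S \<Longrightarrow> (g has_field_derivative F z) (at z within ?S)"
  proof (rule holomorphic_convex_primitive[OF conv finite.emptyI cont])
    show "F field_differentiable at z" if "z \<in> interior ?S - {}" for z
      using that int holo openS holomorphic_on_imp_differentiable_at by blast
  qed blast
  have line: "g (of_real R + w) - g w = c * of_real R"
    if w: "\<And>t::real. of_real t + w \<in> ?S" "\<And>t::real. F (of_real t + w) = c" for w c R
  proof -
    have "((\<lambda>t. g (of_real t + w) - c * of_real t) has_vector_derivative 0) (at t within UNIV)" for t :: real
    proof -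
      have "((\<lambda>t::real. of_real t + w) has_vector_derivative (1::complex)) (at t within UNIV)"
        using has_vector_derivative_add[OF has_vector_derivative_of_real[OF DERIV_ident] has_vector_derivative_const] by simp
      moreover have "(g has_field_derivative c) (at (of_real t + w) within ((\<lambda>t::real. of_real t + w) ` UNIV))"
      proof (rule DERIV_subset)
        show "(g has_field_derivative c) (at (of_real t + w) within ?S)"
          using g[OF w(1)[of t]] unfolding w(2) .
        show "(\<lambda>t::real. of_real t + w) ` UNIV \<subseteq> ?S" using w(1) by blast
      qed
      ultimately have "((g \<circ> (\<lambda>t::real. of_real t + w)) has_vector_derivative (1 * c)) (at t within UNIV)"
        by (rule field_vector_diff_chain_within)
      then show ?thesis
        using has_vector_derivative_diff[OF _ has_vector_derivative_mult_right[OF has_vector_derivative_of_real[OF DERIV_ident], of c]]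
        by (fastforce simp: o_def)
    qed
    then obtain k where "\<And>t::real. g (of_real t + w) - c * of_real t = k"
      using has_vector_derivative_zero_constant[of UNIV "\<lambda>t. g (of_real t + w) - c * of_real t"] by auto
    from this[of R] this[of 0] show ?thesis by (simp add: algebra_simps)
  qed
  obtain B where B: "\<And>z. z \<in> ?S \<Longrightarrow> norm (F z) \<le> B" using bdd by (auto simp: bounded_iff)
  have side: "norm (g (of_real t + \<i> * of_real \<beta>) - g (of_real t)) \<le> B * \<beta>" for t :: real
    using field_differentiable_bound[OF conv g B, of "of_real t + \<i> * of_real \<beta>" "of_real t"] beta
    by (simp add: norm_mult)
  have bound: "norm (b - a) * R \<le> 2 * (B * \<beta>)" if "R \<ge> 0" for R :: real
  proof -
    have top: "g (of_real R + \<i> * of_real \<beta>) - g (\<i> * of_real \<beta>) = b * of_real R"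
      using beta b by (intro line) auto
    have bot: "g (of_real R) - g 0 = a * of_real R"
      using beta a line[of 0 a R] by simp
    \<comment> \<open>Around a rectangle of width \<open>R\<close>, the difference of the two
      horizontal increments of \<open>g\<close> equals that of the two vertical ones.\<close>
    have "(b - a) * of_real R = (g (of_real R + \<i> * of_real \<beta>) - g (of_real R)) - (g (\<i> * of_real \<beta>) - g 0)"
      unfolding left_diff_distrib top[symmetric] bot[symmetric] by simp
    then have "norm ((b - a) * of_real R) \<le> B * \<beta> + B * \<beta>"
      using norm_triangle_ineq4[of "g (of_real R + \<i> * of_real \<beta>) - g (of_real R)" "g (\<i> * of_real \<beta>) - g 0"]
        side[of R] side[of 0] by simp
    then show ?thesis using that by (simp add: norm_mult)
  qed
  show ?thesis
  proof (rule ccontr)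
    assume "a \<noteq> b"
    then have n: "norm (b - a) > 0" by simp
    have "B \<ge> 0" using B[of 0] beta norm_ge_zero[of "F 0"] by (simp del: norm_ge_zero)
    then have "2 * (B * \<beta>) \<ge> 0" using beta by simp
    \<comment> \<open>This width makes the left side exceed the right side by 1.\<close>
    then have "norm (b - a) * ((2 * (B * \<beta>) + 1) / norm (b - a)) \<le> 2 * (B * \<beta>)"
      using n by (intro bound) auto
    then show False using n by simp
  qed
qed

section \<open>Creation operators, projections and the gauge action on the path basis\<close>

context finite_graph
begin

text \<open>Creation operators act at the range end of a path, hence the decomposition at the last
  edge; counting paths from a fixed source uses \<open>path_Cons\<close> instead.\<close>

lemma path_append: "path (v, es @ [e]) \<longleftrightarrow> path (v, es) \<and> e \<in> E \<and> s e = prange r (v, es)"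
proof (cases "es = []")
  case False
  then obtain fs f where es: "es = fs @ [f]" by (metis rev_exhaust)
  have "(\<forall>i. Suc i < length (es @ [e]) \<longrightarrow> r ((es @ [e]) ! i) = s ((es @ [e]) ! Suc i)) \<longleftrightarrow>
      (\<forall>i. Suc i < length es \<longrightarrow> r (es ! i) = s (es ! Suc i)) \<and> r (last es) = s e"
    unfolding es by (auto simp: nth_append less_Suc_eq)
  then show ?thesis using False by (auto simp: is_path_def prange_def)
qed (auto simp: is_path_def prange_def)

abbreviation crea :: "'e \<Rightarrow> ('v, 'e) op" where "crea \<equiv> creation E s r"

text \<open>A common form for the vertex projections, the range projections of the creation
  operators and the projections onto empty paths.\<close>

definition diag_proj :: "('v \<times> 'e list) set \<Rightarrow> ('v, 'e) op" where
  "diag_proj A f = (if f \<in> H then (\<lambda>p. if p \<in> A then f p else 0) else (\<lambda>_. 0))"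

lemma bop_diag_proj: "bop (diag_proj A)"
  unfolding bounded_op_def
proof (intro conjI ballI allI impI)
  show "\<exists>K. \<forall>f\<in>H. hnorm (diag_proj A f) \<le> K * hnorm f"
  proof (intro exI ballI)
    fix f assume f: "f \<in> H"
    have "(hnorm (diag_proj A f))\<^sup>2 \<le> (hnorm f)\<^sup>2"
      using f l2_sq_summable[OF f] sq_summable_restrict(1)[OF l2_sq_summable[OF f], of A]
      unfolding hnorm_power2 diag_proj_def sq_summable_def
      by (intro infsum_mono) auto
    then show "hnorm (diag_proj A f) \<le> 1 * hnorm f" by (simp add: power2_le_iff_abs_le)
  qed
qed (auto simp: diag_proj_def l2_restrict l2_add_scaled)

lemma adj_diag_proj: "adj (diag_proj A) = diag_proj A"
  by (rule adj_eqI[OF bop_diag_proj]) (auto simp: hinner_def diag_proj_def intro!: infsum_cong)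

lemma diag_proj_idem: "diag_proj A \<circ> diag_proj A = diag_proj A"
  by (auto simp: diag_proj_def fun_eq_iff l2_restrict)

lemma leftproj_eq: "leftproj E s r w = diag_proj {p. prange r p = w}"
  by (auto simp: leftproj_def diag_proj_def fun_eq_iff)

lemma crea_apply:
  "f \<in> H \<Longrightarrow> crea e f p = (if path p \<and> snd p \<noteq> [] \<and> last (snd p) = e then f (fst p, butlast (snd p)) else 0)"
  by (cases p) (simp add: creation_def)

text \<open>Removing the last edge is injective on the paths that end in \<open>e\<close>, so each
  value of \<open>f\<close> occurs at most once in \<open>crea e f\<close>.\<close>

lemma hnorm_crea_le:
  assumes f: "f \<in> H"
  shows "crea e f \<in> H" "hnorm (crea e f) \<le> hnorm f"
proof -
  have "L2_set (\<lambda>p. cmod (crea e f p)) F \<le> hnorm f" if F: "finite F" for F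
  proof -
    define A where "A = {p\<in>F. path p \<and> snd p \<noteq> [] \<and> last (snd p) = e}"
    define b where "b p = (fst p, butlast (snd p))" for p :: "'v \<times> 'e list"
    have inj: "inj_on b A"
    proof (rule inj_onI)
      fix p q assume pq: "p \<in> A" "q \<in> A" "b p = b q"
      have "snd x = butlast (snd x) @ [e]" if "x \<in> A" for x
        using that append_butlast_last_id[of "snd x"] by (auto simp: A_def)
      then have "snd p = snd q" using pq by (metis b_def prod.inject)
      then show "p = q" using pq by (simp add: b_def prod_eq_iff)
    qed
    have "(\<Sum>p\<in>F. (cmod (crea e f p))\<^sup>2) = (\<Sum>p\<in>A. (cmod (f (b p)))\<^sup>2)"
      using F f unfolding A_def
      by (intro sum.mono_neutral_cong_right) (auto simp: crea_apply b_def)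
    also have "\<dots> = (\<Sum>q\<in>b ` A. (cmod (f q))\<^sup>2)" using inj by (simp add: sum.reindex)
    finally have "L2_set (\<lambda>p. cmod (crea e f p)) F = L2_set (\<lambda>p. cmod (f p)) (b ` A)"
      by (simp add: L2_set_def)
    then show ?thesis using L2_set_le_hnorm[OF l2_sq_summable[OF f], of "b ` A"] by simp
  qed
  from sq_summable_hnorm_leI[OF this] show "crea e f \<in> H" "hnorm (crea e f) \<le> hnorm f"
    using f by (auto simp: l2_iff crea_apply)
qed

lemma bop_crea: "bop (crea e)"
  unfolding bounded_op_def
proof (intro conjI ballI allI impI)
  show "\<exists>K. \<forall>f\<in>H. hnorm (crea e f) \<le> K * hnorm f"
    using hnorm_crea_le(2) by (intro exI[of _ 1]) simp
qed (auto simp: hnorm_crea_le crea_apply l2_add_scaled fun_eq_iff, simp add: creation_def)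

lemma crea_single:
  assumes "path p"
  shows "crea e (single p) = (if path (fst p, snd p @ [e]) then single (fst p, snd p @ [e]) else (\<lambda>_. 0))"
proof
  fix q :: "'v \<times> 'e list"
  obtain v es where q: "q = (v, es)" by (cases q)
  have "(path q \<and> es \<noteq> [] \<and> last es = e \<and> (v, butlast es) = p) \<longleftrightarrow> (path (fst p, snd p @ [e]) \<and> q = (fst p, snd p @ [e]))"
    unfolding q by auto
  then show "crea e (single p) q = (if path (fst p, snd p @ [e]) then single (fst p, snd p @ [e]) else (\<lambda>_. 0)) q"
    using assms by (simp add: crea_apply q) (auto simp: single_def)
qed

lemma adj_crea_apply:
  assumes f: "f \<in> H"
  shows "adj (crea e) f p = (if path p \<and> path (fst p, snd p @ [e]) then f (fst p, snd p @ [e]) else 0)"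
proof (cases "path p")
  case True
  then show ?thesis
    using f by (simp add: adj_apply[OF bop_crea] crea_single hinner_single_left) (simp add: hinner_def)
next
  case False
  then show ?thesis using bop_l2[OF bop_adj[OF bop_crea] f] l2_not_path by auto
qed

text \<open>The Toeplitz relation for the inner product of x_e with itself, which is the projection
  at \<open>s e\<close>.\<close>

lemma adj_crea_crea:
  assumes e: "e \<in> E"
  shows "adj (crea e) \<circ> crea e = leftproj E s r (s e)"
proof (intro ext)
  fix f p
  show "(adj (crea e) \<circ> crea e) f p = leftproj E s r (s e) f p"
  proof (cases "f \<in> H")
    case True
    then show ?thesis
      using e path_append[of "fst p" "snd p" e] l2_not_path[OF True]
      by (auto simp: adj_crea_apply hnorm_crea_le crea_apply leftproj_def)
  next
    case False
    then show ?thesis using bop_0[OF bop_adj[OF bop_crea]] by (simp add: creation_def leftproj_def)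
  qed
qed

lemma crea_adj_crea: "crea e \<circ> adj (crea e) = diag_proj {p. path p \<and> snd p \<noteq> [] \<and> last (snd p) = e}"
proof (intro ext)
  fix f p
  show "(crea e \<circ> adj (crea e)) f p = diag_proj {p. path p \<and> snd p \<noteq> [] \<and> last (snd p) = e} f p"
  proof (cases "f \<in> H")
    case True
    have "path (fst p, butlast (snd p))" "(fst p, butlast (snd p) @ [e]) = p"
      if "path p" "snd p \<noteq> []" "last (snd p) = e"
      using that path_append[of "fst p" "butlast (snd p)" e] by (auto simp: prod_eq_iff)
    then show ?thesis
      using True bop_l2[OF bop_adj[OF bop_crea] True]
      by (auto simp: crea_apply adj_crea_apply diag_proj_def)
  next
    case False
    then show ?thesis using bop_0[OF bop_crea] bop_not_l2[OF bop_adj[OF bop_crea] False] by (simp add: diag_proj_def)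
  qed
qed

lemma bop_add: assumes "bop S" "bop T" shows "bop (op_add S T)"
proof -
  obtain K1 where K1: "\<And>f. f \<in> H \<Longrightarrow> hnorm (S f) \<le> K1 * hnorm f" using bop_bound[OF assms(1)] by blast
  obtain K2 where K2: "\<And>f. f \<in> H \<Longrightarrow> hnorm (T f) \<le> K2 * hnorm f" using bop_bound[OF assms(2)] by blast
  have l2: "op_add S T f \<in> H" "hnorm (op_add S T f) \<le> (K1 + K2) * hnorm f" if f: "f \<in> H" for f
  proof -
    have ST: "S f \<in> H" "T f \<in> H" using assms f bop_l2 by auto
    show "op_add S T f \<in> H" using l2_add_scaled[OF ST, of 1] by (simp add: op_add_def)
    show "hnorm (op_add S T f) \<le> (K1 + K2) * hnorm f"
      using sq_summable_add_scaled(2)[OF ST[THEN l2_sq_summable], of 1] K1[OF f] K2[OF f]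
      by (simp add: op_add_def algebra_simps)
  qed
  show ?thesis
    unfolding bounded_op_def
  proof (intro conjI ballI allI impI)
    show "\<exists>K. \<forall>f\<in>H. hnorm (op_add S T f) \<le> K * hnorm f" using l2 by blast
    fix f g c assume fg: "f \<in> H" "g \<in> H"
    show "op_add S T (\<lambda>p. c * f p + g p) = (\<lambda>p. c * op_add S T f p + op_add S T g p)"
      unfolding op_add_def bop_add_scaled[OF assms(1) fg] bop_add_scaled[OF assms(2) fg]
      by (simp add: algebra_simps)
  qed (use assms l2 in \<open>auto simp: op_add_def bop_not_l2\<close>)
qed

lemma bop_scale: assumes "bop T" shows "bop (op_scale c T)"
proof -
  obtain K where K: "\<And>f. f \<in> H \<Longrightarrow> hnorm (T f) \<le> K * hnorm f" using bop_bound[OF assms] by blast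
  have bound: "hnorm (op_scale c T f) \<le> (cmod c * K) * hnorm f" if "f \<in> H" for f
    using K[OF that] hnorm_scaled[OF l2_sq_summable[OF bop_l2[OF assms that]], of c]
    by (simp add: op_scale_def mult_left_mono mult.assoc)
  show ?thesis
    unfolding bounded_op_def
  proof (intro conjI ballI allI impI)
    show "\<exists>K. \<forall>f\<in>H. hnorm (op_scale c T f) \<le> K * hnorm f" using bound by blast
    fix f g d assume fg: "f \<in> H" "g \<in> H"
    show "op_scale c T (\<lambda>p. d * f p + g p) = (\<lambda>p. d * op_scale c T f p + op_scale c T g p)"
      unfolding op_scale_def bop_add_scaled[OF assms fg] by (simp add: algebra_simps)
  qed (use assms in \<open>auto simp: op_scale_def bop_not_l2 l2_scaled bop_l2\<close>)
qed

lemma bop_diff: "bop S \<Longrightarrow> bop T \<Longrightarrow> bop (op_diff S T)"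
  using bop_add[OF _ bop_scale[of T "-1"], of S] by (simp add: op_add_def op_scale_def op_diff_def)

lemma bop_comp: assumes "bop S" "bop T" shows "bop (S \<circ> T)"
proof -
  obtain K1 where K1: "K1 \<ge> 0" "\<And>f. f \<in> H \<Longrightarrow> hnorm (S f) \<le> K1 * hnorm f" using bop_bound[OF assms(1)] by blast
  obtain K2 where K2: "\<And>f. f \<in> H \<Longrightarrow> hnorm (T f) \<le> K2 * hnorm f" using bop_bound[OF assms(2)] by blast
  have "hnorm ((S \<circ> T) f) \<le> (K1 * K2) * hnorm f" if f: "f \<in> H" for f
    using K1(2)[OF bop_l2[OF assms(2) f]] mult_left_mono[OF K2[OF f] K1(1)] by (simp add: mult.assoc)
  then show ?thesis
    unfolding bounded_op_def
    using assms by (intro conjI ballI allI impI)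
      (auto simp: bop_add_scaled bop_not_l2 bop_l2 bop_0)
qed

lemma polyalg_bop: "T \<in> polyalg E s r \<Longrightarrow> bop T"
  by (induction rule: polyalg.induct) (auto simp: bop_crea leftproj_eq bop_diag_proj bop_adj bop_add bop_scale intro: bop_comp[unfolded o_def])

lemma opnorm_bound:
  assumes T: "bop T" and f: "f \<in> H" "hnorm f \<le> 1"
  shows "hnorm (T f) \<le> opnorm E s r T"
proof -
  obtain K where K: "K \<ge> 0" "\<And>f. f \<in> H \<Longrightarrow> hnorm (T f) \<le> K * hnorm f" using bop_bound[OF T] by blast
  have "hnorm (T g) \<le> K" if "g \<in> H" "hnorm g \<le> 1" for g
    using K(2)[OF that(1)] mult_left_mono[OF that(2) K(1)] by simp
  then have "bdd_above {hnorm (T f) | f. f \<in> H \<and> hnorm f \<le> 1}" by (auto intro!: bdd_aboveI)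
  then show ?thesis unfolding opnorm_def using f by (intro cSup_upper) auto
qed

lemma polyalg_toeplitz: assumes "T \<in> polyalg E s r" shows "T \<in> toeplitz E s r"
proof -
  have "{hnorm (op_diff T T f) | f. f \<in> H \<and> hnorm f \<le> 1} = {0}"
    by (auto simp: op_diff_def intro!: exI[of _ "\<lambda>_. 0"])
  then have "opnorm E s r (op_diff T T) = 0" by (simp add: opnorm_def)
  then show ?thesis unfolding toeplitz_def using assms polyalg_bop by force
qed

lemma toeplitz_bop: "T \<in> toeplitz E s r \<Longrightarrow> bop T"
  by (simp add: toeplitz_def)

lemma gauge_unitary_apply:
  "f \<in> H \<Longrightarrow> gauge_unitary E s r t f p = exp (\<i> * of_real t) ^ length (snd p) * f p"
  by (cases p) (simp add: gauge_unitary_def)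

lemma bop_gauge_unitary: "bop (gauge_unitary E s r t)"
proof -
  have norm_eq: "(\<lambda>p. (cmod (gauge_unitary E s r t f p))\<^sup>2) = (\<lambda>p. (cmod (f p))\<^sup>2)" if "f \<in> H" for f
    using that by (simp add: gauge_unitary_apply norm_mult norm_power)
  have l2: "gauge_unitary E s r t f \<in> H" if "f \<in> H" for f
    using that norm_eq[OF that] by (simp add: l2_iff sq_summable_def gauge_unitary_apply)
  have lin: "gauge_unitary E s r t (\<lambda>p. c * f p + g p) = (\<lambda>p. c * gauge_unitary E s r t f p + gauge_unitary E s r t g p)"
    if "f \<in> H" "g \<in> H" for f g c
    unfolding fun_eq_iff gauge_unitary_apply[OF that(1)] gauge_unitary_apply[OF that(2)]
      gauge_unitary_apply[OF l2_add_scaled[OF that]] by (simp add: algebra_simps)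
  have bound: "hnorm (gauge_unitary E s r t f) \<le> 1 * hnorm f" if "f \<in> H" for f
    using norm_eq[OF that] by (simp add: hnorm_def)
  have "gauge_unitary E s r t f = (\<lambda>_. 0)" if "f \<notin> H" for f
    using that by (simp add: gauge_unitary_def)
  then show ?thesis unfolding bounded_op_def using l2 lin bound by blast
qed

lemma bop_sigma: "bop T \<Longrightarrow> bop (sigma E s r t T)"
  unfolding sigma_def by (intro bop_comp bop_gauge_unitary)

text \<open>A matrix coefficient only acquires a phase given by the difference of the path lengths.
  This phase is entire in \<open>t\<close>, which later supplies the analytic continuation.\<close>

lemma sigma_single:
  assumes T: "bop T" and q: "path q"
  shows "sigma E s r t T (single q) p =
    exp (\<i> * of_real t * (of_nat (length (snd p)) - of_nat (length (snd q)))) * T (single q) p"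
proof -
  let ?c = "exp (\<i> * of_real (-t)) ^ length (snd q)"
  have sq: "single q \<in> H" using q by simp
  have "gauge_unitary E s r (-t) (single q) = (\<lambda>x. ?c * single q x)"
    unfolding fun_eq_iff gauge_unitary_apply[OF sq] by (simp add: single_def)
  then have "T (gauge_unitary E s r (-t) (single q)) = (\<lambda>x. ?c * T (single q) x)"
    using bop_scaled[OF T sq] by simp
  moreover have "(\<lambda>x. ?c * T (single q) x) \<in> H" by (intro l2_scaled bop_l2[OF T] sq)
  ultimately have "sigma E s r t T (single q) p = exp (\<i> * of_real t) ^ length (snd p) * (?c * T (single q) p)"
    by (simp add: sigma_def gauge_unitary_apply)
  also have "\<dots> = exp (of_nat (length (snd p)) * (\<i> * of_real t) + of_nat (length (snd q)) * (\<i> * of_real (-t))) * T (single q) p"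
    by (simp only: exp_of_nat_mult exp_add mult.assoc)
  finally show ?thesis by (simp add: algebra_simps)
qed

lemma sigma_crea: "sigma E s r t (crea e) = op_scale (exp (\<i> * of_real t)) (crea e)"
proof (intro ext)
  fix f p
  note gauge_l2 = bop_l2[OF bop_gauge_unitary, of _ "-t"]
  show "sigma E s r t (crea e) f p = op_scale (exp (\<i> * of_real t)) (crea e) f p"
  proof (cases "f \<in> H")
    case True
    obtain v es where p: "p = (v, es)" by (cases p)
    have *: "exp (\<i> * of_real t) ^ Suc n * exp (\<i> * of_real (- t)) ^ n = exp (\<i> * of_real t)" for n
      by (simp add: exp_minus field_simps)
    have "sigma E s r t (crea e) f p = exp (\<i> * of_real t) ^ length es * crea e (gauge_unitary E s r (-t) f) p"
      using True gauge_l2 hnorm_crea_le(1) by (simp add: sigma_def gauge_unitary_def[of _ _ _ t] p)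
    also have "\<dots> = exp (\<i> * of_real t) * crea e f p"
    proof (cases "path p \<and> es \<noteq> [] \<and> last es = e")
      case c: True
      then obtain n where n: "length es = Suc n" by (cases es) auto
      have "exp (\<i> * of_real t) ^ length es * (exp (\<i> * of_real (- t)) ^ length (butlast es) * f (v, butlast es)) = exp (\<i> * of_real t) * f (v, butlast es)"
        using *[of n] n by (simp add: mult.assoc[symmetric])
      then show ?thesis using c True gauge_l2 by (simp add: crea_apply p gauge_unitary_def[of _ _ _ "-t"])
    next
      case False
      then show ?thesis using True gauge_l2 by (auto simp: crea_apply p)
    qed
    finally show ?thesis by (simp add: op_scale_def)
  next
    case False
    then show ?thesis using bop_0[OF bop_crea]
      by (simp add: sigma_def gauge_unitary_def op_scale_def bop_not_l2[OF bop_crea] split: prod.split)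
  qed
qed

section \<open>Vertex masses of a KMS state\<close>

lemma state_add_scaled:
  "is_state E s r \<phi> \<Longrightarrow> S \<in> toeplitz E s r \<Longrightarrow> T \<in> toeplitz E s r \<Longrightarrow> \<phi> (op_add (op_scale c S) T) = c * \<phi> S + \<phi> T"
  by (simp add: is_state_def)

lemma state_zero: assumes "is_state E s r \<phi>" shows "\<phi> (\<lambda>_ _. 0) = 0"
proof -
  have "op_scale 0 (leftproj E s r undefined) \<in> polyalg E s r" by (intro polyalg.intros)
  then have z: "(\<lambda>_ _. 0) \<in> toeplitz E s r" by (simp add: op_scale_def polyalg_toeplitz)
  then show ?thesis using state_add_scaled[OF assms z z, of 1] by (simp add: op_add_def op_scale_def)
qed

lemma state_scale:
  assumes "is_state E s r \<phi>" "T \<in> polyalg E s r"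
  shows "\<phi> (op_scale c T) = c * \<phi> T"
proof -
  have "op_scale 0 T \<in> polyalg E s r" using assms by (intro polyalg.intros)
  then have "(\<lambda>_ _. 0) \<in> toeplitz E s r" by (simp add: op_scale_def polyalg_toeplitz)
  then show ?thesis
    using state_add_scaled[OF assms(1) polyalg_toeplitz[OF assms(2)], where T = "\<lambda>_ _. 0" and c = c] state_zero[OF assms(1)]
    by (simp add: op_add_def)
qed

lemma state_sum:
  assumes st: "is_state E s r \<phi>" and "finite B" "\<And>e. e \<in> B \<Longrightarrow> T e \<in> polyalg E s r"
  shows "(\<lambda>f p. \<Sum>e\<in>B. T e f p) \<in> polyalg E s r \<and> \<phi> (\<lambda>f p. \<Sum>e\<in>B. T e f p) = (\<Sum>e\<in>B. \<phi> (T e))"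
  using assms(2,3)
proof induction
  case empty
  have "op_scale 0 (leftproj E s r undefined) \<in> polyalg E s r" by (intro polyalg.intros)
  then show ?case using state_zero[OF st] by (simp add: op_scale_def)
next
  case (insert a B)
  have eq: "(\<lambda>f p. \<Sum>e\<in>insert a B. T e f p) = op_add (op_scale 1 (T a)) (\<lambda>f p. \<Sum>e\<in>B. T e f p)"
    using insert by (simp add: op_add_def op_scale_def)
  have B: "(\<lambda>f p. \<Sum>e\<in>B. T e f p) \<in> polyalg E s r" "\<phi> (\<lambda>f p. \<Sum>e\<in>B. T e f p) = (\<Sum>e\<in>B. \<phi> (T e))" and a: "T a \<in> polyalg E s r"
    using insert by auto
  have "\<phi> (\<lambda>f p. \<Sum>e\<in>insert a B. T e f p) = 1 * \<phi> (T a) + \<phi> (\<lambda>f p. \<Sum>e\<in>B. T e f p)"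
    unfolding eq by (rule state_add_scaled[OF st polyalg_toeplitz[OF a] polyalg_toeplitz[OF B(1)]])
  moreover have "(\<lambda>f p. \<Sum>e\<in>insert a B. T e f p) \<in> polyalg E s r"
    unfolding eq using a B(1) by (intro polyalg.intros)
  ultimately show ?case using insert B by simp
qed

text \<open>A diagonal projection is its own adjoint times itself, so positivity of the state
  applies.\<close>

lemma state_diag_proj:
  assumes "is_state E s r \<phi>" "diag_proj A \<in> polyalg E s r"
  shows "\<phi> (diag_proj A) \<in> \<real>" "Re (\<phi> (diag_proj A)) \<ge> 0"
  using assms polyalg_toeplitz[OF assms(2)] unfolding is_state_def
  by (metis adj_diag_proj diag_proj_idem)+

text \<open>On both edges of the strip the KMS function of the pair \<open>adj (crea e)\<close>,
  \<open>crea e\<close> is \<open>exp (\<i> * of_real t)\<close> times a constant. Multiplying it by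
  \<open>exp (- \<i> * z)\<close> makes the boundary values constant; at height
  \<open>\<beta>\<close> this multiplier has modulus \<open>exp \<beta>\<close>.\<close>

lemma KMS_crea:
  assumes kms: "is_KMS E s r \<beta> \<phi>" and beta: "\<beta> > 0" and e: "e \<in> E"
  shows "\<phi> (leftproj E s r (s e)) = \<phi> (crea e \<circ> adj (crea e)) * exp (of_real \<beta>)"
proof -
  let ?S = "{z. 0 \<le> Im z \<and> Im z \<le> \<beta>}"
  let ?a = "adj (crea e)" and ?b = "crea e"
  let ?m = "\<phi> (leftproj E s r (s e))" and ?n = "\<phi> (crea e \<circ> adj (crea e))"
  have pa: "?b \<in> polyalg E s r" "?a \<in> polyalg E s r" using e by (auto intro: polyalg.intros)
  have st: "is_state E s r \<phi>" using kms by (simp add: is_KMS_def)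
  obtain F where F: "continuous_on ?S F" "F holomorphic_on {z. 0 < Im z \<and> Im z < \<beta>}" "bounded (F ` ?S)"
     "\<And>t::real. F (of_real t) = \<phi> (?a \<circ> sigma E s r t ?b)"
     "\<And>t::real. F (of_real t + \<i> * of_real \<beta>) = \<phi> (sigma E s r t ?b \<circ> ?a)"
    using kms polyalg_toeplitz[OF pa(1)] polyalg_toeplitz[OF pa(2)] unfolding is_KMS_def by meson
  have "?a \<circ> op_scale c ?b = op_scale c (?a \<circ> ?b)" for c
  proof (intro ext)
    fix f p show "(?a \<circ> op_scale c ?b) f p = op_scale c (?a \<circ> ?b) f p"
      using bop_scaled[OF bop_adj[OF bop_crea], of "?b f" e c] bop_l2[OF bop_crea] bop_not_l2[OF bop_crea] bop_0[OF bop_adj[OF bop_crea]]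
      by (cases "f \<in> H") (auto simp: op_scale_def)
  qed
  moreover have "op_scale c ?b \<circ> ?a = op_scale c (?b \<circ> ?a)" for c
    by (simp add: op_scale_def fun_eq_iff)
  moreover have "?a \<circ> ?b \<in> polyalg E s r" "?b \<circ> ?a \<in> polyalg E s r" using pa by (auto intro: polyalg.intros)
  ultimately have Fb: "F (of_real t) = exp (\<i> * of_real t) * ?m"
    "F (of_real t + \<i> * of_real \<beta>) = exp (\<i> * of_real t) * ?n" for t :: real
    using F(4,5)[of t] by (simp_all add: sigma_crea state_scale[OF st] adj_crea_crea[OF e])
  show ?thesis
  proof (rule strip_boundary_constants_eq[where F = "\<lambda>z. F z * exp (- \<i> * z)" and \<beta> = \<beta>])
    show "continuous_on ?S (\<lambda>z. F z * exp (- \<i> * z))" by (intro continuous_intros F)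
    show "(\<lambda>z. F z * exp (- \<i> * z)) holomorphic_on {z. 0 < Im z \<and> Im z < \<beta>}" by (intro holomorphic_intros F)
    obtain B where B: "\<And>z. z \<in> ?S \<Longrightarrow> norm (F z) \<le> B" using F(3) by (auto simp: bounded_iff)
    have "norm (F z * exp (- \<i> * z)) \<le> B * exp \<beta>" if "z \<in> ?S" for z
      unfolding norm_mult using B[OF that] that order_trans[OF norm_ge_zero B[OF that]]
      by (intro mult_mono) auto
    then show "bounded ((\<lambda>z. F z * exp (- \<i> * z)) ` ?S)" by (auto simp: bounded_iff)
    show "F (of_real t) * exp (- \<i> * of_real t) = ?m" for t :: real
      unfolding Fb by (simp add: exp_minus)
    show "F (of_real t + \<i> * of_real \<beta>) * exp (- \<i> * (of_real t + \<i> * of_real \<beta>)) = ?n * exp (of_real \<beta>)" for t :: real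
    proof -
      have "exp (- \<i> * (of_real t + \<i> * of_real \<beta>)) = exp (- (\<i> * of_real t)) * exp (of_real \<beta>)"
        by (simp add: exp_add[symmetric] algebra_simps)
      then show ?thesis unfolding Fb by (simp add: exp_minus)
    qed
  qed (fact beta)
qed

lemma sum_in_edges:
  fixes f :: "'v \<Rightarrow> real"
  shows "(\<Sum>e\<in>{e\<in>E. r e = w}. f (s e)) = (\<Sum>v\<in>UNIV. real (G v w) * f v)"
proof -
  have "(\<Sum>e\<in>{e\<in>E. r e = w}. f (s e)) = (\<Sum>v\<in>UNIV. \<Sum>e\<in>{e\<in>{e\<in>E. r e = w}. s e = v}. f (s e))"
    using finite_E by (intro sum.group[symmetric]) auto
  also have "\<dots> = (\<Sum>v\<in>UNIV. real (G v w) * f v)"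
  proof (intro sum.cong refl)
    fix v
    have "(\<Sum>e\<in>{e\<in>{e\<in>E. r e = w}. s e = v}. f (s e)) = (\<Sum>e\<in>{e\<in>E. s e = v \<and> r e = w}. f v)"
      by (intro sum.cong) auto
    then show "(\<Sum>e\<in>{e\<in>{e\<in>E. r e = w}. s e = v}. f (s e)) = real (G v w) * f v"
      by (simp add: adjm_def)
  qed
  finally show ?thesis .
qed

lemma KMS_subinvariant:
  assumes kms: "is_KMS E s r \<beta> \<phi>" and beta: "\<beta> > 0"
  obtains m :: "'v \<Rightarrow> real" where "\<And>v. m v \<ge> 0" "(\<Sum>v\<in>UNIV. m v) = 1"
    "\<And>w. (\<Sum>v\<in>UNIV. real (G v w) * m v) \<le> exp \<beta> * m w"
proof -
  have st: "is_state E s r \<phi>" using kms by (simp add: is_KMS_def)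
  define m where "m w = Re (\<phi> (leftproj E s r w))" for w
  have Q: "leftproj E s r w \<in> polyalg E s r" for w by (intro polyalg.intros)
  show ?thesis
  proof
    show "m v \<ge> 0" for v
      unfolding m_def using state_diag_proj(2)[OF st] Q unfolding leftproj_eq by blast
    have "idop E s r = (\<lambda>f p. \<Sum>w\<in>UNIV. leftproj E s r w f p)"
      by (auto simp: idop_def leftproj_def fun_eq_iff)
    then have "(\<Sum>w\<in>UNIV. \<phi> (leftproj E s r w)) = \<phi> (idop E s r)"
      using state_sum[OF st, of UNIV "leftproj E s r"] Q by simp
    also have "\<dots> = 1" using st by (simp add: is_state_def)
    finally have "Re (\<Sum>w\<in>UNIV. \<phi> (leftproj E s r w)) = 1" by simp
    then show "(\<Sum>v\<in>UNIV. m v) = 1" by (simp add: m_def)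
    fix w
    let ?B = "{e\<in>E. r e = w}"
    let ?T = "\<lambda>e. crea e \<circ> adj (crea e)"
    let ?Sum = "\<lambda>f p. \<Sum>e\<in>?B. ?T e f p"
    have T: "?T e \<in> polyalg E s r" if "e \<in> ?B" for e using that by (auto intro!: polyalg.intros)
    have Sum: "?Sum \<in> polyalg E s r" "\<phi> ?Sum = (\<Sum>e\<in>?B. \<phi> (?T e))"
      using state_sum[OF st, of ?B ?T] T finite_E by auto
    \<comment> \<open>What the range projections of the edges into \<open>w\<close> leave of the
      vertex projection is the projection onto the empty path at \<open>w\<close>. Its positivity is
      the subinvariance.\<close>
    have V: "op_add (op_scale (-1) ?Sum) (leftproj E s r w) = diag_proj {(w, [])}"
    proof (intro ext)
      fix f p
      show "op_add (op_scale (-1) ?Sum) (leftproj E s r w) f p = diag_proj {(w, [])} f p"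
      proof (cases "f \<in> H \<and> path p")
        case True
        obtain v es where p: "p = (v, es)" by (cases p)
        have "?Sum f p = (\<Sum>e\<in>?B. if es \<noteq> [] \<and> last es = e then f p else 0)"
          unfolding crea_adj_crea using True by (simp add: diag_proj_def p cong: if_cong)
        also have "\<dots> = (if es \<noteq> [] \<and> r (last es) = w then f p else 0)"
        proof (cases "es = []")
          case False
          then have "last es \<in> E" using True p by (auto simp: is_path_def)
          then show ?thesis using False finite_E by (auto simp: sum.delta)
        qed auto
        finally show ?thesis using True by (auto simp: op_add_def op_scale_def leftproj_def diag_proj_def p prange_def)
      next
        case False
        have z: "diag_proj A f p = 0" for A using False l2_not_path by (auto simp: diag_proj_def)
        show ?thesis unfolding op_add_def op_scale_def crea_adj_crea leftproj_eq z by simp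
      qed
    qed
    have Vp: "diag_proj {(w, [])} \<in> polyalg E s r"
      unfolding V[symmetric] using Sum(1) Q by (intro polyalg.intros)
    have "\<phi> (diag_proj {(w, [])}) = (-1) * \<phi> ?Sum + \<phi> (leftproj E s r w)"
      unfolding V[symmetric] by (rule state_add_scaled[OF st polyalg_toeplitz[OF Sum(1)] polyalg_toeplitz[OF Q]])
    then have "m w - (\<Sum>e\<in>?B. Re (\<phi> (?T e))) \<ge> 0"
      using state_diag_proj(2)[OF st Vp] unfolding Sum(2) m_def by simp
    moreover have "Re (\<phi> (?T e)) = m (s e) / exp \<beta>" if "e \<in> ?B" for e
    proof -
      have "\<phi> (leftproj E s r (s e)) = \<phi> (?T e) * of_real (exp \<beta>)"
        using KMS_crea[OF kms beta] that by (simp add: exp_of_real)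
      then have "m (s e) = Re (\<phi> (?T e)) * exp \<beta>" unfolding m_def by simp
      then show ?thesis by simp
    qed
    ultimately have "(\<Sum>e\<in>?B. m (s e)) / exp \<beta> \<le> m w" by (simp add: sum_divide_distrib)
    then have "(\<Sum>e\<in>?B. m (s e)) \<le> exp \<beta> * m w" by (simp add: field_simps)
    then show "(\<Sum>v\<in>UNIV. real (G v w) * m v) \<le> exp \<beta> * m w" unfolding sum_in_edges .
  qed
qed

text \<open>Take a reachable vertex from which the fewest vertices can be reached. Following an edge
  out of its component can only shrink the reachable set, so by minimality it stays the same and the
  edge leads back.\<close>

lemma exists_reachable_sink: "\<exists>w. (v, w) \<in> reach E s r \<and> is_sink E s r (comp_of E s r w)"
proof -
  let ?R = "\<lambda>w. {x. (w, x) \<in> reach E s r}"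
  obtain w where w: "(v, w) \<in> reach E s r" "\<And>y. (v, y) \<in> reach E s r \<Longrightarrow> card (?R w) \<le> card (?R y)"
    using ex_has_least_nat[of "\<lambda>w. (v, w) \<in> reach E s r" v "\<lambda>w. card (?R w)"] reach_refl by blast
  have "is_sink E s r (comp_of E s r w)"
    unfolding is_sink_def
  proof (intro ballI impI)
    fix e assume e: "e \<in> E" "s e \<in> comp_of E s r w"
    have "(s e, r e) \<in> reach E s r" using e by (auto simp: reach_def)
    then have we: "(w, r e) \<in> reach E s r" using e reach_trans by (auto simp: comp_of_def)
    then have "?R (r e) \<subseteq> ?R w" using reach_trans by blast
    moreover have "card (?R w) \<le> card (?R (r e))" using w we reach_trans by blast
    ultimately have "?R (r e) = ?R w" by (intro card_seteq) auto
    then have "(r e, w) \<in> reach E s r" using reach_refl by blast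
    then show "r e \<in> comp_of E s r w" using we by (simp add: comp_of_def)
  qed
  then show ?thesis using w by blast
qed

lemma KMS_imp_sink_bound:
  assumes kms: "is_KMS E s r \<beta> \<phi>" and beta: "\<beta> > 0"
  shows "\<exists>C\<in>components E s r. is_sink E s r C \<and> spec_rad E s r C \<le> exp \<beta>"
proof -
  obtain m where m: "\<And>v. m v \<ge> 0" "(\<Sum>v\<in>UNIV. m v) = 1"
    "\<And>w. (\<Sum>v\<in>UNIV. real (G v w) * m v) \<le> exp \<beta> * m w"
    using KMS_subinvariant[OF assms] by blast
  obtain v0 where "m v0 \<noteq> 0" using m(2) by (metis sum.neutral zero_neq_one)
  then have v0: "m v0 > 0" using m(1)[of v0] by simp
  obtain w where w: "(v0, w) \<in> reach E s r" "is_sink E s r (comp_of E s r w)"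
    using exists_reachable_sink by blast
  have pos_step: "m y > 0" if "G x y > 0" "m x > 0" for x y
  proof -
    have "0 < real (G x y) * m x" using that by simp
    also have "\<dots> \<le> (\<Sum>v\<in>UNIV. real (G v y) * m v)" using m(1) by (intro member_le_sum) auto
    also have "\<dots> \<le> exp \<beta> * m y" by (rule m)
    finally show ?thesis by (simp add: zero_less_mult_iff)
  qed
  from w(1) have "m v0 > 0 \<longrightarrow> m w > 0"
    by (induction rule: reach_induct_adj) (use pos_step in blast)+
  then have mw: "m w > 0" using v0 by blast
  define C where "C = comp_of E s r w"
  have C: "C \<in> components E s r" by (simp add: C_def)
  obtain h where h: "\<And>i. i \<in> C \<Longrightarrow> h i > 0"
    "\<And>i. i \<in> C \<Longrightarrow> (\<Sum>j\<in>C. real (G i j) * h j) = spec_rad E s r C * h i"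
    using perron_vector[OF C] by blast
  define N where "N = (\<Sum>i\<in>C. m i * h i)"
  have "0 < m w * h w" using mw h(1)[of w] by (simp add: C_def)
  also have "\<dots> \<le> N" unfolding N_def
    using m(1) h(1) by (intro member_le_sum mult_nonneg_nonneg) (auto simp: C_def less_imp_le)
  finally have N: "N > 0" .
  have "spec_rad E s r C * N = (\<Sum>i\<in>C. m i * (\<Sum>j\<in>C. real (G i j) * h j))"
    unfolding N_def sum_distrib_left[of "spec_rad E s r C"] by (intro sum.cong) (simp_all add: h(2))
  also have "\<dots> = (\<Sum>j\<in>C. h j * (\<Sum>i\<in>C. real (G i j) * m i))"
    unfolding sum_distrib_left by (subst sum.swap) (simp add: mult_ac)
  also have "\<dots> \<le> (\<Sum>j\<in>C. h j * (exp \<beta> * m j))"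
  proof (intro sum_mono mult_left_mono)
    fix j assume j: "j \<in> C"
    \<comment> \<open>Mass entering \<open>C\<close> from outside only adds nonnegative
      terms.\<close>
    have "(\<Sum>i\<in>C. real (G i j) * m i) \<le> (\<Sum>i\<in>UNIV. real (G i j) * m i)"
      using m(1) by (intro sum_mono2) auto
    also have "\<dots> \<le> exp \<beta> * m j" by (rule m)
    finally show "(\<Sum>i\<in>C. real (G i j) * m i) \<le> exp \<beta> * m j" .
    show "0 \<le> h j" using h(1)[OF j] by simp
  qed
  also have "\<dots> = exp \<beta> * N" unfolding N_def sum_distrib_left by (simp add: mult_ac)
  finally have "spec_rad E s r C \<le> exp \<beta>" using N by simp
  then show ?thesis using C w(2) C_def by blast
qed

end

section \<open>Gibbs states\<close>

text \<open>The Weierstrass M-test for unordered sums: the tail off a finite set is dominated by the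
  tail of \<open>D\<close>, independently of \<open>z\<close>.\<close>

lemma uniform_limit_infsum:
  fixes f :: "'a \<Rightarrow> 'b \<Rightarrow> 'c::banach"
  assumes D: "D summable_on UNIV" and le: "\<And>x z. z \<in> S \<Longrightarrow> norm (f x z) \<le> D x"
  shows "uniform_limit S (\<lambda>F z. \<Sum>x\<in>F. f x z) (\<lambda>z. \<Sum>\<^sub>\<infinity>x. f x z) (finite_subsets_at_top UNIV)"
proof (rule uniform_limitI)
  fix e :: real assume e: "e > 0"
  have Ds: "D summable_on A" for A using summable_on_subset_banach[OF D] by blast
  have fs: "(\<lambda>x. norm (f x z)) summable_on A" if "z \<in> S" for z A
    using Ds le[OF that] by (rule summable_on_comparison_test) auto
  have "((\<lambda>F. sum D F) \<longlongrightarrow> infsum D UNIV) (finite_subsets_at_top UNIV)" using D by (rule infsum_tendsto)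
  then have "\<forall>\<^sub>F F in finite_subsets_at_top UNIV. dist (sum D F) (infsum D UNIV) < e" using e by (rule tendstoD)
  moreover have "\<forall>\<^sub>F F in finite_subsets_at_top (UNIV :: 'a set). finite F"
    by (rule eventually_finite_subsets_at_top_weakI)
  ultimately show "\<forall>\<^sub>F F in finite_subsets_at_top UNIV. \<forall>z\<in>S. dist (\<Sum>x\<in>F. f x z) (\<Sum>\<^sub>\<infinity>x. f x z) < e"
  proof eventually_elim
    case (elim F)
    show ?case
    proof
      fix z assume z: "z \<in> S"
      have fsz: "(\<lambda>x. f x z) summable_on A" for A using fs[OF z] by (rule abs_summable_summable)
      have "(\<Sum>\<^sub>\<infinity>x\<in>F \<union> -F. f x z) = (\<Sum>\<^sub>\<infinity>x\<in>F. f x z) + (\<Sum>\<^sub>\<infinity>x\<in>-F. f x z)"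
        by (intro infsum_Un_disjoint fsz) auto
      then have "dist (\<Sum>x\<in>F. f x z) (\<Sum>\<^sub>\<infinity>x. f x z) = norm (\<Sum>\<^sub>\<infinity>x\<in>-F. f x z)"
        using elim by (simp add: dist_norm)
      also have "\<dots> \<le> (\<Sum>\<^sub>\<infinity>x\<in>-F. norm (f x z))" by (rule norm_infsum_bound[OF fs[OF z]])
      also have "\<dots> \<le> infsum D (-F)" using fs[OF z] Ds le[OF z] by (intro infsum_mono) auto
      also have "\<dots> = infsum D UNIV - sum D F"
      proof -
        have "infsum D (F \<union> -F) = infsum D F + infsum D (-F)" by (intro infsum_Un_disjoint Ds) auto
        then show ?thesis using elim by simp
      qed
      also have "\<dots> \<le> dist (sum D F) (infsum D UNIV)" by (simp add: dist_real_def)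
      finally show "dist (\<Sum>x\<in>F. f x z) (\<Sum>\<^sub>\<infinity>x. f x z) < e" using elim by simp
    qed
  qed
qed

text \<open>Holomorphy is local, and on a closed disc inside \<open>A\<close> the uniform limit
  theorem applies. Below, \<open>A\<close> is the open strip and \<open>B\<close> the closed
  one.\<close>

lemma holomorphic_on_uniform_limit:
  assumes A: "open A" "A \<subseteq> B" and holo: "\<And>F. f F holomorphic_on A"
    and lim: "uniform_limit B f g L" and L: "L \<noteq> bot"
  shows "g holomorphic_on A"
proof -
  have "\<exists>r>0. g holomorphic_on ball z r" if z: "z \<in> A" for z
  proof -
    obtain r where r: "r > 0" "cball z r \<subseteq> A" using A z by (meson open_contains_cball)
    have "g holomorphic_on ball z r"
    proof (rule holomorphic_uniform_limit)
      show "\<forall>\<^sub>F n in L. continuous_on (cball z r) (f n) \<and> f n holomorphic_on ball z r"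
      proof (intro always_eventually allI conjI)
        fix n
        have cb: "f n holomorphic_on cball z r" by (rule holomorphic_on_subset[OF holo r(2)])
        then show "continuous_on (cball z r) (f n)" by (rule holomorphic_on_imp_continuous_on)
        show "f n holomorphic_on ball z r" using cb ball_subset_cball by (rule holomorphic_on_subset)
      qed
      show "uniform_limit (cball z r) f g L" using lim r(2) A(2) by (auto intro: uniform_limit_on_subset)
    qed (use L in auto)
    then show ?thesis using r by blast
  qed
  then show ?thesis unfolding holomorphic_on_def
    using A(1) by (metis at_within_open centre_in_ball open_ball at_within_open)
qed

lemma infsum_of_real_complex:
  "f summable_on A \<Longrightarrow> (\<Sum>\<^sub>\<infinity>x\<in>A. complex_of_real (f x)) = of_real (infsum f A)"
  by (intro infsumI has_sum_of_real has_sum_infsum)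

section \<open>Partition functions of the paths from a vertex\<close>

context finite_graph
begin

lemma path_Cons: "path (v, e # es) \<longleftrightarrow> e \<in> E \<and> s e = v \<and> path (r e, es)"
proof (cases es)
  case (Cons f fs)
  have "(\<forall>i. Suc i < length (e # es) \<longrightarrow> r ((e # es) ! i) = s ((e # es) ! Suc i)) \<longleftrightarrow>
      r e = s (hd es) \<and> (\<forall>i. Suc i < length es \<longrightarrow> r (es ! i) = s (es ! Suc i))"
  proof -
    have "(\<forall>i. P i) \<longleftrightarrow> P 0 \<and> (\<forall>i. P (Suc i))" for P :: "nat \<Rightarrow> bool" by (metis not0_implies_Suc)
    from this[of "\<lambda>i. Suc i < length (e # es) \<longrightarrow> r ((e # es) ! i) = s ((e # es) ! Suc i)"]
    show ?thesis unfolding Cons by simp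
  qed
  then show ?thesis using Cons by (auto simp: is_path_def)
qed (auto simp: is_path_def)

text \<open>Splitting off the first edge matches the recursion of \<open>walks\<close>. Finiteness
  is carried along because it is needed to compute the cardinality of the union.\<close>

lemma card_paths:
  "finite {es. path (v, es) \<and> length es = k} \<and> card {es. path (v, es) \<and> length es = k} = walks k v"
proof (induction k arbitrary: v)
  case 0
  have "{es. path (v, es) \<and> length es = 0} = {[]}" by (auto simp: is_path_def)
  then show ?case by simp
next
  case (Suc k)
  let ?P = "\<lambda>v. {es. path (v, es) \<and> length es = k}"
  have eq: "{es. path (v, es) \<and> length es = Suc k} = (\<Union>e\<in>{e\<in>E. s e = v}. (#) e ` ?P (r e))"
    by (auto simp: length_Suc_conv path_Cons)
  have "card (\<Union>e\<in>{e\<in>E. s e = v}. (#) e ` ?P (r e)) = (\<Sum>e\<in>{e\<in>E. s e = v}. card ((#) e ` ?P (r e)))"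
    using finite_E Suc by (intro card_UN_disjoint) auto
  also have "\<dots> = (\<Sum>e\<in>{e\<in>E. s e = v}. walks k (r e))"
    using Suc by (intro sum.cong refl) (simp add: card_image)
  also have "\<dots> = walks (Suc k) v" by (subst sum_out_edges) simp
  finally show ?case unfolding eq using finite_E Suc by auto
qed

definition gibbs_weight :: "real \<Rightarrow> 'v \<Rightarrow> 'v \<times> 'e list \<Rightarrow> real" where
  "gibbs_weight \<beta> v p = (if path p \<and> fst p = v then exp (- \<beta> * real (length (snd p))) else 0)"

text \<open>With N the path length operator, this is Tr(exp(-beta N) T) / Tr(exp(-beta N)), the
  traces being taken over the paths that start at \<open>v\<close>.\<close>

definition gibbs_state :: "real \<Rightarrow> 'v \<Rightarrow> ('v, 'e) op \<Rightarrow> complex" where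
  "gibbs_state \<beta> v T = (\<Sum>\<^sub>\<infinity>p. of_real (gibbs_weight \<beta> v p) * T (single p) p) / of_real (\<Sum>\<^sub>\<infinity>p. gibbs_weight \<beta> v p)"

lemma gibbs_weight_nonneg [simp]: "gibbs_weight \<beta> v p \<ge> 0"
  by (simp add: gibbs_weight_def)

text \<open>Sorted by length, the paths from \<open>v\<close> are dominated by a geometric series;
  its ratio \<open>q\<close> is below 1 exactly when the spectral radius of the sink is below
  \<open>exp \<beta>\<close>.\<close>

lemma summable_gibbs_weight:
  assumes C: "C \<in> components E s r" "is_sink E s r C" "v \<in> C" and beta: "spec_rad E s r C < exp \<beta>"
  shows "gibbs_weight \<beta> v summable_on UNIV"
proof (rule nonneg_bdd_above_summable_on)
  obtain K where K: "K > 0" "\<And>k. real (walks k v) \<le> K * spec_rad E s r C ^ k"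
    using sink_walks_le[OF C(1,2)] C(3) by blast
  define q where "q = spec_rad E s r C * exp (- \<beta>)"
  have q: "0 \<le> q" "q < 1" using spec_rad_nonneg[OF C(1)] beta by (simp_all add: q_def exp_minus field_simps)
  have "sum (gibbs_weight \<beta> v) F \<le> K / (1 - q)" if F: "finite F" for F
  proof -
    define F' where "F' = {p\<in>F. path p \<and> fst p = v}"
    have F': "finite F'" using F by (simp add: F'_def)
    define N where "N = Suc (Max (insert 0 ((\<lambda>p. length (snd p)) ` F')))"
    have N: "length (snd p) < N" if "p \<in> F'" for p
      unfolding N_def using that F' by (intro le_imp_less_Suc Max_ge) auto
    have "sum (gibbs_weight \<beta> v) F = (\<Sum>p\<in>F'. exp (- \<beta> * real (length (snd p))))"
      unfolding F'_def using F by (intro sum.mono_neutral_cong_right) (auto simp: gibbs_weight_def)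
    also have "\<dots> = (\<Sum>k<N. \<Sum>p\<in>{p\<in>F'. length (snd p) = k}. exp (- \<beta> * real (length (snd p))))"
      using F' N by (intro sum.group[symmetric]) auto
    also have "\<dots> = (\<Sum>k<N. real (card {p\<in>F'. length (snd p) = k}) * exp (- \<beta> * real k))" by simp
    also have "\<dots> \<le> (\<Sum>k<N. K * q ^ k)"
    proof (rule sum_mono)
      fix k
      have "{p\<in>F'. length (snd p) = k} \<subseteq> Pair v ` {es. path (v, es) \<and> length es = k}"
        by (auto simp: F'_def)
      then have "card {p\<in>F'. length (snd p) = k} \<le> card (Pair v ` {es. path (v, es) \<and> length es = k})"
        using card_paths[of v k] by (intro card_mono) auto
      also have "\<dots> = walks k v" using card_paths[of v k] by (simp add: card_image inj_on_def)
      finally have "real (card {p\<in>F'. length (snd p) = k}) \<le> K * spec_rad E s r C ^ k"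
        using K(2)[of k] by linarith
      moreover have "exp (- \<beta> * real k) = exp (- \<beta>) ^ k" by (simp add: exp_of_nat_mult[symmetric] mult.commute)
      ultimately show "real (card {p\<in>F'. length (snd p) = k}) * exp (- \<beta> * real k) \<le> K * q ^ k"
        by (simp add: q_def power_mult_distrib mult.assoc[symmetric])
    qed
    also have "\<dots> = K * (\<Sum>k<N. q ^ k)" by (simp add: sum_distrib_left)
    also have "(\<Sum>k<N. q ^ k) = (1 - q ^ N) / (1 - q)" using q by (simp add: sum_gp_strict)
    also have "K * \<dots> \<le> K / (1 - q)" using q K(1) by (simp add: divide_right_mono mult_left_le)
    finally show ?thesis .
  qed
  then show "bdd_above (sum (gibbs_weight \<beta> v) ` {F. F \<subseteq> UNIV \<and> finite F})"
    by (auto intro!: bdd_aboveI[of _ "K / (1 - q)"])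
qed simp

lemma infsum_gibbs_weight_pos:
  assumes "gibbs_weight \<beta> v summable_on UNIV"
  shows "(\<Sum>\<^sub>\<infinity>p. gibbs_weight \<beta> v p) > 0"
proof -
  have "sum (gibbs_weight \<beta> v) {(v, [])} \<le> (\<Sum>\<^sub>\<infinity>p. gibbs_weight \<beta> v p)"
    using assms by (intro finite_sum_le_infsum) auto
  moreover have "gibbs_weight \<beta> v (v, []) = 1" by (simp add: gibbs_weight_def is_path_def)
  ultimately show ?thesis by simp
qed

text \<open>This is the right \<open>A\<close>-linearity of the elements of the Toeplitz algebra. It is what makes a Gibbs
  state supported on the paths starting at a single vertex a KMS state.\<close>

definition source_preserving :: "('v, 'e) op \<Rightarrow> bool" where
  "source_preserving T \<longleftrightarrow> (\<forall>p q. fst p \<noteq> fst q \<longrightarrow> T (single q) p = 0)"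

lemma polyalg_source_preserving: "T \<in> polyalg E s r \<Longrightarrow> source_preserving T"
proof (induction rule: polyalg.induct)
  case (gen_edge e)
  have "crea e (single q) p = 0" if "fst p \<noteq> fst q" for p q
  proof (cases "path q")
    case True
    then show ?thesis using that by (auto simp: crea_single) (auto simp: single_def)
  next
    case False
    then show ?thesis using bop_not_l2[OF bop_crea] by simp
  qed
  then show ?case by (simp add: source_preserving_def)
next
  case (gen_vertex w)
  show ?case unfolding source_preserving_def leftproj_def by (auto simp: single_def)
next
  case (adj T)
  have T: "bop T" using adj polyalg_bop by blast
  have "adj T (single q) p = 0" if "fst p \<noteq> fst q" for p q
  proof (cases "path q")
    case True
    then show ?thesis using adj_single[OF T True] adj.IH that by (simp add: source_preserving_def)
  next
    case False
    then show ?thesis using bop_not_l2[OF bop_adj[OF T]] by simp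
  qed
  then show ?case by (simp add: source_preserving_def)
next
  case (comp S T)
  have S: "bop S" and T: "bop T" using comp polyalg_bop by blast+
  have "S (T (single q)) p = 0" if pq: "fst p \<noteq> fst q" for p q
  proof (cases "path q \<and> path p")
    case True
    then have "single q \<in> H" by simp
    then have "T (single q) \<in> H" by (rule bop_l2[OF T])
    then have "S (T (single q)) p = (\<Sum>\<^sub>\<infinity>x. S (single x) p * T (single q) x)"
      using bop_apply_expand(2)[OF S] True by blast
    \<comment> \<open>As \<open>p\<close> and \<open>q\<close> have different sources, every
      intermediate path \<open>x\<close> differs in source from one of them, and that factor
      vanishes.\<close>
    also have "\<dots> = (\<Sum>\<^sub>\<infinity>x::'v \<times> 'e list. 0)"
    proof (intro infsum_cong)
      fix x show "S (single x) p * T (single q) x = 0"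
        using comp.IH pq unfolding source_preserving_def by (metis mult_eq_0_iff)
    qed
    finally show ?thesis by simp
  next
    case False
    then consider "\<not> path q" | "path q" "\<not> path p" by blast
    then show ?thesis
    proof cases
      case 1
      then show ?thesis using bop_not_l2[OF T] bop_0[OF S] by simp
    next
      case 2
      then show ?thesis using l2_not_path bop_l2[OF S bop_l2[OF T, of "single q"]] by simp
    qed
  qed
  then show ?case by (simp add: source_preserving_def)
qed (auto simp: source_preserving_def op_add_def op_scale_def)

text \<open>A matrix coefficient is bounded by the operator norm, so its vanishing passes from the
  polynomial algebra to the norm closure.\<close>

lemma toeplitz_source_preserving:
  assumes T: "T \<in> toeplitz E s r"
  shows "source_preserving T"
  unfolding source_preserving_def
proof (intro allI impI)
  fix p q :: "'v \<times> 'e list" assume pq: "fst p \<noteq> fst q"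
  have bT: "bop T" using T by (rule toeplitz_bop)
  show "T (single q) p = 0"
  proof (cases "path q")
    case True
    have "cmod (T (single q) p) < \<epsilon>" if "\<epsilon> > 0" for \<epsilon>
    proof -
      obtain S where S: "S \<in> polyalg E s r" "opnorm E s r (op_diff T S) < \<epsilon>"
        using T \<open>\<epsilon> > 0\<close> unfolding toeplitz_def by blast
      have b: "bop (op_diff T S)" using bT polyalg_bop[OF S(1)] by (rule bop_diff)
      have "S (single q) p = 0" using polyalg_source_preserving[OF S(1)] pq by (simp add: source_preserving_def)
      then have "cmod (T (single q) p) = cmod (op_diff T S (single q) p)" by (simp add: op_diff_def)
      also have "\<dots> \<le> hnorm (op_diff T S (single q))"
        using True by (intro cmod_le_hnorm l2_sq_summable bop_l2[OF b]) simp
      also have "\<dots> \<le> opnorm E s r (op_diff T S)" using True by (intro opnorm_bound[OF b]) auto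
      finally show ?thesis using S(2) by simp
    qed
    then show ?thesis by (metis less_irrefl zero_less_norm_iff)
  next
    case False
    then show ?thesis using bop_not_l2[OF bT] by simp
  qed
qed

section \<open>State and KMS properties of the Gibbs functional\<close>

lemma bop_single_bound:
  assumes "bop T"
  obtains K where "K \<ge> 0" "\<And>p. sq_summable (T (single p))" "\<And>p. hnorm (T (single p)) \<le> K"
proof -
  obtain K where K: "K \<ge> 0" "\<And>f. f \<in> H \<Longrightarrow> hnorm (T f) \<le> K * hnorm f" using bop_bound[OF assms] by blast
  have "sq_summable (T (single p)) \<and> hnorm (T (single p)) \<le> K" for p
  proof (cases "path p")
    case True
    then show ?thesis using K(2)[of "single p"] l2_sq_summable[OF bop_l2[OF assms, of "single p"]] by simp
  next
    case False
    then show ?thesis using bop_not_l2[OF assms, of "single p"] K(1) by simp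
  qed
  then show ?thesis using that K(1) by blast
qed

lemma gibbs_diag_summable:
  assumes W: "gibbs_weight \<beta> v summable_on UNIV" and T: "bop T"
  shows "(\<lambda>p. of_real (gibbs_weight \<beta> v p) * T (single p) p) summable_on UNIV"
proof -
  obtain K where K: "K \<ge> 0" "\<And>p. sq_summable (T (single p))" "\<And>p. hnorm (T (single p)) \<le> K"
    using bop_single_bound[OF T] by blast
  have "(\<lambda>p. K * gibbs_weight \<beta> v p) summable_on UNIV" using W by (rule summable_on_cmult_right)
  then have "(\<lambda>p. cmod (of_real (gibbs_weight \<beta> v p) * T (single p) p)) summable_on UNIV"
  proof (rule summable_on_comparison_test)
    fix p
    have "cmod (T (single p) p) \<le> K" using cmod_le_hnorm[OF K(2)] K(3) order_trans by blast
    then show "cmod (of_real (gibbs_weight \<beta> v p) * T (single p) p) \<le> K * gibbs_weight \<beta> v p"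
      by (simp add: norm_mult mult.commute mult_right_mono)
  qed simp
  then show ?thesis by (rule abs_summable_summable)
qed

lemma gibbs_is_state:
  assumes W: "gibbs_weight \<beta> v summable_on UNIV"
  shows "is_state E s r (gibbs_state \<beta> v)"
  unfolding is_state_def
proof (intro conjI ballI allI)
  let ?Z = "\<Sum>\<^sub>\<infinity>p. gibbs_weight \<beta> v p"
  have Z: "?Z > 0" by (rule infsum_gibbs_weight_pos[OF W])
  note sm = gibbs_diag_summable[OF W]
  {
    fix S T c assume ST: "S \<in> toeplitz E s r" "T \<in> toeplitz E s r"
    let ?f = "\<lambda>T p. of_real (gibbs_weight \<beta> v p) * T (single p) p"
    have b: "bop S" "bop T" using ST toeplitz_bop by auto
    have "(\<Sum>\<^sub>\<infinity>p. c * ?f S p + ?f T p) = c * (\<Sum>\<^sub>\<infinity>p. ?f S p) + (\<Sum>\<^sub>\<infinity>p. ?f T p)"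
      using sm[OF b(1)] sm[OF b(2)] by (subst infsum_add) (auto intro: summable_on_cmult_right infsum_cmult_right)
    then show "gibbs_state \<beta> v (op_add (op_scale c S) T) = c * gibbs_state \<beta> v S + gibbs_state \<beta> v T"
      by (simp add: gibbs_state_def op_add_def op_scale_def add_divide_distrib algebra_simps)
  }
  {
    fix T assume "T \<in> toeplitz E s r"
    then have T: "bop T" by (rule toeplitz_bop)
    let ?g = "\<lambda>p. gibbs_weight \<beta> v p * (hnorm (T (single p)))\<^sup>2"
    \<comment> \<open>The diagonal coefficient of \<open>adj T \<circ> T\<close> at a path is the
      squared norm of a column of \<open>T\<close>.\<close>
    have eq: "of_real (gibbs_weight \<beta> v p) * (adj T \<circ> T) (single p) p = complex_of_real (?g p)" for p
    proof (cases "path p")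
      case True
      then show ?thesis using T by (simp add: adj_apply bop_l2 hinner_self)
    qed (simp add: gibbs_weight_def)
    have "(\<lambda>p. complex_of_real (?g p)) summable_on UNIV"
      using sm[OF bop_comp[OF bop_adj[OF T] T]] unfolding eq .
    then have "?g summable_on UNIV" using summable_on_Re by fastforce
    then have *: "gibbs_state \<beta> v (adj T \<circ> T) = of_real (infsum ?g UNIV / ?Z)"
      unfolding gibbs_state_def eq by (simp only: infsum_of_real_complex of_real_divide)
    show "gibbs_state \<beta> v (adj T \<circ> T) \<in> \<real>" unfolding * by simp
    show "Re (gibbs_state \<beta> v (adj T \<circ> T)) \<ge> 0"
      unfolding * Re_complex_of_real using Z by (intro divide_nonneg_pos infsum_nonneg) auto
  }
  have eq: "of_real (gibbs_weight \<beta> v p) * idop E s r (single p) p = complex_of_real (gibbs_weight \<beta> v p)" for p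
  proof -
    have "single p p = 1" by (simp add: single_def)
    then show ?thesis by (simp add: idop_def gibbs_weight_def)
  qed
  show "gibbs_state \<beta> v (idop E s r) = 1"
    unfolding gibbs_state_def eq infsum_of_real_complex[OF W] using Z by simp
qed

text \<open>For fixed \<open>p\<close>, Cauchy-Schwarz for row \<open>p\<close> of \<open>a\<close>
  and column \<open>p\<close> of \<open>b\<close> bounds the sum over \<open>q\<close> by a
  constant, and the weights are summable over \<open>p\<close>. This absolute convergence permits
  exchanging the two sums.\<close>

lemma gibbs_pair_summable:
  assumes W: "gibbs_weight \<beta> v summable_on UNIV" and a: "bop a" and b: "bop b"
  shows "(\<lambda>(p, q). gibbs_weight \<beta> v p * (cmod (a (single q) p) * cmod (b (single p) q))) summable_on UNIV \<times> UNIV"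
proof -
  let ?f = "\<lambda>(p, q). gibbs_weight \<beta> v p * (cmod (a (single q) p) * cmod (b (single p) q))"
  obtain Ka where Ka: "Ka \<ge> 0" "\<And>p. sq_summable (adj a (single p))" "\<And>p. hnorm (adj a (single p)) \<le> Ka"
    using bop_single_bound[OF bop_adj[OF a]] by blast
  obtain Kb where Kb: "Kb \<ge> 0" "\<And>p. sq_summable (b (single p))" "\<And>p. hnorm (b (single p)) \<le> Kb"
    using bop_single_bound[OF b] by blast
  have inner: "(\<lambda>q. ?f (p, q)) summable_on UNIV \<and> (\<Sum>\<^sub>\<infinity>q. ?f (p, q)) \<le> gibbs_weight \<beta> v p * (Ka * Kb)" for p
  proof (cases "path p")
    case True
    have "cmod (a (single q) p) = cmod (adj a (single p) q)" for q
      using adj_single[OF a True] by simp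
    then have eq: "?f (p, q) = gibbs_weight \<beta> v p * (cmod (adj a (single p) q) * cmod (b (single p) q))" for q
      by simp
    note sm = summable_on_mult_sq_summable[OF Ka(2) Kb(2), of p p]
    have "(\<Sum>\<^sub>\<infinity>q. ?f (p, q)) = gibbs_weight \<beta> v p * (\<Sum>\<^sub>\<infinity>q. cmod (adj a (single p) q) * cmod (b (single p) q))"
      unfolding eq using sm(1) by (simp add: infsum_cmult_right)
    also have "\<dots> \<le> gibbs_weight \<beta> v p * (Ka * Kb)"
      using sm(2) Ka Kb mult_mono[OF Ka(3) Kb(3) Ka(1) hnorm_nonneg, of p p]
      by (intro mult_left_mono) auto
    finally show ?thesis unfolding eq using sm(1) by (auto intro: summable_on_cmult_right)
  next
    case False
    then have "?f (p, q) = 0" for q by (simp add: gibbs_weight_def)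
    then show ?thesis using False by (simp add: gibbs_weight_def)
  qed
  have "(\<lambda>p. gibbs_weight \<beta> v p * (Ka * Kb)) summable_on UNIV" using W by (rule summable_on_cmult_left)
  then have outer: "(\<lambda>p. \<Sum>\<^sub>\<infinity>q. ?f (p, q)) summable_on UNIV"
    using inner[THEN conjunct2] by (rule summable_on_comparison_test) (auto intro!: infsum_nonneg)
  have nonneg: "?f x \<ge> 0" for x by (simp add: case_prod_unfold)
  then have nf: "norm (?f x) = ?f x" for x by simp
  have "(\<lambda>x. norm (?f x)) summable_on Sigma UNIV (\<lambda>_. UNIV)"
  proof (rule Infinite_Sum.abs_summable_on_Sigma_iff[THEN iffD2], intro conjI ballI)
    show "(\<lambda>q. norm (?f (p, q))) summable_on UNIV" for p
      unfolding nf using inner[of p] by blast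
    have "norm (\<Sum>\<^sub>\<infinity>q. ?f (p, q)) = (\<Sum>\<^sub>\<infinity>q. ?f (p, q))" for p
      using infsum_nonneg[of UNIV "\<lambda>q. ?f (p, q)"] nonneg by simp
    then show "(\<lambda>p. norm (\<Sum>\<^sub>\<infinity>q. norm (?f (p, q)))) summable_on UNIV"
      unfolding nf using outer by simp
  qed
  then show ?thesis unfolding nf .
qed

text \<open>Up to normalisation, the strip function is the sum over \<open>p\<close>,
  \<open>q\<close> of weight(p) * a_pq * b_qp * exp(i z (|q| - |p|)). For real \<open>z\<close>
  summing over \<open>q\<close> first gives the product with \<open>a\<close> on the left; at height
  \<open>\<beta>\<close> the exponential turns weight(p) into weight(q), and summing over
  \<open>p\<close> first gives the opposite product.\<close>

lemma gibbs_is_KMS: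
  assumes W: "gibbs_weight \<beta> v summable_on UNIV" and beta: "\<beta> > 0"
  shows "is_KMS E s r \<beta> (gibbs_state \<beta> v)"
  unfolding is_KMS_def
proof (intro conjI ballI gibbs_is_state[OF W])
  fix a b assume ab: "a \<in> toeplitz E s r" "b \<in> toeplitz E s r"
  have a: "bop a" and b: "bop b" using ab toeplitz_bop by auto
  let ?S = "{z. 0 \<le> Im z \<and> Im z \<le> \<beta>}"
  let ?U = "{z. 0 < Im z \<and> Im z < \<beta>}"
  let ?w = "gibbs_weight \<beta> v"
  define Z where "Z = (\<Sum>\<^sub>\<infinity>p. ?w p)"
  define l where "l x = complex_of_real (real (length (snd (snd x))) - real (length (snd (fst x))))"
    for x :: "('v \<times> 'e list) \<times> ('v \<times> 'e list)"
  define c where "c x = a (single (snd x)) (fst x) * b (single (fst x)) (snd x)" for x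
  define f where "f x z = of_real (?w (fst x)) * c x * exp (\<i> * z * l x)" for x z
  \<comment> \<open>On the strip the modulus of the weight interpolates between the weights of the
    two paths, so their sum is a majorant. Exchanging the roles of \<open>a\<close> and
    \<open>b\<close> handles the second summand.\<close>
  define D where "D x = (?w (fst x) + ?w (snd x)) * cmod (c x)" for x
  have "(\<lambda>(p, q). ?w p * (cmod (a (single q) p) * cmod (b (single p) q))) summable_on UNIV \<times> UNIV"
    by (rule gibbs_pair_summable[OF W a b])
  moreover have "(\<lambda>(p, q). ?w q * (cmod (b (single p) q) * cmod (a (single q) p))) summable_on UNIV \<times> UNIV"
    using gibbs_pair_summable[OF W b a]
      summable_on_reindex_bij_betw[of prod.swap UNIV UNIV "\<lambda>(p, q). ?w p * (cmod (b (single q) p) * cmod (a (single p) q))"]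
    by (simp add: case_prod_unfold)
  ultimately have "(\<lambda>x. (case x of (p, q) \<Rightarrow> ?w p * (cmod (a (single q) p) * cmod (b (single p) q))) +
     (case x of (p, q) \<Rightarrow> ?w q * (cmod (b (single p) q) * cmod (a (single q) p)))) summable_on UNIV \<times> UNIV"
    by (rule summable_on_add)
  then have D: "D summable_on UNIV"
    by (simp add: D_def[abs_def] c_def norm_mult case_prod_unfold algebra_simps)
  have supp: "path (fst x) \<and> path (snd x) \<and> fst (fst x) = fst (snd x)" if "c x \<noteq> 0" for x
  proof -
    have ne: "a (single (snd x)) \<noteq> (\<lambda>_. 0)" "b (single (fst x)) \<noteq> (\<lambda>_. 0)"
      using that by (auto simp: c_def)
    have "path (snd x)" using ne(1) bop_not_l2[OF a, of "single (snd x)"] unfolding single_l2_iff by blast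
    moreover have "path (fst x)" using ne(2) bop_not_l2[OF b, of "single (fst x)"] unfolding single_l2_iff by blast
    moreover have "fst (fst x) = fst (snd x)"
      using that toeplitz_source_preserving[OF ab(1)] by (auto simp: c_def source_preserving_def)
    ultimately show ?thesis by blast
  qed
  \<comment> \<open>\<open>- (\<beta> - y) m - y n\<close> lies between \<open>-\<beta> m\<close> and \<open>-\<beta> n\<close> for \<open>0 \<le> y \<le> \<beta>\<close>\<close>
  have le: "norm (f x z) \<le> D x" if z: "z \<in> ?S" for x z
  proof (cases "c x = 0 \<or> fst (fst x) \<noteq> v")
    case True
    then show ?thesis by (auto simp: f_def D_def gibbs_weight_def)
  next
    case False
    then have x: "path (fst x)" "path (snd x)" "fst (fst x) = v" "fst (snd x) = v" using supp[of x] by auto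
    let ?m = "real (length (snd (fst x)))" and ?n = "real (length (snd (snd x)))"
    have "Re (\<i> * z * l x) = - (Im z * (?n - ?m))" by (simp add: l_def)
    then have "norm (f x z) = exp (- \<beta> * ?m) * exp (- (Im z * (?n - ?m))) * cmod (c x)"
      using x by (simp add: f_def norm_mult gibbs_weight_def)
    also have "exp (- \<beta> * ?m) * exp (- (Im z * (?n - ?m))) = exp (- ((\<beta> - Im z) * ?m + Im z * ?n))"
      by (simp add: exp_add[symmetric] algebra_simps)
    also have "\<dots> \<le> exp (- \<beta> * ?m) + exp (- \<beta> * ?n)"
    proof (cases "?m \<le> ?n")
      case True
      then have "\<beta> * ?m \<le> (\<beta> - Im z) * ?m + Im z * ?n"
        using z mult_left_mono[of ?m ?n "Im z"] by (simp add: algebra_simps)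
      then have "exp (- ((\<beta> - Im z) * ?m + Im z * ?n)) \<le> exp (- \<beta> * ?m)" by simp
      then show ?thesis using exp_ge_zero[of "- \<beta> * ?n"] by linarith
    next
      case False
      then have "\<beta> * ?n \<le> (\<beta> - Im z) * ?m + Im z * ?n"
        using z mult_left_mono[of ?n ?m "\<beta> - Im z"] by (simp add: algebra_simps)
      then have "exp (- ((\<beta> - Im z) * ?m + Im z * ?n)) \<le> exp (- \<beta> * ?n)" by simp
      then show ?thesis using exp_ge_zero[of "- \<beta> * ?m"] by linarith
    qed
    finally show ?thesis using x by (simp add: D_def gibbs_weight_def mult_right_mono)
  qed
  define F where "F z = (\<Sum>\<^sub>\<infinity>x. f x z) / of_real Z" for z
  have lim: "uniform_limit ?S (\<lambda>X z. \<Sum>x\<in>X. f x z) (\<lambda>z. \<Sum>\<^sub>\<infinity>x. f x z) (finite_subsets_at_top UNIV)"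
    using D le by (rule uniform_limit_infsum)
  have fsum: "(\<lambda>x. norm (f x z)) summable_on UNIV" if "z \<in> ?S" for z
    using D le[OF that] by (rule summable_on_comparison_test) auto
  have "continuous_on ?S (\<lambda>z. \<Sum>\<^sub>\<infinity>x. f x z)"
    by (rule uniform_limit_theorem[OF _ lim]) (auto simp: f_def intro!: always_eventually continuous_intros)
  then have F1: "continuous_on ?S F"
    unfolding F_def divide_inverse by (intro continuous_intros)
  have "(\<lambda>z. \<Sum>\<^sub>\<infinity>x. f x z) holomorphic_on ?U"
  proof (rule holomorphic_on_uniform_limit[OF _ _ _ lim])
    show "open ?U" by (intro open_Collect_conj open_halfspace_Im_gt open_halfspace_Im_lt)
    show "(\<lambda>z. \<Sum>x\<in>X. f x z) holomorphic_on ?U" for X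
      unfolding f_def by (intro holomorphic_intros)
  qed auto
  then have F2: "F holomorphic_on ?U"
    unfolding F_def divide_inverse by (intro holomorphic_intros)
  have "norm (F z) \<le> infsum D UNIV / norm Z" if z: "z \<in> ?S" for z
  proof -
    have "norm (\<Sum>\<^sub>\<infinity>x. f x z) \<le> (\<Sum>\<^sub>\<infinity>x. norm (f x z))" by (rule norm_infsum_bound[OF fsum[OF z]])
    also have "\<dots> \<le> infsum D UNIV" using fsum[OF z] D le[OF z] by (intro infsum_mono) auto
    finally show ?thesis by (simp add: F_def norm_divide divide_right_mono)
  qed
  then have F3: "bounded (F ` ?S)" by (auto simp: bounded_iff)
  have F4: "F (of_real t) = gibbs_state \<beta> v (a \<circ> sigma E s r t b)" for t :: real
  proof -
    have "of_real t \<in> ?S" using beta by simp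
    from abs_summable_summable[OF fsum[OF this]]
    have sum: "(\<lambda>x. f x (of_real t)) summable_on UNIV \<times> UNIV"
      unfolding UNIV_Times_UNIV .
    have "(\<Sum>\<^sub>\<infinity>q. f (p, q) (of_real t)) = of_real (?w p) * (a \<circ> sigma E s r t b) (single p) p" for p
    proof (cases "path p")
      case True
      then have "single p \<in> H" by simp
      then have g: "sigma E s r t b (single p) \<in> H" by (rule bop_l2[OF bop_sigma[OF b]])
      note ex = bop_apply_expand[OF a g True]
      have "(\<Sum>\<^sub>\<infinity>q. f (p, q) (of_real t)) = (\<Sum>\<^sub>\<infinity>q. of_real (?w p) * (a (single q) p * sigma E s r t b (single p) q))"
        unfolding sigma_single[OF b True]
        by (intro infsum_cong) (simp add: f_def c_def l_def mult_ac)
      also have "\<dots> = of_real (?w p) * (\<Sum>\<^sub>\<infinity>q. a (single q) p * sigma E s r t b (single p) q)"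
        using abs_summable_summable[OF ex(1)] by (intro infsum_cmult_right)
      finally show ?thesis using ex(2) by simp
    qed (simp add: f_def gibbs_weight_def)
    then show ?thesis
      unfolding F_def gibbs_state_def Z_def using infsum_Sigma_banach[OF sum] by simp
  qed
  have F5: "F (of_real t + \<i> * of_real \<beta>) = gibbs_state \<beta> v (sigma E s r t b \<circ> a)" for t :: real
  proof -
    let ?z = "of_real t + \<i> * of_real \<beta>"
    have "?z \<in> ?S" using beta by simp
    from abs_summable_summable[OF fsum[OF this]]
    have sum: "(\<lambda>x. f x ?z) summable_on UNIV \<times> UNIV"
      unfolding UNIV_Times_UNIV .
    then have swap: "(\<Sum>\<^sub>\<infinity>p. \<Sum>\<^sub>\<infinity>q. f (p, q) ?z) = (\<Sum>\<^sub>\<infinity>q. \<Sum>\<^sub>\<infinity>p. f (p, q) ?z)"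
      by (intro infsum_swap_banach) (simp only: case_prod_unfold prod.collapse)
    \<comment> \<open>Equal sources are essential here: otherwise one of the two weights could be 0
      and the other not.\<close>
    have fz: "f (p, q) ?z = of_real (?w q) * (sigma E s r t b (single p) q * a (single q) p)" for p q
    proof (cases "c (p, q) = 0")
      case True
      then have "a (single q) p = 0 \<or> b (single p) q = 0" by (simp add: c_def)
      moreover have "sigma E s r t b (single p) q = 0" if "b (single p) q = 0"
        using that sigma_single[OF b, of p t q] bop_not_l2[OF bop_sigma[OF b], of "single p" t]
        by (cases "path p") auto
      ultimately show ?thesis using True by (auto simp: f_def)
    next
      case False
      then have pq: "path p" "path q" "fst p = fst q" using supp[of "(p, q)"] by auto
      let ?m = "real (length (snd p))" and ?n = "real (length (snd q))"
      have "exp (\<i> * ?z * l (p, q)) = exp (\<i> * of_real t * (of_real ?n - of_real ?m)) * of_real (exp (- \<beta> * (?n - ?m)))"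
        unfolding exp_of_real[symmetric] exp_add[symmetric] by (simp add: l_def algebra_simps)
      moreover have "?w q = ?w p * exp (- \<beta> * (?n - ?m))"
        using pq by (simp add: gibbs_weight_def exp_add[symmetric] algebra_simps)
      ultimately show ?thesis
        unfolding sigma_single[OF b pq(1)] by (simp add: f_def c_def mult_ac)
    qed
    have "(\<Sum>\<^sub>\<infinity>p. f (p, q) ?z) = of_real (?w q) * (sigma E s r t b \<circ> a) (single q) q" for q
    proof (cases "path q")
      case True
      have g: "a (single q) \<in> H" using True by (intro bop_l2[OF a]) simp
      note ex = bop_apply_expand[OF bop_sigma[OF b] g True]
      have "(\<Sum>\<^sub>\<infinity>p. f (p, q) ?z) = of_real (?w q) * (\<Sum>\<^sub>\<infinity>p. sigma E s r t b (single p) q * a (single q) p)"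
        unfolding fz using abs_summable_summable[OF ex(1)] by (intro infsum_cmult_right)
      then show ?thesis using ex(2) by simp
    qed (simp add: fz gibbs_weight_def)
    then show ?thesis
      unfolding F_def gibbs_state_def Z_def
      using infsum_Sigma_banach[OF sum] swap by simp
  qed
  show "\<exists>F. continuous_on ?S F \<and> F holomorphic_on ?U \<and> bounded (F ` ?S) \<and>
      (\<forall>t::real. F (of_real t) = gibbs_state \<beta> v (a \<circ> sigma E s r t b) \<and>
        F (of_real t + \<i> * of_real \<beta>) = gibbs_state \<beta> v (sigma E s r t b \<circ> a))"
    using F1 F2 F3 F4 F5 by blast
qed

section \<open>The infimum of the admissible inverse temperatures\<close>

lemma exists_KMS:
  assumes C: "C \<in> components E s r" "is_sink E s r C" and beta: "\<beta> > 0" "spec_rad E s r C < exp \<beta>"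
  shows "\<exists>\<phi>. is_KMS E s r \<beta> \<phi>"
proof -
  obtain v where "v \<in> C" using component_nonempty[OF C(1)] by blast
  then show ?thesis using gibbs_is_KMS[OF summable_gibbs_weight[OF C _ beta(2)] beta(1)] by blast
qed

text \<open>States are supplied for \<open>\<beta> > M\<close> only, so the upper bound comes from
  \<open>M + e\<close> with arbitrary \<open>e > 0\<close>; \<open>M + 1\<close> shows that the set
  is nonempty, which the real \<open>Inf\<close> requires.\<close>

lemma hX_eqI:
  assumes M: "M \<ge> 0"
    and lower: "\<And>\<beta> \<phi>. \<beta> > 0 \<Longrightarrow> is_KMS E s r \<beta> \<phi> \<Longrightarrow> M \<le> \<beta>"
    and upper: "\<And>\<beta>. \<beta> > M \<Longrightarrow> \<exists>\<phi>. is_KMS E s r \<beta> \<phi>"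
  shows "hX E s r = M"
proof -
  let ?B = "{\<beta>. \<beta> > 0 \<and> (\<exists>\<phi>. is_KMS E s r \<beta> \<phi>)}"
  have mem: "\<beta> \<in> ?B" if "\<beta> > M" for \<beta> using that M upper by auto
  have "Inf ?B \<le> M + e" if "e > 0" for e
    using mem[of "M + e"] that by (intro cInf_lower bdd_belowI[of _ 0]) auto
  then have "Inf ?B \<le> M" by (rule field_le_epsilon)
  moreover have "M \<le> Inf ?B" using mem[of "M + 1"] lower by (intro cInf_greatest) auto
  ultimately show ?thesis by (simp add: hX_def)
qed

text \<open>A zero sink is a vertex without outgoing edges. The empty path is the only path from it,
  so its Gibbs state exists for every positive \<open>\<beta>\<close>.\<close>

lemma hX_zero_sink:
  assumes "C \<in> components E s r" "is_sink E s r C" "zero_comp E s r C"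
  shows "hX E s r = 0"
proof (rule hX_eqI)
  fix \<beta> :: real assume "\<beta> > 0"
  then show "\<exists>\<phi>. is_KMS E s r \<beta> \<phi>"
    using exists_KMS[OF assms(1,2)] spec_rad_zero_comp[OF assms(1,3)] by simp
qed auto

lemma hX_nonzero_sinks:
  assumes nz: "\<not> (\<exists>C\<in>components E s r. is_sink E s r C \<and> zero_comp E s r C)"
  shows "hX E s r = Min ((\<lambda>C. logc (spec_rad E s r C)) ` {C\<in>components E s r. is_sink E s r C \<and> \<not> zero_comp E s r C})"
    (is "_ = Min (?f ` ?A)")
proof (rule hX_eqI)
  have fin: "finite (?f ` ?A)" by simp
  \<comment> \<open>Every finite graph has a sink component, so the minimum is over a nonempty
    set.\<close>
  obtain w where "is_sink E s r (comp_of E s r w)" using exists_reachable_sink by blast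
  then have "comp_of E s r w \<in> ?A" using nz by auto
  then have "Min (?f ` ?A) \<in> ?f ` ?A" by (intro Min_in fin) blast
  then obtain C where C: "C \<in> components E s r" "is_sink E s r C" "\<not> zero_comp E s r C" "Min (?f ` ?A) = ?f C" by auto
  show "0 \<le> Min (?f ` ?A)" unfolding C(4) by (rule logc_spec_rad_nonneg[OF C(1)])
  have lnC: "?f C = ln (spec_rad E s r C)" "spec_rad E s r C \<ge> 1"
    using spec_rad_nonzero_comp[OF C(1,3)] by (auto simp: logc_def)
  show "\<exists>\<phi>. is_KMS E s r \<beta> \<phi>" if beta: "\<beta> > Min (?f ` ?A)" for \<beta>
  proof (rule exists_KMS[OF C(1,2)])
    show "\<beta> > 0" using beta unfolding C(4) using logc_spec_rad_nonneg[OF C(1)] by linarith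
    have "exp (ln (spec_rad E s r C)) < exp \<beta>" using beta unfolding C(4) lnC(1) by simp
    then show "spec_rad E s r C < exp \<beta>" using lnC(2) by simp
  qed
  fix \<beta> \<phi> assume "\<beta> > 0" "is_KMS E s r \<beta> \<phi>"
  then obtain C' where C': "C' \<in> components E s r" "is_sink E s r C'" "spec_rad E s r C' \<le> exp \<beta>"
    using KMS_imp_sink_bound by blast
  then have nzC': "\<not> zero_comp E s r C'" using nz by blast
  then have 1: "spec_rad E s r C' \<ge> 1" by (rule spec_rad_nonzero_comp[OF C'(1)])
  have "Min (?f ` ?A) \<le> ?f C'" using C' nzC' by (intro Min_le fin) auto
  also have "\<dots> = ln (spec_rad E s r C')" using 1 by (simp add: logc_def)
  also have "\<dots> \<le> ln (exp \<beta>)" using 1 C'(3) by (intro ln_mono) auto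
  finally show "Min (?f ` ?A) \<le> \<beta>" by simp
qed

end

section \<open>The entropies of a finite graph\<close>

theorem theorem8p9:
  fixes E :: "'e set" and s r :: "'e \<Rightarrow> 'v::finite"
  assumes "finite E"
  shows "hXs E s r = ereal (Max ((\<lambda>C. logc (spec_rad E s r C)) ` components E s r)) \<and>
         ((\<exists>C\<in>components E s r. is_sink E s r C \<and> zero_comp E s r C) \<longrightarrow> hX E s r = 0) \<and>
         (\<not> (\<exists>C\<in>components E s r. is_sink E s r C \<and> zero_comp E s r C) \<longrightarrow>
           hX E s r = Min ((\<lambda>C. logc (spec_rad E s r C)) `
                        {C\<in>components E s r. is_sink E s r C \<and> \<not> zero_comp E s r C}))"
proof -
  interpret finite_graph E s r using assms by unfold_locales
  show ?thesis using hXs_eq hX_zero_sink hX_nonzero_sinks by blast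
qed

end
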